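(* Let $p\in[0,1]$ be fixed and let $(G_n)_{n\ge1}$ be a sequence of finite simple graphs with $|V(G_n)|=n$. Then $(G_n)$ is $p$-quasirandom if and only if it converges to a graphon $\mathcal{G}$ with $$\psi_{\mathcal{G}}(z)=(1-pz)\exp\left(pz-\frac{p(1-p)}{2}z^2\right).$$ Furthermore, when this occurs, one can write $$\psi_{\mathcal{G}}(z)=\sum_{k=0}^\infty z^k\sum_{i,j\ge 0}\ \sum_{\lambda\in\Lambda(k;i,j)}\frac{(-1)^j p^{k-i}}{\eta(\lambda)},$$ where $\Lambda(k;i,j)$ is the set of integer partitions of $k$ into $j$ parts, each of size at least $2$, of which exactly $i$ are of size exactly $2$.
   Context: A graphon $\mathcal{G}$ is (represented by) a symmetric measurable function $\mathcal{G}:[0,1]^2\to[0,1]$; two such kernels $U,W$ represent the same graphon if there are measure-preserving maps $f,g:[0,1]\to[0,1]$ with $U(f(x),f(y))=W(g(x),g(y))$ for almost every $(x,y)$. The kernel defines a self-adjoint Hilbert-Schmidt integral operator on $L^2([0,1])$ by $h\mapsto \int_0^1 \mathcal{G}(\cdot,y)h(y)\,dy$; "eigenvalues of $\mathcal{G}$" means eigenvalues of this operator, counted with multiplicity. $\|\mathcal{G}\|_1=\int_{[0,1]^2}|\mathcal{G}|$ and $\|\mathcal{G}\|_2^2=\int_{[0,1]^2}|\mathcal{G}|^2$. Convergence $G_n\to\mathcal{G}$ means left-convergence: for every finite simple graph $F$, $t(F,G_n)\to t(F,\mathcal{G})$, where $t(F,G)$ is the number of homomorphisms $F\to G$ divided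 by $|V(G)|^{|V(F)|}$, and $t(F,\mathcal{G})=\int_{[0,1]^{V(F)}}\prod_{uv\in E(F)}\mathcal{G}(x_u,x_v)\prod_{v\in V(F)} dx_v$. The characteristic power series of a graphon $\mathcal{G}$ is $$\psi_{\mathcal{G}}(z)=\det{}^{(2)}(I-z\mathcal{G})\,\exp\left(z^2\cdot\frac{\|\mathcal{G}\|_2^2-\|\mathcal{G}\|_1}{2}\right),$$ where $\det^{(2)}(I-z\mathcal{G})=\prod_j (1-\lambda_j z)\exp(\lambda_j z)$, the product being over the eigenvalues $\lambda_j$ of $\mathcal{G}$ with multiplicity. A sequence $(G_n)$ with $|V(G_n)|=n$ is $p$-quasirandom if it satisfies the (equivalent) quasi-random properties of Chung, Graham and Wilson; concretely: for every $s\geq 1$ and every graph $H$ on $s$ vertices, the number of injective homomorphisms from $H$ to $G_n$ is $n^{s}(p^{|E(H)|}+o(1))$ as $n\to\infty$. For an integer partition $\lambda$ in which the distinct part sizes $b_i$ occur with multiplicities $m_i$, $\eta(\lambda)=\prod_i b_i^{m_i}m_i!$ (so $\eta$ of the empty partition is $1$). Convention: $p^0=1$. *)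

theory Defs
  imports "HOL-Analysis.Analysis" "HOL-Library.Multiset"
begin

type_synonym 'a sgraph = "'a set \<times> 'a set set"

abbreviation verts :: "'a sgraph \<Rightarrow> 'a set" where "verts \<equiv> fst"
abbreviation edges :: "'a sgraph \<Rightarrow> 'a set set" where "edges \<equiv> snd"

definition simple_graph :: "'a sgraph \<Rightarrow> bool" where
  "simple_graph G \<longleftrightarrow> finite (verts G) \<and> (\<forall>e\<in>edges G. e \<subseteq> verts G \<and> card e = 2)"

definition homs :: "'b sgraph \<Rightarrow> 'a sgraph \<Rightarrow> ('b \<Rightarrow> 'a) set" where
  "homs F G = {\<phi> \<in> verts F \<rightarrow>\<^sub>E verts G. \<forall>e\<in>edges F. \<phi> ` e \<in> edges G}"

definition inj_homs :: "'b sgraph \<Rightarrow> 'a sgraph \<Rightarrow> ('b \<Rightarrow> 'a) set" where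
  "inj_homs F G = {\<phi> \<in> homs F G. inj_on \<phi> (verts F)}"

definition hom_density :: "'b sgraph \<Rightarrow> 'a sgraph \<Rightarrow> real" where
  "hom_density F G = real (card (homs F G)) / real (card (verts G)) ^ card (verts F)"

text \<open>Test graphs are taken with natural-number vertices; every finite graph is isomorphic to
  such a graph.\<close>

definition quasirandom :: "real \<Rightarrow> (nat \<Rightarrow> 'a sgraph) \<Rightarrow> bool" where
  "quasirandom p G \<longleftrightarrow>
     (\<forall>s\<ge>1. \<forall>H :: nat sgraph. simple_graph H \<and> card (verts H) = s \<longrightarrow>
        (\<lambda>n. real (card (inj_homs H (G n))) / real n ^ s) \<longlonglongrightarrow> p ^ card (edges H))"

abbreviation unit_leb :: "real measure" where
  "unit_leb \<equiv> restrict_space lborel {0..1}"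

text \<open>Kernels are Borel measurable on the unit square; every Lebesgue measurable kernel agrees almost
  everywhere with a symmetric Borel one and hence represents the same graphon.\<close>

definition graphon :: "(real \<Rightarrow> real \<Rightarrow> real) \<Rightarrow> bool" where
  "graphon W \<longleftrightarrow>
     (\<lambda>(x, y). W x y) \<in> borel_measurable (unit_leb \<Otimes>\<^sub>M unit_leb) \<and>
     (\<forall>x\<in>{0..1}. \<forall>y\<in>{0..1}. W x y = W y x \<and> W x y \<in> {0..1})"

definition graphon_norm1 :: "(real \<Rightarrow> real \<Rightarrow> real) \<Rightarrow> real" where
  "graphon_norm1 W = (\<integral>(x, y). \<bar>W x y\<bar> \<partial>(unit_leb \<Otimes>\<^sub>M unit_leb))"

definition graphon_norm2 :: "(real \<Rightarrow> real \<Rightarrow> real) \<Rightarrow> real" where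
  "graphon_norm2 W = sqrt (\<integral>(x, y). \<bar>W x y\<bar>\<^sup>2 \<partial>(unit_leb \<Otimes>\<^sub>M unit_leb))"

text \<open>An edge \<open>e = {u, v}\<close> contributes \<open>W (x u) (x v)\<close>; as \<open>W\<close> is symmetric, the order of the
  endpoints, here \<open>Min e\<close> and \<open>Max e\<close>, is immaterial.\<close>

definition graphon_density :: "nat sgraph \<Rightarrow> (real \<Rightarrow> real \<Rightarrow> real) \<Rightarrow> real" where
  "graphon_density F W =
     (\<integral>x. (\<Prod>e\<in>edges F. W (x (Min e)) (x (Max e))) \<partial>(\<Pi>\<^sub>M v\<in>verts F. unit_leb))"

definition left_converges :: "(nat \<Rightarrow> 'a sgraph) \<Rightarrow> (real \<Rightarrow> real \<Rightarrow> real) \<Rightarrow> bool" where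
  "left_converges G W \<longleftrightarrow>
     (\<forall>F :: nat sgraph. simple_graph F \<longrightarrow>
        (\<lambda>n. hom_density F (G n)) \<longlonglongrightarrow> graphon_density F W)"

definition sq_integrable :: "(real \<Rightarrow> real) \<Rightarrow> bool" where
  "sq_integrable f \<longleftrightarrow> f \<in> borel_measurable unit_leb \<and> integrable unit_leb (\<lambda>x. (f x)\<^sup>2)"

definition L2_eq :: "(real \<Rightarrow> real) \<Rightarrow> (real \<Rightarrow> real) \<Rightarrow> bool" where
  "L2_eq f g \<longleftrightarrow> sq_integrable f \<and> sq_integrable g \<and> (AE x in unit_leb. f x = g x)"

lemma sq_integrable_zero: "sq_integrable (\<lambda>x. 0)"
  by (simp add: sq_integrable_def)

lemma sq_integrable_scale: "sq_integrable f \<Longrightarrow> sq_integrable (\<lambda>x. c * f x)"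
  by (auto simp: sq_integrable_def power_mult_distrib)

lemma sq_integrable_add:
  assumes "sq_integrable f" "sq_integrable g"
  shows "sq_integrable (\<lambda>x. f x + g x)"
proof -
  have [measurable]: "f \<in> borel_measurable unit_leb" "g \<in> borel_measurable unit_leb"
    using assms by (auto simp: sq_integrable_def)
  have "integrable unit_leb (\<lambda>x. 2 * (f x)\<^sup>2 + 2 * (g x)\<^sup>2)"
    using assms by (auto simp: sq_integrable_def)
  then have "integrable unit_leb (\<lambda>x. (f x + g x)\<^sup>2)"
  proof (rule Bochner_Integration.integrable_bound)
    have "(f x + g x)\<^sup>2 \<le> 2 * (f x)\<^sup>2 + 2 * (g x)\<^sup>2" for x
      using zero_le_power2[of "f x - g x"] by (simp add: power2_sum power2_diff)
    then show "AE x in unit_leb. norm ((f x + g x)\<^sup>2) \<le> norm (2 * (f x)\<^sup>2 + 2 * (g x)\<^sup>2)"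
      by simp
  qed measurable
  then show ?thesis by (simp add: sq_integrable_def)
qed

quotient_type L2 = "real \<Rightarrow> real" / partial: L2_eq
proof (rule part_equivpI)
  show "\<exists>f. L2_eq f f"
    using sq_integrable_zero by (auto simp: L2_eq_def)
  show "symp L2_eq"
    by (auto simp: symp_def L2_eq_def)
  show "transp L2_eq"
    unfolding transp_def L2_eq_def by (auto elim: eventually_elim2)
qed

instantiation L2 :: real_vector
begin

lift_definition zero_L2 :: L2 is "\<lambda>x. 0"
  by (simp add: L2_eq_def sq_integrable_zero)

lift_definition plus_L2 :: "L2 \<Rightarrow> L2 \<Rightarrow> L2" is "\<lambda>f g x. f x + g x"
  by (auto simp: L2_eq_def intro: sq_integrable_add)

lift_definition uminus_L2 :: "L2 \<Rightarrow> L2" is "\<lambda>f x. - f x"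
  using sq_integrable_scale[where c = "-1"] by (auto simp: L2_eq_def)

lift_definition minus_L2 :: "L2 \<Rightarrow> L2 \<Rightarrow> L2" is "\<lambda>f g x. f x - g x"
  using sq_integrable_add[OF _ sq_integrable_scale[where c = "-1"]] by (auto simp: L2_eq_def)

lift_definition scaleR_L2 :: "real \<Rightarrow> L2 \<Rightarrow> L2" is "\<lambda>c f x. c * f x"
  by (auto simp: L2_eq_def intro: sq_integrable_scale)

instance
proof
  fix a b c :: L2 and r s :: real
  show "a + b + c = a + (b + c)"
    by transfer (simp add: L2_eq_def sq_integrable_add add.assoc)
  show "a + b = b + a"
    by transfer (simp add: L2_eq_def sq_integrable_add add.commute)
  show "0 + a = a"
    by transfer (simp add: L2_eq_def)
  show "- a + a = 0"
    by transfer (simp add: L2_eq_def sq_integrable_zero)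
  show "a - b = a + - b"
    by transfer (use sq_integrable_add[OF _ sq_integrable_scale[where c = "-1"]] in
        \<open>simp add: L2_eq_def\<close>)
  show "r *\<^sub>R (a + b) = r *\<^sub>R a + r *\<^sub>R b"
    by transfer (simp add: L2_eq_def sq_integrable_add sq_integrable_scale distrib_left)
  show "(r + s) *\<^sub>R a = r *\<^sub>R a + s *\<^sub>R a"
    by transfer (simp add: L2_eq_def sq_integrable_add sq_integrable_scale distrib_right)
  show "r *\<^sub>R s *\<^sub>R a = (r * s) *\<^sub>R a"
    by transfer (simp add: L2_eq_def sq_integrable_scale mult.assoc)
  show "1 *\<^sub>R a = a"
    by transfer (simp add: L2_eq_def)
qed

end

text \<open>For a graphon \<open>W\<close> the integrand below is integrable, the resulting function is square
  integrable, and its class does not depend on the representative \<open>rep_L2 h\<close>.\<close>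

definition graphon_op :: "(real \<Rightarrow> real \<Rightarrow> real) \<Rightarrow> L2 \<Rightarrow> L2" where
  "graphon_op W h = abs_L2 (\<lambda>x. \<integral>y. W x y * rep_L2 h y \<partial>unit_leb)"

definition eigenspace :: "(real \<Rightarrow> real \<Rightarrow> real) \<Rightarrow> real \<Rightarrow> L2 set" where
  "eigenspace W \<mu> = {h. graphon_op W h = \<mu> *\<^sub>R h}"

definition eigenvalues :: "(real \<Rightarrow> real \<Rightarrow> real) \<Rightarrow> real set" where
  "eigenvalues W = {\<mu>. \<exists>h\<in>eigenspace W \<mu>. h \<noteq> 0}"

text \<open>The (unconditionally convergent) product over the eigenvalues with multiplicity is the limit
  of the finite subproducts. Nonzero eigenvalues have finite multiplicity; for the eigenvalue \<open>0\<close>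
  the factor is \<open>1\<close>, so it is harmless that \<open>dim\<close> is \<open>0\<close> on infinite-dimensional spaces.\<close>

definition det2 :: "(real \<Rightarrow> real \<Rightarrow> real) \<Rightarrow> complex \<Rightarrow> complex" where
  "det2 W z =
     Lim (finite_subsets_at_top (eigenvalues W))
       (\<lambda>A. \<Prod>\<mu>\<in>A. ((1 - of_real \<mu> * z) * exp (of_real \<mu> * z)) ^ dim (eigenspace W \<mu>))"

definition char_series :: "(real \<Rightarrow> real \<Rightarrow> real) \<Rightarrow> complex \<Rightarrow> complex" where
  "char_series W z =
     det2 W z * exp (z\<^sup>2 * of_real (((graphon_norm2 W)\<^sup>2 - graphon_norm1 W) / 2))"

definition partitions :: "nat \<Rightarrow> nat \<Rightarrow> nat \<Rightarrow> nat multiset set" where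
  "partitions k i j =
     {\<Lambda>. sum_mset \<Lambda> = k \<and> size \<Lambda> = j \<and> (\<forall>b\<in>#\<Lambda>. 2 \<le> b) \<and> count \<Lambda> 2 = i}"

definition eta :: "nat multiset \<Rightarrow> nat" where
  "eta \<Lambda> = (\<Prod>b\<in>set_mset \<Lambda>. b ^ count \<Lambda> b * fact (count \<Lambda> b))"

end

theory Submission
  imports Defs "HOL-Probability.Probability" "HOL-Complex_Analysis.Complex_Analysis"
begin

text \<open>Both conditions are equivalent to the limit kernel being almost everywhere equal to \<open>p\<close>.
  A kernel with edge density \<open>p\<close> and 4-cycle density \<open>p\<^sup>4\<close> is constant, because equality
  holds throughout the Cauchy--Schwarz estimates and because \<open>K \<circ> K = 0\<close> forces \<open>K = 0\<close> for
  symmetric \<open>K\<close>. Conversely, every nonzero eigenvalue of \<open>W\<close> is the reciprocal of a zero of the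
  characteristic power series; if the series has the stated form, the only nonzero eigenvalue is
  \<open>p\<close>, with multiplicity one, so \<open>W = p f \<otimes> f\<close> with \<open>f\<close> of norm one by the existence of
  eigenfunctions for nonzero symmetric kernels. Comparing the quadratic exponents gives
  \<open>\<parallel>W\<parallel>\<^sub>1 = p\<close>, so \<open>f\<close> has mean \<open>\<plusminus>1\<close> and is constant. The partition expansion
  holds because both sides solve the same first-order linear differential equation.\<close>

section \<open>Bounded measurable functions and kernels\<close>

text \<open>The spectrum cannot single out the constant kernel: \<open>p f(x) f(y)\<close> has
  \<open>p\<close> as its only nonzero eigenvalue for every \<open>f\<close> of norm one. The
  missing information sits in the exponential factor of the series, whose term
  \<open>graphon_norm1\<close> sees the mean of \<open>f\<close>; for the constant kernel its
  exponent is \<open>(p^2 - p) z^2 / 2\<close>, which is where the quadratic term comes from.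

  The eigenfunction theorem is proved within bounded functions on a probability space. This class is
  closed under products, iterated integrals and bounded pointwise limits, and a bounded kernel sends
  every square integrable function into it; so Fubini applies throughout, and eigenfunctions for
  nonzero eigenvalues have bounded representatives.

  \<open>det2\<close> is a limit over finite sets of eigenvalues. It is evaluated in two situations:
  at the reciprocal of a nonzero eigenvalue, where all large subproducts contain a zero factor, and
  for a finite spectrum. In both, \<open>dim\<close> can be read as a multiplicity only after the
  eigenspace is known to be finite-dimensional.

  For a quasirandom sequence the constant kernel is exhibited as a limit; any other limit is shown
  to agree with it almost everywhere.\<close>

definition bounded_measurable :: "'a measure \<Rightarrow> ('a \<Rightarrow> real) \<Rightarrow> bool" where
  "bounded_measurable N f \<longleftrightarrow> f \<in> borel_measurable N \<and> (\<exists>B. \<forall>x\<in>space N. \<bar>f x\<bar> \<le> B)"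

lemma bounded_measurableI:
  "f \<in> borel_measurable N \<Longrightarrow> (\<And>x. x \<in> space N \<Longrightarrow> \<bar>f x\<bar> \<le> B) \<Longrightarrow> bounded_measurable N f"
  by (auto simp: bounded_measurable_def)

lemma bounded_measurableD [measurable_dest]:
  "bounded_measurable N f \<Longrightarrow> f \<in> borel_measurable N"
  by (auto simp: bounded_measurable_def)

lemma bounded_measurable_bound:
  assumes "bounded_measurable N f"
  obtains B where "B \<ge> 0" "\<And>x. x \<in> space N \<Longrightarrow> \<bar>f x\<bar> \<le> B"
proof -
  obtain B where "\<forall>x\<in>space N. \<bar>f x\<bar> \<le> B"
    using assms by (auto simp: bounded_measurable_def)
  then show ?thesis
    using that[of "max B 0"] by fastforce
qed

lemma bounded_measurable_const: "bounded_measurable N (\<lambda>_. c)"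
  by (rule bounded_measurableI[where B = "\<bar>c\<bar>"]) auto

lemma bounded_measurable_add:
  assumes "bounded_measurable N f" "bounded_measurable N g"
  shows "bounded_measurable N (\<lambda>x. f x + g x)"
proof -
  obtain B C where "\<And>x. x \<in> space N \<Longrightarrow> \<bar>f x\<bar> \<le> B" "\<And>x. x \<in> space N \<Longrightarrow> \<bar>g x\<bar> \<le> C"
    using assms by (metis bounded_measurable_bound)
  then show ?thesis
    using assms by (intro bounded_measurableI[where B = "B + C"])
      (auto intro!: order_trans[OF abs_triangle_ineq] add_mono dest: bounded_measurableD)
qed

lemma bounded_measurable_mult:
  assumes "bounded_measurable N f" "bounded_measurable N g"
  shows "bounded_measurable N (\<lambda>x. f x * g x)"
proof -
  obtain B C where "B \<ge> 0" "\<And>x. x \<in> space N \<Longrightarrow> \<bar>f x\<bar> \<le> B" "\<And>x. x \<in> space N \<Longrightarrow> \<bar>g x\<bar> \<le> C"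
    using assms by (metis bounded_measurable_bound)
  then show ?thesis
    using assms by (intro bounded_measurableI[where B = "B * C"])
      (auto intro!: mult_mono simp: abs_mult dest: bounded_measurableD)
qed

lemma bounded_measurable_diff:
  assumes "bounded_measurable N f" "bounded_measurable N g"
  shows "bounded_measurable N (\<lambda>x. f x - g x)"
  using bounded_measurable_add[OF assms(1)
      bounded_measurable_mult[OF bounded_measurable_const[of _ "-1"] assms(2)]] by simp

lemma bounded_measurable_divide:
  assumes "bounded_measurable N f"
  shows "bounded_measurable N (\<lambda>x. f x / c)"
  using bounded_measurable_mult[OF bounded_measurable_const[of _ "1 / c"] assms] by simp

lemma bounded_measurable_power2:
  "bounded_measurable N f \<Longrightarrow> bounded_measurable N (\<lambda>x. (f x)\<^sup>2)"
  by (simp add: power2_eq_square bounded_measurable_mult)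

lemma bounded_measurable_indicator:
  "A \<in> sets N \<Longrightarrow> bounded_measurable N (indicator A)"
  by (rule bounded_measurableI[where B = 1]) (auto simp: indicator_def)

lemma bounded_measurable_compose:
  assumes "bounded_measurable N f" "g \<in> measurable N' N"
  shows "bounded_measurable N' (\<lambda>x. f (g x))"
proof -
  obtain B where B: "\<And>x. x \<in> space N \<Longrightarrow> \<bar>f x\<bar> \<le> B"
    using assms by (metis bounded_measurable_bound)
  have [measurable]: "g \<in> measurable N' N" "f \<in> borel_measurable N"
    using assms by (auto dest: bounded_measurableD)
  show ?thesis
    by (rule bounded_measurableI[where B = B]) (use B measurable_space[OF assms(2)] in auto)
qed

lemmas bounded_measurable_intros =
  bounded_measurable_const bounded_measurable_add bounded_measurable_mult
  bounded_measurable_diff bounded_measurable_divide bounded_measurable_power2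

section \<open>Cauchy-Schwarz and moments on a probability space\<close>

context prob_space
begin

lemma bounded_measurable_integrable:
  assumes "bounded_measurable M f" shows "integrable M f"
proof -
  obtain B where "\<And>x. x \<in> space M \<Longrightarrow> \<bar>f x\<bar> \<le> B"
    using assms by (metis bounded_measurable_bound)
  then show ?thesis
    using assms by (intro integrable_const_bound[where B = B]) (auto dest: bounded_measurableD)
qed

lemma abs_integral_le:
  assumes "bounded_measurable M f" "\<And>x. x \<in> space M \<Longrightarrow> \<bar>f x\<bar> \<le> B"
  shows "\<bar>\<integral>x. f x \<partial>M\<bar> \<le> B"
proof -
  have i: "integrable M f" by (rule bounded_measurable_integrable) fact
  have "\<bar>\<integral>x. f x \<partial>M\<bar> \<le> (\<integral>x. \<bar>f x\<bar> \<partial>M)"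
    by (rule integral_abs_bound)
  also have "\<dots> \<le> (\<integral>x. B \<partial>M)"
    using i assms(2) by (intro integral_mono) auto
  finally show ?thesis by (simp add: prob_space)
qed

lemma integral_power2_eq_0_iff:
  assumes "bounded_measurable M f"
  shows "(\<integral>x. (f x)\<^sup>2 \<partial>M) = 0 \<longleftrightarrow> (AE x in M. f x = 0)"
  using integral_nonneg_eq_0_iff_AE[of M "\<lambda>x. (f x)\<^sup>2"]
    bounded_measurable_integrable[OF bounded_measurable_power2[OF assms]] by simp

lemma integral_Cauchy_Schwarz:
  assumes "bounded_measurable M f" "bounded_measurable M g"
  shows "(\<integral>x. f x * g x \<partial>M)\<^sup>2 \<le> (\<integral>x. (f x)\<^sup>2 \<partial>M) * (\<integral>x. (g x)\<^sup>2 \<partial>M)"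
proof -
  define F G I where "F = (\<integral>x. (f x)\<^sup>2 \<partial>M)" and "G = (\<integral>x. (g x)\<^sup>2 \<partial>M)"
    and "I = (\<integral>x. f x * g x \<partial>M)"
  have ints: "integrable M (\<lambda>x. (f x)\<^sup>2)" "integrable M (\<lambda>x. (g x)\<^sup>2)" "integrable M (\<lambda>x. f x * g x)"
    by (intro bounded_measurable_integrable bounded_measurable_intros assms)+
  show ?thesis
  proof (cases "G = 0")
    case True
    then have "AE x in M. g x = 0"
      using integral_power2_eq_0_iff[OF assms(2)] G_def by simp
    then have "I = (\<integral>x. 0 \<partial>M)"
      unfolding I_def using assms
      by (intro integral_cong_AE) (auto dest: bounded_measurableD)
    then show ?thesis by (simp add: I_def)
  next
    case False
    moreover have "G \<ge> 0" unfolding G_def by (rule Bochner_Integration.integral_nonneg) simp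
    ultimately have "G > 0" by simp
    \<comment> \<open>The integrand is the square of \<open>G\<close> times the residual of
      \<open>f\<close> after projection onto \<open>g\<close>.\<close>
    have "0 \<le> (\<integral>x. (G * f x - I * g x)\<^sup>2 \<partial>M)"
      by (rule Bochner_Integration.integral_nonneg) simp
    also have "\<dots> = (\<integral>x. G\<^sup>2 * (f x)\<^sup>2 - 2 * G * I * (f x * g x) + I\<^sup>2 * (g x)\<^sup>2 \<partial>M)"
      by (simp add: power2_diff power_mult_distrib algebra_simps)
    also have "\<dots> = G\<^sup>2 * F - 2 * G * I * I + I\<^sup>2 * G"
      using ints by (simp add: F_def[symmetric] G_def[symmetric] I_def[symmetric])
    also have "\<dots> = G * (F * G - I\<^sup>2)"
      by (simp add: algebra_simps power2_eq_square)
    finally show ?thesis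
      using \<open>G > 0\<close> by (simp add: zero_le_mult_iff F_def G_def I_def)
  qed
qed

lemma integral_power2_le:
  assumes "bounded_measurable M f"
  shows "(\<integral>x. f x \<partial>M)\<^sup>2 \<le> (\<integral>x. (f x)\<^sup>2 \<partial>M)"
  using integral_Cauchy_Schwarz[OF assms bounded_measurable_const[of _ 1]] by (simp add: prob_space)

text \<open>The two moments say that the variance of \<open>f\<close> is zero.\<close>

lemma AE_eq_const_of_moments:
  assumes f: "bounded_measurable M f" and "(\<integral>x. f x \<partial>M) = m" "(\<integral>x. (f x)\<^sup>2 \<partial>M) = m\<^sup>2"
  shows "AE x in M. f x = m"
proof -
  have ints: "integrable M f" "integrable M (\<lambda>x. (f x)\<^sup>2)"
    by (intro bounded_measurable_integrable bounded_measurable_intros assms)+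
  have "(\<integral>x. (f x - m)\<^sup>2 \<partial>M) = (\<integral>x. (f x)\<^sup>2 - 2 * m * f x + m\<^sup>2 \<partial>M)"
    by (simp add: power2_diff algebra_simps)
  also have "\<dots> = m\<^sup>2 - 2 * m * m + m\<^sup>2"
    using ints by (simp add: assms prob_space)
  finally have "(\<integral>x. (f x - m)\<^sup>2 \<partial>M) = 0" by (simp add: power2_eq_square)
  then have "AE x in M. f x - m = 0"
    by (subst (asm) integral_power2_eq_0_iff) (intro bounded_measurable_intros f)
  then show ?thesis by simp
qed

lemma bounded_measurable_integral:
  assumes "bounded_measurable (N \<Otimes>\<^sub>M M) (\<lambda>(x, y). h x y)"
  shows "bounded_measurable N (\<lambda>x. \<integral>y. h x y \<partial>M)"
proof -
  obtain B where B: "\<And>p. p \<in> space (N \<Otimes>\<^sub>M M) \<Longrightarrow> \<bar>case p of (x, y) \<Rightarrow> h x y\<bar> \<le> B"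
    using assms by (metis bounded_measurable_bound)
  have [measurable]: "(\<lambda>(x, y). h x y) \<in> borel_measurable (N \<Otimes>\<^sub>M M)"
    using assms by (rule bounded_measurableD)
  show ?thesis
  proof (rule bounded_measurableI[where B = B])
    fix x assume x: "x \<in> space N"
    have "bounded_measurable M (\<lambda>y. case (x, y) of (x, y) \<Rightarrow> h x y)"
      using x by (intro bounded_measurable_compose[OF assms]) auto
    then show "\<bar>\<integral>y. h x y \<partial>M\<bar> \<le> B"
      using B[of "(x, _)"] x by (intro abs_integral_le) (auto simp: space_pair_measure)
  qed measurable
qed

section \<open>Composition and Hilbert-Schmidt inner product of kernels\<close>

lemma prob_space_pair_self: "prob_space (M \<Otimes>\<^sub>M M)"
  by (rule prob_space_pair) unfold_locales

abbreviation kernel :: "('a \<Rightarrow> 'a \<Rightarrow> real) \<Rightarrow> bool" where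
  "kernel A \<equiv> bounded_measurable (M \<Otimes>\<^sub>M M) (\<lambda>(x, y). A x y)"

lemma kernel_compose:
  assumes "kernel A" "f \<in> measurable N M" "g \<in> measurable N M"
  shows "bounded_measurable N (\<lambda>\<omega>. A (f \<omega>) (g \<omega>))"
  using bounded_measurable_compose[OF assms(1), of "\<lambda>\<omega>. (f \<omega>, g \<omega>)" N] assms by simp

lemma kernel_integral:
  assumes "kernel A"
  shows "(\<integral>(x, y). A x y \<partial>(M \<Otimes>\<^sub>M M)) = (\<integral>x. \<integral>y. A x y \<partial>M \<partial>M)"
proof -
  interpret pair_prob_space M M ..
  show ?thesis
    using integral_fst'[OF P.bounded_measurable_integrable[OF assms]] by simp
qed

lemma kernel_integral_swap:
  assumes "kernel A"
  shows "(\<integral>x. \<integral>y. A x y \<partial>M \<partial>M) = (\<integral>y. \<integral>x. A x y \<partial>M \<partial>M)"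
proof -
  interpret pair_prob_space M M ..
  show ?thesis
    using Fubini_integral[OF P.bounded_measurable_integrable[OF assms]] by simp
qed

text \<open>The kernel of the product of the two integral operators, a continuous matrix
  product.\<close>

definition kcomp :: "('a \<Rightarrow> 'a \<Rightarrow> real) \<Rightarrow> ('a \<Rightarrow> 'a \<Rightarrow> real) \<Rightarrow> 'a \<Rightarrow> 'a \<Rightarrow> real" where
  "kcomp A B x y = (\<integral>z. A x z * B z y \<partial>M)"

text \<open>The Hilbert-Schmidt inner product; for symmetric kernels it is the trace of the product
  of the operators.\<close>

definition kip :: "('a \<Rightarrow> 'a \<Rightarrow> real) \<Rightarrow> ('a \<Rightarrow> 'a \<Rightarrow> real) \<Rightarrow> real" where
  "kip A B = (\<integral>x. \<integral>y. A x y * B x y \<partial>M \<partial>M)"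

lemma kernel_mult: "kernel A \<Longrightarrow> kernel B \<Longrightarrow> kernel (\<lambda>x y. A x y * B x y)"
  by (drule (1) bounded_measurable_mult) (simp add: case_prod_beta')

lemma kernel_diff: "kernel A \<Longrightarrow> kernel B \<Longrightarrow> kernel (\<lambda>x y. A x y - B x y)"
  by (drule (1) bounded_measurable_diff) (simp add: case_prod_beta')

lemma kernel_const: "kernel (\<lambda>x y. c)"
  using bounded_measurable_const[of "M \<Otimes>\<^sub>M M" c] by (simp add: case_prod_beta')

lemma kernel_fst: "bounded_measurable M f \<Longrightarrow> kernel (\<lambda>x y. f x)"
  by (drule bounded_measurable_compose[where g = fst, OF _ measurable_fst]) (simp add: case_prod_beta')

lemma kernel_snd: "bounded_measurable M f \<Longrightarrow> kernel (\<lambda>x y. f y)"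
  by (drule bounded_measurable_compose[where g = snd, OF _ measurable_snd]) (simp add: case_prod_beta')

lemma kernel_swap: "kernel A \<Longrightarrow> kernel (\<lambda>x y. A y x)"
  using kernel_compose[of A snd "M \<Otimes>\<^sub>M M" fst] by (simp add: case_prod_beta')

lemma kernel_row: "kernel A \<Longrightarrow> x \<in> space M \<Longrightarrow> bounded_measurable M (\<lambda>y. A x y)"
  by (rule kernel_compose) auto

lemma kernel_col: "kernel A \<Longrightarrow> y \<in> space M \<Longrightarrow> bounded_measurable M (\<lambda>x. A x y)"
  by (rule kernel_compose[where g = "\<lambda>_. y"]) auto

lemma kernel_apply:
  assumes "kernel A" "bounded_measurable M f"
  shows "bounded_measurable M (\<lambda>x. \<integral>y. A x y * f y \<partial>M)"
  by (intro bounded_measurable_integral kernel_mult kernel_snd assms)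

lemma kernel_kcomp:
  assumes "kernel A" "kernel B"
  shows "kernel (kcomp A B)"
proof -
  have "bounded_measurable ((M \<Otimes>\<^sub>M M) \<Otimes>\<^sub>M M) (\<lambda>\<omega>. A (fst (fst \<omega>)) (snd \<omega>) * B (snd \<omega>) (snd (fst \<omega>)))"
    by (intro bounded_measurable_mult kernel_compose assms) measurable
  then have "bounded_measurable (M \<Otimes>\<^sub>M M) (\<lambda>p. \<integral>z. A (fst p) z * B z (snd p) \<partial>M)"
    by (intro bounded_measurable_integral) (simp add: case_prod_beta')
  then show ?thesis
    by (simp add: kcomp_def case_prod_beta')
qed

lemma kcomp_assoc:
  assumes "kernel A" "kernel B" "kernel C" "x \<in> space M" "y \<in> space M"
  shows "kcomp (kcomp A B) C x y = kcomp A (kcomp B C) x y"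
proof -
  have k: "kernel (\<lambda>w z. A x w * B w z * C z y)"
    by (intro kernel_mult kernel_fst[OF kernel_row[OF assms(1,4)]]
        kernel_snd[OF kernel_col[OF assms(3,5)]] assms(2))
  have "kcomp (kcomp A B) C x y = (\<integral>z. \<integral>w. A x w * B w z * C z y \<partial>M \<partial>M)"
    by (simp add: kcomp_def)
  also have "\<dots> = (\<integral>w. \<integral>z. A x w * B w z * C z y \<partial>M \<partial>M)"
    using kernel_integral_swap[OF k] by simp
  also have "\<dots> = kcomp A (kcomp B C) x y"
    by (simp add: kcomp_def mult.assoc)
  finally show ?thesis .
qed

lemma kip_pair:
  assumes "kernel A" "kernel B"
  shows "kip A B = (\<integral>p. (case p of (x, y) \<Rightarrow> A x y) * (case p of (x, y) \<Rightarrow> B x y) \<partial>(M \<Otimes>\<^sub>M M))"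
  using kernel_integral[OF kernel_mult[OF assms]] by (simp add: kip_def case_prod_beta')

lemma kip_self_pair:
  assumes "kernel A"
  shows "kip A A = (\<integral>p. (case p of (x, y) \<Rightarrow> A x y)\<^sup>2 \<partial>(M \<Otimes>\<^sub>M M))"
  by (simp add: kip_pair[OF assms assms] power2_eq_square)

lemma kip_nonneg: "0 \<le> kip A A"
  by (simp add: kip_def)

lemma kip_cong:
  "(\<And>x y. x \<in> space M \<Longrightarrow> y \<in> space M \<Longrightarrow> A x y = A' x y) \<Longrightarrow>
   (\<And>x y. x \<in> space M \<Longrightarrow> y \<in> space M \<Longrightarrow> B x y = B' x y) \<Longrightarrow> kip A B = kip A' B'"
  unfolding kip_def by (intro Bochner_Integration.integral_cong refl) auto

lemma kip_Cauchy_Schwarz: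
  assumes "kernel A" "kernel B"
  shows "(kip A B)\<^sup>2 \<le> kip A A * kip B B"
proof -
  interpret P: prob_space "M \<Otimes>\<^sub>M M" by (rule prob_space_pair_self)
  show ?thesis
    using P.integral_Cauchy_Schwarz[OF assms]
    by (simp only: kip_pair[OF assms] kip_self_pair[OF assms(1)] kip_self_pair[OF assms(2)])
qed

lemma kip_self_eq_0_iff:
  assumes "kernel A"
  shows "kip A A = 0 \<longleftrightarrow> (AE (x, y) in M \<Otimes>\<^sub>M M. A x y = 0)"
proof -
  interpret P: prob_space "M \<Otimes>\<^sub>M M" by (rule prob_space_pair_self)
  show ?thesis
    using P.integral_power2_eq_0_iff[OF assms]
    by (simp only: kip_self_pair[OF assms] case_prod_beta')
qed

text \<open>Left multiplication by a symmetric kernel is self-adjoint for \<open>kip\<close>. Both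
  sides are the triple integral of \<open>A x z * B z y * C x y\<close>; Fubini is applied to two
  variables at a time, in three swaps, and symmetry enters in the innermost integral at the
  end.\<close>

lemma kip_kcomp_left:
  assumes "kernel A" "kernel B" "kernel C"
    and sym: "\<And>x y. x \<in> space M \<Longrightarrow> y \<in> space M \<Longrightarrow> A x y = A y x"
  shows "kip (kcomp A B) C = kip B (kcomp A C)"
proof -
  have k1: "kernel (\<lambda>y z. A x z * B z y * C x y)" if "x \<in> space M" for x
    by (intro kernel_mult kernel_snd[where f = "\<lambda>z. A x z"] kernel_swap[OF assms(2)]
        kernel_fst[where f = "\<lambda>y. C x y"] kernel_row assms that)
  have "kip (kcomp A B) C = (\<integral>x. \<integral>y. \<integral>z. A x z * B z y * C x y \<partial>M \<partial>M \<partial>M)"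
    by (simp add: kip_def kcomp_def)
  also have "\<dots> = (\<integral>x. \<integral>z. \<integral>y. A x z * B z y * C x y \<partial>M \<partial>M \<partial>M)"
    by (rule Bochner_Integration.integral_cong[OF refl], rule kernel_integral_swap, rule k1)
  also have "\<dots> = (\<integral>z. \<integral>x. \<integral>y. A x z * B z y * C x y \<partial>M \<partial>M \<partial>M)"
  proof (rule kernel_integral_swap)
    have "bounded_measurable ((M \<Otimes>\<^sub>M M) \<Otimes>\<^sub>M M) (\<lambda>\<omega>. A (fst (fst \<omega>)) (snd (fst \<omega>)) *
            B (snd (fst \<omega>)) (snd \<omega>) * C (fst (fst \<omega>)) (snd \<omega>))"
      by (intro bounded_measurable_mult kernel_compose assms) measurable
    then have "bounded_measurable (M \<Otimes>\<^sub>M M) (\<lambda>p. \<integral>y. A (fst p) (snd p) *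
            B (snd p) y * C (fst p) y \<partial>M)"
      by (intro bounded_measurable_integral) (simp add: case_prod_beta')
    then show "kernel (\<lambda>x z. \<integral>y. A x z * B z y * C x y \<partial>M)"
      by (simp add: case_prod_beta')
  qed
  also have "\<dots> = (\<integral>z. \<integral>y. \<integral>x. A x z * B z y * C x y \<partial>M \<partial>M \<partial>M)"
  proof (rule Bochner_Integration.integral_cong[OF refl], rule kernel_integral_swap)
    fix z assume "z \<in> space M"
    then show "kernel (\<lambda>x y. A x z * B z y * C x y)"
      by (intro kernel_mult kernel_fst[where f = "\<lambda>x. A x z"] kernel_snd[where f = "\<lambda>y. B z y"]
          kernel_row kernel_col assms)
  qed
  also have "\<dots> = kip B (kcomp A C)"
    unfolding kip_def kcomp_def
  proof (intro Bochner_Integration.integral_cong refl)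
    fix z y assume "z \<in> space M" "y \<in> space M"
    have "(\<integral>x. A x z * B z y * C x y \<partial>M) = (\<integral>x. B z y * (A z x * C x y) \<partial>M)"
      using sym[OF _ \<open>z \<in> space M\<close>] by (intro Bochner_Integration.integral_cong refl) simp
    then show "(\<integral>x. A x z * B z y * C x y \<partial>M) = B z y * (\<integral>x. A z x * C x y \<partial>M)" by simp
  qed
  finally show ?thesis .
qed

text \<open>Submultiplicativity of the Hilbert-Schmidt norm. Cauchy-Schwarz at each point
  \<open>(x, y)\<close> bounds the entry by the norm of a row of \<open>A\<close> times that of a
  column of \<open>B\<close>, and the two squared norms integrate separately.\<close>

lemma kip_kcomp_le:
  assumes "kernel A" "kernel B"
  shows "kip (kcomp A B) (kcomp A B) \<le> kip A A * kip B B"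
proof -
  define f g where "f = (\<lambda>x. \<integral>z. (A x z)\<^sup>2 \<partial>M)" and "g = (\<lambda>y. \<integral>z. (B z y)\<^sup>2 \<partial>M)"
  have f: "bounded_measurable M f" unfolding f_def power2_eq_square
    by (intro bounded_measurable_integral kernel_mult assms)
  have g: "bounded_measurable M g" unfolding g_def power2_eq_square
    by (intro bounded_measurable_integral kernel_mult kernel_swap[OF assms(2)])
  have k: "kernel (kcomp A B)" by (intro kernel_kcomp assms)
  have "kip (kcomp A B) (kcomp A B) \<le> (\<integral>x. \<integral>y. f x * g y \<partial>M \<partial>M)"
    unfolding kip_def
  proof (intro integral_mono bounded_measurable_integrable)
    show "bounded_measurable M (\<lambda>x. \<integral>y. kcomp A B x y * kcomp A B x y \<partial>M)"
      by (intro bounded_measurable_integral kernel_mult k)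
    show "bounded_measurable M (\<lambda>x. \<integral>y. f x * g y \<partial>M)"
      by (intro bounded_measurable_integral kernel_mult kernel_fst[OF f] kernel_snd[OF g])
    fix x y assume x: "x \<in> space M"
    show "bounded_measurable M (\<lambda>y. kcomp A B x y * kcomp A B x y)"
      by (intro bounded_measurable_mult kernel_row k x)
    show "bounded_measurable M (\<lambda>y. f x * g y)"
      by (intro bounded_measurable_mult bounded_measurable_const g)
    assume y: "y \<in> space M"
    show "kcomp A B x y * kcomp A B x y \<le> f x * g y"
      unfolding kcomp_def f_def g_def power2_eq_square[of "integral\<^sup>L _ _", symmetric]
      by (intro integral_Cauchy_Schwarz kernel_row kernel_col assms x y)
  qed
  also have "\<dots> = (\<integral>x. f x \<partial>M) * (\<integral>y. g y \<partial>M)" by simp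
  also have "(\<integral>y. g y \<partial>M) = kip B B"
    unfolding g_def kip_def power2_eq_square
    by (rule kernel_integral_swap[symmetric]) (intro kernel_mult assms)
  finally show ?thesis by (simp add: f_def kip_def power2_eq_square)
qed

end

section \<open>Eigenfunctions of symmetric kernels\<close>

text \<open>In the application \<open>a n\<close> is the squared Hilbert-Schmidt norm of the power
  \<open>n + 1\<close> of a kernel, heuristically the sum of all \<open>lambda^(2(n+1))\<close>, and
  \<open>c\<close> is the largest \<open>lambda^2\<close>; this explains the exponent
  \<open>Suc n\<close>. Log-convexity makes the ratios of consecutive terms increase to
  \<open>c\<close>, so the normalized sequence decreases. Submultiplicativity gives the lower bound
  as in Fekete's lemma: a single term below \<open>c ^ Suc N\<close> would force a growth rate below
  \<open>c\<close>.\<close>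

lemma submultiplicative_log_convex_normalization:
  fixes a :: "nat \<Rightarrow> real"
  assumes pos: "\<And>n. a n > 0"
    and convex: "\<And>n. (a (Suc n))\<^sup>2 \<le> a n * a (Suc (Suc n))"
    and submult: "\<And>n m. a (Suc (n + m)) \<le> a n * a m"
  obtains c where "c > 0" "decseq (\<lambda>n. a n / c ^ Suc n)" "\<And>n. a n / c ^ Suc n \<ge> 1"
proof -
  define r where "r = (\<lambda>n. a (Suc n) / a n)"
  have r_pos: "r n > 0" for n by (simp add: r_def pos)
  have r_Suc: "r n \<le> r (Suc n)" for n
    using convex[of n] pos[of n] pos[of "Suc n"]
    by (simp add: r_def field_simps power2_eq_square)
  have "incseq r" by (rule incseq_SucI) (rule r_Suc)
  have r_le: "r n \<le> a 0" for n
    using submult[of n 0] pos[of n] by (simp add: r_def field_simps)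
  obtain c where c: "r \<longlonglongrightarrow> c" "\<And>n. r n \<le> c"
    using incseq_convergent[OF \<open>incseq r\<close>, of "a 0"] r_le by auto
  have c_pos: "c > 0" using r_pos[of 0] c(2)[of 0] by simp
  have step: "a (Suc n) \<le> c * a n" for n
    using c(2)[of n] pos[of n] by (simp add: r_def field_simps)
  have "decseq (\<lambda>n. a n / c ^ Suc n)"
    using step c_pos by (intro decseq_SucI) (simp add: field_simps)
  moreover have "a N / c ^ Suc N \<ge> 1" for N
  proof (rule ccontr)
    assume "\<not> 1 \<le> a N / c ^ Suc N"
    moreover have "a N / c ^ Suc N > 0" using pos c_pos by simp
    ultimately obtain v where v: "a N / c ^ Suc N < v" "v < 1" "v > 0"
      using dense[of "a N / c ^ Suc N" 1] by force
    \<comment> \<open>Lowers the rate from \<open>c\<close> to \<open>d\<close> while keeping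
      \<open>a N < d ^ Suc N\<close>. The ratios eventually exceed \<open>d\<close>, so
      \<open>a\<close> grows at least like \<open>d ^ n\<close>, whereas along the indices
      \<open>Suc N * k + N\<close> it is bounded by powers of \<open>a N\<close>.\<close>
    define d where "d = c * root (Suc N) v"
    have d: "d > 0" "d < c" "d ^ Suc N = c ^ Suc N * v"
      using v c_pos real_root_less_iff[of "Suc N" v 1]
      by (auto simp: d_def power_mult_distrib simp del: power_Suc real_root_less_iff)
    have aN: "a N < d ^ Suc N"
      using v(1) c_pos unfolding d(3) by (simp add: field_simps)
    define q where "q = a N / d ^ Suc N"
    have q: "0 < q" "q < 1" using aN pos[of N] d(1) by (auto simp: q_def)
    obtain n0 where n0: "\<And>n. n \<ge> n0 \<Longrightarrow> r n > d"
      using order_tendstoD(1)[OF c(1) d(2)] by (auto simp: eventually_sequentially)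
    define C where "C = a n0 / d ^ n0"
    have C: "C > 0" using pos d(1) by (simp add: C_def)
    have lower: "C * d ^ n \<le> a n" if "n \<ge> n0" for n
      using that
    proof (induction n rule: dec_induct)
      case base
      then show ?case using d(1) by (simp add: C_def)
    next
      case (step n)
      have "C * d ^ Suc n \<le> d * a n"
        using step.IH d(1) by (simp add: field_simps)
      also have "\<dots> \<le> a (Suc n)"
        using n0[of n] step.hyps pos[of n] by (simp add: r_def field_simps)
      finally show ?case .
    qed
    \<comment> \<open>In \<open>submult\<close> the left index is one more than the sum, so a factor
      \<open>a N\<close> advances the index by \<open>Suc N\<close>; starting at \<open>N\<close>
      gives the exponent \<open>Suc k\<close>.\<close>
    have upper: "a (Suc N * k + N) \<le> a N ^ Suc k" for k
    proof (induction k)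
      case (Suc k)
      have "a (Suc N * Suc k + N) = a (Suc (N + (Suc N * k + N)))"
        by (simp add: algebra_simps)
      also have "\<dots> \<le> a N * a (Suc N * k + N)" by (rule submult)
      also have "\<dots> \<le> a N * a N ^ Suc k"
        using Suc.IH pos[of N] by (intro mult_left_mono) auto
      finally show ?case by simp
    qed simp
    have "C / d \<le> q ^ Suc k" if "k \<ge> n0" for k
    proof -
      have "k \<le> Suc N * k + N" by simp
      then have "C * d ^ (Suc N * k + N) \<le> a N ^ Suc k"
        using lower[of "Suc N * k + N"] upper[of k] that by linarith
      moreover have "d ^ Suc (Suc N * k + N) = (d ^ Suc N) ^ Suc k"
        unfolding power_mult[symmetric] by (rule arg_cong[where f = "\<lambda>i. d ^ i"]) (simp add: algebra_simps)
      then have "d ^ (Suc N * k + N) = (d ^ Suc N) ^ Suc k / d"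
        using d(1) by (simp add: field_simps)
      ultimately have "C * ((d ^ Suc N) ^ Suc k / d) \<le> a N ^ Suc k" by simp
      then show ?thesis
        unfolding q_def power_divide using d(1) by (simp add: field_simps)
    qed
    moreover have "(\<lambda>k. q ^ Suc k) \<longlonglongrightarrow> 0"
      using q by (intro LIMSEQ_Suc LIMSEQ_power_zero) auto
    ultimately have "C / d \<le> 0"
      by (intro LIMSEQ_le_const[where X = "\<lambda>k. q ^ Suc k"]) auto
    then show False using C d(1) by (simp add: field_simps)
  qed
  ultimately show ?thesis using c_pos that by blast
qed

context prob_space
begin

section \<open>Limits of bounded functions and criteria for a kernel to vanish\<close>

lemma bounded_measurable_LIMSEQ:
  assumes f: "\<And>n. bounded_measurable M (f n)" and B: "\<And>n x. x \<in> space M \<Longrightarrow> \<bar>f n x\<bar> \<le> B"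
    and lim: "\<And>x. x \<in> space M \<Longrightarrow> (\<lambda>n. f n x) \<longlonglongrightarrow> g x"
  shows "bounded_measurable M g" "(\<lambda>n. \<integral>x. f n x \<partial>M) \<longlonglongrightarrow> (\<integral>x. g x \<partial>M)"
proof -
  have [measurable]: "f n \<in> borel_measurable M" for n
    using f by (rule bounded_measurableD)
  have [measurable]: "g \<in> borel_measurable M"
    using lim by (rule borel_measurable_LIMSEQ_metric[rotated]) auto
  show "bounded_measurable M g"
  proof (rule bounded_measurableI[where B = B])
    fix x assume "x \<in> space M"
    then show "\<bar>g x\<bar> \<le> B"
      using B by (intro LIMSEQ_le_const2[OF tendsto_rabs[OF lim]]) auto
  qed measurable
  show "(\<lambda>n. \<integral>x. f n x \<partial>M) \<longlonglongrightarrow> (\<integral>x. g x \<partial>M)"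
    by (rule integral_dominated_convergence[where w = "\<lambda>_. B"]) (use B lim in auto)
qed

text \<open>Rectangles form an intersection-stable generator of the product sigma-algebra, and the
  sets over which \<open>K\<close> integrates to zero form a Dynkin system; integral zero over every
  measurable set means zero almost everywhere.\<close>

lemma kernel_AE_0_of_rectangles:
  assumes K: "kernel K"
    and rect: "\<And>A B. A \<in> sets M \<Longrightarrow> B \<in> sets M \<Longrightarrow>
      (\<integral>x. indicator A x * (\<integral>y. K x y * indicator B y \<partial>M) \<partial>M) = 0"
  shows "AE (x, y) in M \<Otimes>\<^sub>M M. K x y = 0"
proof -
  interpret P: prob_space "M \<Otimes>\<^sub>M M" by (rule prob_space_pair_self)
  let ?k = "\<lambda>p. case p of (x, y) \<Rightarrow> K x y"
  have int: "set_integrable (M \<Otimes>\<^sub>M M) S ?k" if "S \<in> sets (M \<Otimes>\<^sub>M M)" for S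
    unfolding set_integrable_def real_scaleR_def
    by (intro P.bounded_measurable_integrable bounded_measurable_mult bounded_measurable_indicator K that)
  have rect0: "(LINT p:A \<times> B|M \<Otimes>\<^sub>M M. ?k p) = 0" if A: "A \<in> sets M" and B: "B \<in> sets M" for A B
  proof -
    have k: "kernel (\<lambda>x y. indicator A x * (K x y * indicator B y))"
      by (intro kernel_mult kernel_fst[OF bounded_measurable_indicator[OF A]]
          kernel_snd[OF bounded_measurable_indicator[OF B]] K)
    have "(LINT p:A \<times> B|M \<Otimes>\<^sub>M M. ?k p)
        = (\<integral>(x, y). indicator A x * (K x y * indicator B y) \<partial>(M \<Otimes>\<^sub>M M))"
      unfolding set_lebesgue_integral_def
      by (intro Bochner_Integration.integral_cong refl) (auto simp: indicator_def)
    also have "\<dots> = (\<integral>x. \<integral>y. indicator A x * (K x y * indicator B y) \<partial>M \<partial>M)"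
      by (rule kernel_integral[OF k])
    also have "\<dots> = 0" using rect[OF A B] by simp
    finally show ?thesis .
  qed
  have "(LINT p:S|M \<Otimes>\<^sub>M M. ?k p) = 0" if "S \<in> sets (M \<Otimes>\<^sub>M M)" for S
    using Int_stable_pair_measure_generator[of M M] pair_measure_closed[of M M]
      that[unfolded sets_pair_measure]
  proof (induction S rule: sigma_sets_induct_disjoint)
    case (basic S)
    then show ?case using rect0 by auto
  next
    case empty
    show ?case by (simp add: set_lebesgue_integral_def)
  next
    case (compl S)
    then have S: "S \<in> sets (M \<Otimes>\<^sub>M M)" by (simp add: sets_pair_measure)
    have "(LINT p:S \<union> (space (M \<Otimes>\<^sub>M M) - S)|M \<Otimes>\<^sub>M M. ?k p)
        = (LINT p:S|M \<Otimes>\<^sub>M M. ?k p) + (LINT p:space (M \<Otimes>\<^sub>M M) - S|M \<Otimes>\<^sub>M M. ?k p)"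
      by (rule set_integral_Un) (use S int in auto)
    moreover have "S \<union> (space (M \<Otimes>\<^sub>M M) - S) = space M \<times> space M"
      using sets.sets_into_space[OF S] by (auto simp: space_pair_measure)
    ultimately show ?case
      using compl.IH rect0[of "space M" "space M"] by (simp add: space_pair_measure)
  next
    case (union S)
    then have S: "S i \<in> sets (M \<Otimes>\<^sub>M M)" for i by (auto simp: sets_pair_measure)
    have "(LINT p:(\<Union>i. S i)|M \<Otimes>\<^sub>M M. ?k p) = (\<Sum>i. LINT p:S i|M \<Otimes>\<^sub>M M. ?k p)"
      by (rule lebesgue_integral_countable_add)
        (use S int union(1) in \<open>auto simp: disjoint_family_on_def\<close>)
    then show ?case using union.IH by simp
  qed
  then have "AE p in M \<Otimes>\<^sub>M M. ?k p = 0"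
    by (intro density_unique_real) (auto intro: P.bounded_measurable_integrable K simp: set_lebesgue_integral_def)
  then show ?thesis by (simp add: case_prod_beta')
qed

lemma kcomp_cong:
  "(\<And>z. z \<in> space M \<Longrightarrow> A x z = A' x z) \<Longrightarrow> (\<And>z. z \<in> space M \<Longrightarrow> B z y = B' z y) \<Longrightarrow>
   kcomp A B x y = kcomp A' B' x y"
  unfolding kcomp_def by (intro Bochner_Integration.integral_cong refl) auto

text \<open>For an indicator \<open>1_B\<close>, self-adjointness gives
  \<open>|K 1_B|^2 = <1_B, K K 1_B> = 0\<close>, so \<open>K\<close> annihilates all indicators and
  the rectangle criterion applies.\<close>

lemma kernel_AE_0_of_square:
  assumes K: "kernel K" and sym: "\<And>x y. x \<in> space M \<Longrightarrow> y \<in> space M \<Longrightarrow> K x y = K y x"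
    and sq: "AE (x, y) in M \<Otimes>\<^sub>M M. kcomp K K x y = 0"
  shows "AE (x, y) in M \<Otimes>\<^sub>M M. K x y = 0"
proof (rule kernel_AE_0_of_rectangles[OF K])
  fix A B assume A: "A \<in> sets M" and B: "B \<in> sets M"
  define g where "g = (\<lambda>x. \<integral>y. K x y * indicator B y \<partial>M)"
  \<comment> \<open>A function is encoded as a kernel that is constant in the second variable, so
    that \<open>kip\<close> and \<open>kcomp\<close> act on it like the inner product and the
    operator on functions.\<close>
  define H :: "'a \<Rightarrow> 'a \<Rightarrow> real" where "H = (\<lambda>x _. indicator B x)"
  have H: "kernel H"
    unfolding H_def by (rule kernel_fst[OF bounded_measurable_indicator[OF B]])
  have g: "bounded_measurable M g"
    unfolding g_def by (intro kernel_apply K bounded_measurable_indicator B)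
  have KK: "kernel (kcomp K K)" and KKH: "kernel (kcomp (kcomp K K) H)"
    by (intro kernel_kcomp K H)+
  have "kip (kcomp (kcomp K K) H) (kcomp (kcomp K K) H) \<le> kip (kcomp K K) (kcomp K K) * kip H H"
    by (rule kip_kcomp_le[OF KK H])
  then have "kip (kcomp (kcomp K K) H) (kcomp (kcomp K K) H) = 0"
    using sq kip_self_eq_0_iff[OF KK] kip_nonneg[of "kcomp (kcomp K K) H"] by simp
  then have 0: "kip H (kcomp (kcomp K K) H) = 0"
    using kip_Cauchy_Schwarz[OF H KKH] by simp
  have "(\<integral>x. (g x)\<^sup>2 \<partial>M) = kip (kcomp K H) (kcomp K H)"
    by (simp add: kip_def kcomp_def H_def g_def power2_eq_square prob_space)
  also have "\<dots> = kip H (kcomp K (kcomp K H))"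
    by (intro kip_kcomp_left K H kernel_kcomp sym)
  also have "\<dots> = kip H (kcomp (kcomp K K) H)"
    by (intro kip_cong refl kcomp_assoc[symmetric] K H)
  finally have "AE x in M. g x = 0"
    using 0 integral_power2_eq_0_iff[OF g] by simp
  then have "(\<integral>x. indicator A x * g x \<partial>M) = (\<integral>x. 0 \<partial>M)"
    using A g by (intro integral_cong_AE) (auto dest: bounded_measurableD)
  then show "(\<integral>x. indicator A x * (\<integral>y. K x y * indicator B y \<partial>M) \<partial>M) = 0"
    by (simp add: g_def)
qed

lemma kip_diff_self:
  assumes "kernel A" "kernel B"
  shows "kip (\<lambda>x y. A x y - B x y) (\<lambda>x y. A x y - B x y) = kip A A - 2 * kip A B + kip B B"
proof -
  interpret P: prob_space "M \<Otimes>\<^sub>M M" by (rule prob_space_pair_self)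
  let ?a = "\<lambda>p. case p of (x, y) \<Rightarrow> A x y" and ?b = "\<lambda>p. case p of (x, y) \<Rightarrow> B x y"
  have ints: "integrable (M \<Otimes>\<^sub>M M) (\<lambda>p. (?a p)\<^sup>2)" "integrable (M \<Otimes>\<^sub>M M) (\<lambda>p. (?b p)\<^sup>2)"
    "integrable (M \<Otimes>\<^sub>M M) (\<lambda>p. ?a p * ?b p)"
    by (intro P.bounded_measurable_integrable bounded_measurable_intros assms)+
  have "kip (\<lambda>x y. A x y - B x y) (\<lambda>x y. A x y - B x y)
      = (\<integral>p. (?a p)\<^sup>2 - 2 * (?a p * ?b p) + (?b p)\<^sup>2 \<partial>(M \<Otimes>\<^sub>M M))"
    unfolding kip_self_pair[OF kernel_diff[OF assms]]
    by (intro Bochner_Integration.integral_cong refl) (auto simp: power2_diff)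
  also have "\<dots> = kip A A - 2 * kip A B + kip B B"
    using ints by (simp add: kip_self_pair[OF assms(1)] kip_self_pair[OF assms(2)] kip_pair[OF assms]
        del: split_beta)
  finally show ?thesis .
qed

lemma kip_divide: "kip (\<lambda>x y. A x y / s) (\<lambda>x y. B x y / t) = kip A B / (s * t)"
proof -
  have "kip (\<lambda>x y. A x y / s) (\<lambda>x y. B x y / t) = (\<integral>x. \<integral>y. A x y * B x y / (s * t) \<partial>M \<partial>M)"
    unfolding kip_def by (simp add: field_simps)
  then show ?thesis by (simp add: kip_def)
qed

text \<open>Rows and columns of \<open>K\<close> have norm at most \<open>B\<close>, so two
  applications of Cauchy-Schwarz turn Hilbert-Schmidt smallness of \<open>D\<close> into smallness
  of \<open>K D K\<close> that is uniform in the point.\<close>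

lemma kcomp_sandwich_le:
  assumes K: "kernel K" and D: "kernel D" and x: "x \<in> space M" and y: "y \<in> space M"
    and B: "\<And>x y. x \<in> space M \<Longrightarrow> y \<in> space M \<Longrightarrow> \<bar>K x y\<bar> \<le> B"
  shows "(kcomp K (kcomp D K) x y)\<^sup>2 \<le> (B\<^sup>2)\<^sup>2 * kip D D"
proof -
  have DK: "kernel (kcomp D K)" by (intro kernel_kcomp K D)
  have B0: "B \<ge> 0" using B[OF x x] by linarith
  have K2: "(K z w)\<^sup>2 \<le> B\<^sup>2" if "z \<in> space M" "w \<in> space M" for z w
    using B[OF that] B0 by (simp add: abs_le_square_iff[symmetric])
  have row: "(\<integral>z. (K x z)\<^sup>2 \<partial>M) \<le> B\<^sup>2"
    using abs_integral_le[OF bounded_measurable_power2[OF kernel_row[OF K x]], of "B\<^sup>2"] K2[OF x]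
    by (metis abs_le_D1 abs_power2)
  have col: "(\<integral>z. (K z y)\<^sup>2 \<partial>M) \<le> B\<^sup>2"
    using abs_integral_le[OF bounded_measurable_power2[OF kernel_col[OF K y]], of "B\<^sup>2"] K2[OF _ y]
    by (metis abs_le_D1 abs_power2)
  have "(kcomp K (kcomp D K) x y)\<^sup>2 \<le> (\<integral>z. (K x z)\<^sup>2 \<partial>M) * (\<integral>z. (kcomp D K z y)\<^sup>2 \<partial>M)"
    unfolding kcomp_def[of K "kcomp D K"]
    by (rule integral_Cauchy_Schwarz[OF kernel_row[OF K x] kernel_col[OF DK y]])
  also have "\<dots> \<le> B\<^sup>2 * (\<integral>z. (kcomp D K z y)\<^sup>2 \<partial>M)"
    by (intro mult_right_mono row Bochner_Integration.integral_nonneg) simp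
  also have "(\<integral>z. (kcomp D K z y)\<^sup>2 \<partial>M) \<le> (\<integral>z. (\<integral>w. D z w * D z w \<partial>M) * B\<^sup>2 \<partial>M)"
  proof (intro integral_mono bounded_measurable_integrable)
    show "bounded_measurable M (\<lambda>z. (kcomp D K z y)\<^sup>2)"
      by (rule bounded_measurable_power2[OF kernel_col[OF DK y]])
    show "bounded_measurable M (\<lambda>z. (\<integral>w. D z w * D z w \<partial>M) * B\<^sup>2)"
      by (intro bounded_measurable_mult bounded_measurable_integral kernel_mult D bounded_measurable_const)
    fix z assume z: "z \<in> space M"
    have "(kcomp D K z y)\<^sup>2 \<le> (\<integral>w. (D z w)\<^sup>2 \<partial>M) * (\<integral>w. (K w y)\<^sup>2 \<partial>M)"
      unfolding kcomp_def
      by (rule integral_Cauchy_Schwarz[OF kernel_row[OF D z] kernel_col[OF K y]])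
    also have "\<dots> \<le> (\<integral>w. (D z w)\<^sup>2 \<partial>M) * B\<^sup>2"
      by (intro mult_left_mono col Bochner_Integration.integral_nonneg) simp
    finally show "(kcomp D K z y)\<^sup>2 \<le> (\<integral>w. D z w * D z w \<partial>M) * B\<^sup>2"
      by (simp add: power2_eq_square)
  qed
  finally have "(kcomp K (kcomp D K) x y)\<^sup>2 \<le> B\<^sup>2 * (\<integral>z. (\<integral>w. D z w * D z w \<partial>M) * B\<^sup>2 \<partial>M)"
    by (simp add: mult_left_mono)
  then show ?thesis by (simp add: kip_def power2_eq_square mult_ac)
qed

section \<open>Powers of a symmetric kernel and the eigenfunction theorem\<close>

text \<open>The identity operator has in general no bounded kernel, so indexing starts at the first
  power: \<open>kpow K n\<close> stands for the power \<open>n + 1\<close>.\<close>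

primrec kpow :: "('a \<Rightarrow> 'a \<Rightarrow> real) \<Rightarrow> nat \<Rightarrow> 'a \<Rightarrow> 'a \<Rightarrow> real" where
  "kpow K 0 = K"
| "kpow K (Suc n) = kcomp K (kpow K n)"

lemma kernel_kpow: "kernel K \<Longrightarrow> kernel (kpow K n)"
  by (induction n) (auto intro: kernel_kcomp)

lemma kpow_add:
  assumes "kernel K" "x \<in> space M" "y \<in> space M"
  shows "kpow K (Suc (n + m)) x y = kcomp (kpow K n) (kpow K m) x y"
  using assms(2)
proof (induction n arbitrary: x)
  case (Suc n)
  have "kpow K (Suc (Suc n + m)) x y = kcomp K (kpow K (Suc (n + m))) x y" by simp
  also have "\<dots> = kcomp K (kcomp (kpow K n) (kpow K m)) x y"
    by (intro kcomp_cong refl Suc.IH)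
  also have "\<dots> = kcomp (kpow K (Suc n)) (kpow K m) x y"
    using kcomp_assoc[OF assms(1) kernel_kpow[OF assms(1)] kernel_kpow[OF assms(1)] Suc.prems assms(3)]
    by simp
  finally show ?case .
qed simp

text \<open>Self-adjointness moves factors from one side to the other, so the inner product depends
  on \<open>n + m\<close> alone; it is the trace of the power \<open>n + m + 2\<close>. The Gram
  matrix of the powers thus reduces to a single sequence.\<close>

lemma kip_kpow:
  assumes "kernel K" "\<And>x y. x \<in> space M \<Longrightarrow> y \<in> space M \<Longrightarrow> K x y = K y x"
  shows "kip (kpow K n) (kpow K m) = kip K (kpow K (n + m))"
proof (induction n arbitrary: m)
  case (Suc n)
  have "kip (kpow K (Suc n)) (kpow K m) = kip (kpow K n) (kpow K (Suc m))"
    by (simp add: kip_kcomp_left[OF assms(1) kernel_kpow[OF assms(1)] kernel_kpow[OF assms(1)] assms(2)])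
  then show ?case using Suc.IH[of "Suc m"] by simp
qed simp

text \<open>The normalized even powers \<open>K\<^sup>2\<^sup>n / c\<^sup>n\<close> form a Cauchy sequence for the
  Hilbert--Schmidt norm, because their inner products are the terms of a convergent sequence.
  Sandwiching between two copies of \<open>K\<close> turns this into pointwise convergence, so completeness of
  \<open>L\<^sup>2\<close> is not needed. The columns of the limit satisfy \<open>T\<^sup>2h = c h\<close>; the limit is
  nonzero by submultiplicativity of the Hilbert--Schmidt norm.\<close>

lemma kernel_square_eigenkernel:
  assumes K: "kernel K" and sym: "\<And>x y. x \<in> space M \<Longrightarrow> y \<in> space M \<Longrightarrow> K x y = K y x"
    and nz: "\<not> (AE (x, y) in M \<Otimes>\<^sub>M M. K x y = 0)"
  obtains c P where "c > 0" "kernel P" "kip P P \<noteq> 0"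
    "\<And>x y. x \<in> space M \<Longrightarrow> y \<in> space M \<Longrightarrow> kcomp K (kcomp K P) x y = c * P x y"
proof -
  interpret P: prob_space "M \<Otimes>\<^sub>M M" by (rule prob_space_pair_self)
  define tr where "tr = (\<lambda>n. kip K (kpow K n))"
  define a where "a = (\<lambda>n. tr (2 * n))"
  note kp = kernel_kpow[OF K]
  have kip_tr: "kip (kpow K n) (kpow K m) = tr (n + m)" for n m
    unfolding tr_def by (rule kip_kpow[OF K sym])
  have a_kip: "a n = kip (kpow K n) (kpow K n)" for n
    by (simp add: a_def kip_tr mult_2)
  have CS: "(tr (n + m))\<^sup>2 \<le> a n * a m" for n m
    using kip_Cauchy_Schwarz[OF kp kp, of n m] by (simp add: kip_tr a_def mult_2)
  have convex: "(a (Suc n))\<^sup>2 \<le> a n * a (Suc (Suc n))" for n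
    using CS[of n "Suc (Suc n)"] by (simp add: a_def mult_2)
  have submult: "a (Suc (n + m)) \<le> a n * a m" for n m
  proof -
    have "a (Suc (n + m)) = kip (kcomp (kpow K n) (kpow K m)) (kcomp (kpow K n) (kpow K m))"
      unfolding a_kip by (intro kip_cong kpow_add K)
    also have "\<dots> \<le> a n * a m"
      unfolding a_kip by (rule kip_kcomp_le[OF kp kp])
    finally show ?thesis .
  qed
  have a_nonneg: "a n \<ge> 0" for n unfolding a_kip by (rule kip_nonneg)
  have "kip K K \<noteq> 0" using nz kip_self_eq_0_iff[OF K] by simp
  then have a0: "a 0 \<noteq> 0" by (simp add: a_kip)
  have "kip (kcomp K K) (kcomp K K) \<noteq> 0"
    using nz kernel_AE_0_of_square[OF K sym] kip_self_eq_0_iff[OF kernel_kcomp[OF K K]] by blast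
  then have a1: "a (Suc 0) \<noteq> 0" by (simp add: a_kip)
  \<comment> \<open>By \<open>convex\<close>, a nonzero \<open>a (Suc n)\<close> makes
    \<open>a (Suc (Suc n))\<close> nonzero. The start \<open>a (Suc 0)\<close> is nonzero because a
    vanishing square would force \<open>K\<close> to vanish.\<close>
  have "a n \<noteq> 0 \<and> a (Suc n) \<noteq> 0" for n
  proof (induction n)
    case (Suc n)
    have "0 < (a (Suc n))\<^sup>2" using Suc.IH by simp
    also note convex
    finally show ?case using Suc.IH by auto
  qed (use a0 a1 in simp)
  then have a_pos: "a n > 0" for n using a_nonneg[of n] by (simp add: less_le)
  obtain c where c: "c > 0" and dec: "decseq (\<lambda>n. a n / c ^ Suc n)"
    and ge1: "\<And>n. a n / c ^ Suc n \<ge> 1"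
    using submultiplicative_log_convex_normalization[of a] a_pos convex submult by blast
  define u where "u = (\<lambda>n. a n / c ^ Suc n)"
  have "decseq u" "\<forall>n. 1 \<le> u n" using dec ge1 by (simp_all add: u_def)
  from decseq_convergent[OF this] obtain L where L: "u \<longlonglongrightarrow> L" by blast
  have "L \<ge> 1" using ge1 by (intro LIMSEQ_le_const[OF L]) (auto simp: u_def)
  \<comment> \<open>\<open>A n\<close> is the power \<open>2 n + 2\<close> over
    \<open>c ^ (n + 1)\<close>. An eigenvalue \<open>- sqrt c\<close> would make the sequence of all
    powers oscillate; along even powers the expected limit is the projection onto the eigenspaces of
    \<open>sqrt c\<close> and \<open>- sqrt c\<close>.\<close>
  define A where "A = (\<lambda>n x y. kpow K (Suc (2 * n)) x y / c ^ Suc n)"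
  have kA: "kernel (A n)" for n
    using bounded_measurable_divide[OF kp, of "Suc (2 * n)" "c ^ Suc n"]
    by (simp add: A_def case_prod_beta' del: kpow.simps)
  have kip_A: "kip (A n) (A m) = u (Suc (n + m))" for n m
    unfolding A_def kip_divide kip_tr u_def a_def
    by (simp add: power_add algebra_simps)
  obtain B where B: "\<And>p. p \<in> space (M \<Otimes>\<^sub>M M) \<Longrightarrow> \<bar>case p of (x, y) \<Rightarrow> K x y\<bar> \<le> B"
    using bounded_measurable_bound[OF K] by metis
  then have B: "\<bar>K x y\<bar> \<le> B" if "x \<in> space M" "y \<in> space M" for x y
    using that by (force simp: space_pair_measure)
  have A_Suc: "A (Suc n) x y = kcomp K (kcomp (A n) K) x y / c" if "x \<in> space M" "y \<in> space M" for n x y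
  proof -
    have "kcomp K (kcomp (A n) K) x y = kcomp K (kcomp (kpow K (Suc (2 * n))) K) x y / c ^ Suc n"
      by (simp add: kcomp_def A_def del: kpow.simps)
    also have "kcomp K (kcomp (kpow K (Suc (2 * n))) K) x y = kcomp K (kpow K (Suc (Suc (2 * n)))) x y"
      using kpow_add[OF K _ that(2), of _ "Suc (2 * n)" 0]
      by (intro kcomp_cong refl) (simp del: kpow.simps add: kpow.simps(1))
    finally show ?thesis using c by (simp add: A_def field_simps)
  qed
  have A_Suc': "kcomp K (kcomp K (A n)) x y = c * A (Suc n) x y" for n x y
    using c by (simp add: A_def kcomp_def field_simps)
  \<comment> \<open>The squared distance of \<open>A n\<close> and \<open>A m\<close> expands into
    three terms of \<open>u\<close>, which tend to \<open>L - 2 L + L = 0\<close>.\<close>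
  have bound: "(A (Suc n) x y - A (Suc m) x y)\<^sup>2 \<le> (B\<^sup>2 / c)\<^sup>2 * (u (Suc (n + n)) - 2 * u (Suc (n + m)) + u (Suc (m + m)))"
    if xy: "x \<in> space M" "y \<in> space M" for n m x y
  proof -
    let ?D = "\<lambda>x y. A n x y - A m x y"
    have "kcomp K (kcomp ?D K) x y = kcomp K (kcomp (A n) K) x y - kcomp K (kcomp (A m) K) x y"
    proof -
      have i: "integrable M (\<lambda>w. A n z w * K w y)" if "z \<in> space M" for n z
        by (intro bounded_measurable_integrable bounded_measurable_mult
            kernel_row[OF kA that] kernel_col[OF K xy(2)])
      have j: "integrable M (\<lambda>z. K x z * kcomp (A n) K z y)" for n
        by (intro bounded_measurable_integrable bounded_measurable_mult
            kernel_row[OF K xy(1)] kernel_col[OF kernel_kcomp[OF kA K] xy(2)])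
      have "kcomp K (kcomp ?D K) x y = (\<integral>z. K x z * kcomp (A n) K z y - K x z * kcomp (A m) K z y \<partial>M)"
        unfolding kcomp_def[of K "kcomp ?D K"]
      proof (intro Bochner_Integration.integral_cong refl)
        fix z assume "z \<in> space M"
        then show "K x z * kcomp ?D K z y = K x z * kcomp (A n) K z y - K x z * kcomp (A m) K z y"
          using i[of z n] i[of z m] by (simp add: kcomp_def algebra_simps)
      qed
      also have "\<dots> = kcomp K (kcomp (A n) K) x y - kcomp K (kcomp (A m) K) x y"
        using j[of n] j[of m] by (simp add: kcomp_def[of K])
      finally show ?thesis .
    qed
    then have "A (Suc n) x y - A (Suc m) x y = kcomp K (kcomp ?D K) x y / c"
      by (simp add: A_Suc[OF xy] diff_divide_distrib)
    moreover have "(kcomp K (kcomp ?D K) x y)\<^sup>2 \<le> (B\<^sup>2)\<^sup>2 * kip ?D ?D"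
      by (rule kcomp_sandwich_le[OF K kernel_diff[OF kA kA] xy B])
    ultimately have "(A (Suc n) x y - A (Suc m) x y)\<^sup>2 \<le> (B\<^sup>2 / c)\<^sup>2 * kip ?D ?D"
      by (simp add: power_divide divide_right_mono)
    then show ?thesis by (simp add: kip_diff_self[OF kA kA] kip_A)
  qed
  have "Cauchy (\<lambda>n. A (Suc n) x y)" if xy: "x \<in> space M" "y \<in> space M" for x y
  proof (rule CauchyI)
    fix e :: real assume e: "e > 0"
    \<comment> \<open>The summand 1 keeps \<open>k\<close> positive even when \<open>B = 0\<close>;
      in \<open>d\<close> the 4 is the total weight 1 + 2 + 1 of the three deviations from
      \<open>L\<close>.\<close>
    define k where "k = (B\<^sup>2 / c)\<^sup>2 + 1"
    define d where "d = e\<^sup>2 / (4 * k)"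
    have k: "k > 0" unfolding k_def by (rule add_nonneg_pos) simp_all
    then have d: "d > 0" using e by (simp add: d_def)
    obtain N where N: "\<And>n. n \<ge> N \<Longrightarrow> \<bar>u n - L\<bar> < d"
      using LIMSEQ_D[OF L d] by auto
    show "\<exists>N. \<forall>m\<ge>N. \<forall>n\<ge>N. norm (A (Suc m) x y - A (Suc n) x y) < e"
    proof (intro exI[of _ N] allI impI)
      fix m n assume mn: "m \<ge> N" "n \<ge> N"
      have "u (Suc (m + m)) - 2 * u (Suc (m + n)) + u (Suc (n + n)) \<le> 4 * d"
        using N[of "Suc (m + m)"] N[of "Suc (m + n)"] N[of "Suc (n + n)"] mn by (simp add: abs_less_iff)
      then have "(A (Suc m) x y - A (Suc n) x y)\<^sup>2 \<le> (B\<^sup>2 / c)\<^sup>2 * (4 * d)"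
        using bound[OF xy, of m n] mult_left_mono[of _ _ "(B\<^sup>2 / c)\<^sup>2"] zero_le_power2 order_trans by blast
      also have "\<dots> < k * (4 * d)"
        using d by (intro mult_strict_right_mono) (simp_all add: k_def)
      also have "\<dots> = e\<^sup>2" using k by (simp add: d_def)
      finally have "\<bar>A (Suc m) x y - A (Suc n) x y\<bar>\<^sup>2 < e\<^sup>2" by simp
      then show "norm (A (Suc m) x y - A (Suc n) x y) < e"
        using e power2_less_imp_less by fastforce
    qed
  qed
  then have conv: "(\<lambda>n. A (Suc n) x y) \<longlonglongrightarrow> lim (\<lambda>n. A (Suc n) x y)" if "x \<in> space M" "y \<in> space M" for x y
    using that by (simp add: Cauchy_convergent convergent_LIMSEQ_iff[symmetric])
  define P where "P = (\<lambda>x y. lim (\<lambda>n. A (Suc n) x y))"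
  have conv: "(\<lambda>n. A (Suc n) x y) \<longlonglongrightarrow> P x y" if "x \<in> space M" "y \<in> space M" for x y
    using conv[OF that] by (simp add: P_def)
  define B' where "B' = B\<^sup>2 / c * sqrt (u 0)"
  have bnd: "\<bar>A (Suc n) x y\<bar> \<le> B'" if xy: "x \<in> space M" "y \<in> space M" for n x y
  proof -
    have "u (Suc (n + n)) \<le> u 0" using decseqD[OF \<open>decseq u\<close>] by simp
    then have "(B\<^sup>2)\<^sup>2 * u (Suc (n + n)) \<le> (B\<^sup>2)\<^sup>2 * u 0" by (rule mult_left_mono) simp
    then have "(kcomp K (kcomp (A n) K) x y)\<^sup>2 \<le> (B\<^sup>2)\<^sup>2 * u 0"
      using kcomp_sandwich_le[OF K kA xy B, of n] unfolding kip_A by (rule order_trans[rotated])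
    also have "\<dots> = (B\<^sup>2 * sqrt (u 0))\<^sup>2"
      using a_nonneg[of 0] c by (simp add: power_mult_distrib u_def)
    finally have "\<bar>kcomp K (kcomp (A n) K) x y\<bar> \<le> \<bar>B\<^sup>2 * sqrt (u 0)\<bar>"
      by (simp only: abs_le_square_iff)
    also have "\<dots> = B\<^sup>2 * sqrt (u 0)"
      using a_nonneg[of 0] c by (intro abs_of_nonneg mult_nonneg_nonneg) (simp_all add: u_def)
    finally have "\<bar>kcomp K (kcomp (A n) K) x y\<bar> \<le> B\<^sup>2 * sqrt (u 0)" .
    then show ?thesis using c by (simp add: A_Suc[OF xy] B'_def field_simps)
  qed
  have kP: "kernel P"
    and "(\<lambda>n. \<integral>p. (case p of (x, y) \<Rightarrow> A (Suc n) x y)\<^sup>2 \<partial>(M \<Otimes>\<^sub>M M)) \<longlonglongrightarrow> (\<integral>p. (case p of (x, y) \<Rightarrow> P x y)\<^sup>2 \<partial>(M \<Otimes>\<^sub>M M))"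
  proof -
    show "kernel P"
      by (rule P.bounded_measurable_LIMSEQ(1)[where f = "\<lambda>n p. case p of (x, y) \<Rightarrow> A (Suc n) x y" and B = B'])
        (use kA bnd conv in \<open>auto simp: space_pair_measure\<close>)
    show "(\<lambda>n. \<integral>p. (case p of (x, y) \<Rightarrow> A (Suc n) x y)\<^sup>2 \<partial>(M \<Otimes>\<^sub>M M)) \<longlonglongrightarrow> (\<integral>p. (case p of (x, y) \<Rightarrow> P x y)\<^sup>2 \<partial>(M \<Otimes>\<^sub>M M))"
    proof (rule P.bounded_measurable_LIMSEQ(2)[where B = "B'\<^sup>2"])
      show "bounded_measurable (M \<Otimes>\<^sub>M M) (\<lambda>p. (case p of (x, y) \<Rightarrow> A (Suc n) x y)\<^sup>2)" for n
        by (rule bounded_measurable_power2[OF kA])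
      fix p assume "p \<in> space (M \<Otimes>\<^sub>M M)"
      then obtain x y where p: "p = (x, y)" "x \<in> space M" "y \<in> space M" by (auto simp: space_pair_measure)
      show "\<bar>(case p of (x, y) \<Rightarrow> A (Suc n) x y)\<^sup>2\<bar> \<le> B'\<^sup>2" for n
        using power_mono[OF bnd[OF p(2,3)], of n 2] by (simp add: p)
      show "(\<lambda>n. (case p of (x, y) \<Rightarrow> A (Suc n) x y)\<^sup>2) \<longlonglongrightarrow> (case p of (x, y) \<Rightarrow> P x y)\<^sup>2"
        using tendsto_power[OF conv[OF p(2,3)], of 2] by (simp add: p)
    qed
  qed
  then have "(\<lambda>n. u (Suc (Suc n + Suc n))) \<longlonglongrightarrow> kip P P"
    by (simp only: kip_self_pair[OF kP] kip_self_pair[OF kA, symmetric] kip_A)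
  moreover have "(\<lambda>n. u (Suc (Suc n + Suc n))) \<longlonglongrightarrow> L"
    using LIMSEQ_subseq_LIMSEQ[OF L, of "\<lambda>n. Suc (Suc n + Suc n)"] by (simp add: strict_mono_def o_def)
  ultimately have "kip P P \<noteq> 0"
    using \<open>L \<ge> 1\<close> LIMSEQ_unique by force
  moreover have "kcomp K (kcomp K P) x y = c * P x y" if xy: "x \<in> space M" "y \<in> space M" for x y
  proof -
    have inner: "(\<lambda>n. kcomp K (A (Suc n)) z y) \<longlonglongrightarrow> kcomp K P z y" if z: "z \<in> space M" for z
      unfolding kcomp_def
    proof (rule bounded_measurable_LIMSEQ(2)[where B = "B * B'"])
      show "bounded_measurable M (\<lambda>w. K z w * A (Suc n) w y)" for n
        by (intro bounded_measurable_mult kernel_row[OF K z] kernel_col[OF kA xy(2)])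
      fix w assume w: "w \<in> space M"
      show "\<bar>K z w * A (Suc n) w y\<bar> \<le> B * B'" for n
        unfolding abs_mult using B[OF z w] by (intro mult_mono bnd w xy) auto
      show "(\<lambda>n. K z w * A (Suc n) w y) \<longlonglongrightarrow> K z w * P w y"
        by (intro tendsto_intros conv w xy)
    qed
    have inner_bnd: "\<bar>kcomp K (A (Suc n)) z y\<bar> \<le> B * B'" if z: "z \<in> space M" for n z
      unfolding kcomp_def
    proof (rule abs_integral_le)
      show "bounded_measurable M (\<lambda>w. K z w * A (Suc n) w y)"
        by (intro bounded_measurable_mult kernel_row[OF K z] kernel_col[OF kA xy(2)])
      fix w assume w: "w \<in> space M"
      show "\<bar>K z w * A (Suc n) w y\<bar> \<le> B * B'"
        unfolding abs_mult using B[OF z w] by (intro mult_mono bnd w xy) auto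
    qed
    have "(\<lambda>n. kcomp K (kcomp K (A (Suc n))) x y) \<longlonglongrightarrow> kcomp K (kcomp K P) x y"
      unfolding kcomp_def[of K "kcomp K _"]
    proof (rule bounded_measurable_LIMSEQ(2)[where B = "B * (B * B')"])
      show "bounded_measurable M (\<lambda>z. K x z * kcomp K (A (Suc n)) z y)" for n
        by (intro bounded_measurable_mult kernel_row[OF K xy(1)] kernel_col[OF kernel_kcomp[OF K kA] xy(2)])
      fix z assume z: "z \<in> space M"
      show "\<bar>K x z * kcomp K (A (Suc n)) z y\<bar> \<le> B * (B * B')" for n
        unfolding abs_mult using B[OF xy(1) z] by (intro mult_mono inner_bnd z) auto
      show "(\<lambda>n. K x z * kcomp K (A (Suc n)) z y) \<longlonglongrightarrow> K x z * kcomp K P z y"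
        by (intro tendsto_intros inner z)
    qed
    then have "(\<lambda>n. c * A (Suc (Suc n)) x y) \<longlonglongrightarrow> kcomp K (kcomp K P) x y"
      by (simp only: A_Suc')
    moreover have "(\<lambda>n. c * A (Suc (Suc n)) x y) \<longlonglongrightarrow> c * P x y"
      by (intro tendsto_intros LIMSEQ_Suc[OF conv[OF xy]])
    ultimately show ?thesis by (rule LIMSEQ_unique)
  qed
  ultimately show ?thesis using that c kP by blast
qed

text \<open>A column \<open>h\<close> of the eigenkernel satisfies \<open>T (T h) = c h\<close>, and
  \<open>T^2 - c\<close> factors as \<open>(T - sqrt c) (T + sqrt c)\<close>. With
  \<open>g = T h + sqrt c h\<close>, either \<open>g\<close> vanishes and \<open>h\<close> has
  eigenvalue \<open>- sqrt c\<close>, or \<open>g\<close> has eigenvalue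
  \<open>sqrt c\<close>.\<close>

theorem symmetric_kernel_eigenfunction:
  assumes K: "kernel K" and sym: "\<And>x y. x \<in> space M \<Longrightarrow> y \<in> space M \<Longrightarrow> K x y = K y x"
    and nz: "\<not> (AE (x, y) in M \<Otimes>\<^sub>M M. K x y = 0)"
  obtains \<mu> g where "\<mu> \<noteq> 0" "bounded_measurable M g" "\<not> (AE x in M. g x = 0)"
    "AE x in M. (\<integral>y. K x y * g y \<partial>M) = \<mu> * g x"
proof -
  obtain c P where c: "c > 0" and P: "kernel P" "kip P P \<noteq> 0"
    and KKP: "\<And>x y. x \<in> space M \<Longrightarrow> y \<in> space M \<Longrightarrow> kcomp K (kcomp K P) x y = c * P x y"
    using kernel_square_eigenkernel[OF assms] by metis
  have "\<exists>y\<in>space M. (\<integral>x. (P x y)\<^sup>2 \<partial>M) \<noteq> 0"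
  proof (rule ccontr)
    assume "\<not> ?thesis"
    then have "(\<integral>y. \<integral>x. P x y * P x y \<partial>M \<partial>M) = (\<integral>y. 0 \<partial>M)"
      by (intro Bochner_Integration.integral_cong refl) (simp add: power2_eq_square)
    then show False
      using P(2) kernel_integral_swap[OF kernel_mult[OF P(1) P(1)]] by (simp add: kip_def)
  qed
  then obtain y where y: "y \<in> space M" "(\<integral>x. (P x y)\<^sup>2 \<partial>M) \<noteq> 0" by blast
  define h where "h = (\<lambda>x. P x y)"
  define T where "T = (\<lambda>f x. \<integral>z. K x z * f z \<partial>M)"
  have h: "bounded_measurable M h" unfolding h_def by (rule kernel_col[OF P(1) y(1)])
  have Th: "bounded_measurable M (T h)" unfolding T_def by (intro kernel_apply K h)
  have TTh: "T (T h) x = c * h x" if "x \<in> space M" for x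
    using KKP[OF that y(1)] by (simp add: T_def h_def kcomp_def)
  have h_nz: "\<not> (AE x in M. h x = 0)"
    using y(2) integral_power2_eq_0_iff[OF h] by (simp add: h_def)
  define g where "g = (\<lambda>x. T h x + sqrt c * h x)"
  have g: "bounded_measurable M g"
    unfolding g_def by (intro bounded_measurable_intros Th h)
  show ?thesis
  proof (cases "AE x in M. g x = 0")
    case True
    then have "AE x in M. T h x = - sqrt c * h x"
      by eventually_elim (simp add: g_def)
    then show ?thesis
      using that[of "- sqrt c" h] c h h_nz by (simp add: T_def)
  next
    case False
    have "T g x = sqrt c * g x" if x: "x \<in> space M" for x
    proof -
      have "integrable M (\<lambda>z. K x z * T h z)" "integrable M (\<lambda>z. K x z * h z)"
        by (intro bounded_measurable_integrable bounded_measurable_mult kernel_row[OF K x] Th h)+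
      then have "T g x = T (T h) x + sqrt c * T h x"
        by (simp add: T_def g_def distrib_left mult.left_commute[of _ "sqrt c"])
      then show ?thesis
        using c TTh[OF x] by (simp add: g_def algebra_simps)
    qed
    then have "AE x in M. (\<integral>z. K x z * g z \<partial>M) = sqrt c * g x"
      by (intro AE_I2) (simp add: T_def)
    then show ?thesis using that[of "sqrt c" g] c g False by simp
  qed
qed

end

section \<open>The space of square integrable functions and eigenspaces of graphons\<close>

lemma prob_space_unit_leb: "prob_space unit_leb"
  by (rule prob_spaceI) (simp add: emeasure_restrict_space space_restrict_space)

interpretation U: prob_space unit_leb
  by (rule prob_space_unit_leb)

lemma space_unit_leb [simp]: "space unit_leb = {0..1}"
  by (simp add: space_restrict_space)

lemma measure_unit_leb [simp]: "measure unit_leb {0..1} = 1"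
  using U.prob_space by simp

lemma graphon_kernel: "graphon W \<Longrightarrow> U.kernel W"
  by (rule bounded_measurableI[where B = 1]) (auto simp: graphon_def space_pair_measure)

lemma graphon_sym: "graphon W \<Longrightarrow> x \<in> {0..1} \<Longrightarrow> y \<in> {0..1} \<Longrightarrow> W x y = W y x"
  by (auto simp: graphon_def)

lemma graphon_bound: "graphon W \<Longrightarrow> x \<in> {0..1} \<Longrightarrow> y \<in> {0..1} \<Longrightarrow> 0 \<le> W x y \<and> W x y \<le> 1"
  by (auto simp: graphon_def)

lemma sq_integrable_mult:
  assumes "sq_integrable f" "sq_integrable g"
  shows "integrable unit_leb (\<lambda>x. f x * g x)"
proof -
  have [measurable]: "f \<in> borel_measurable unit_leb" "g \<in> borel_measurable unit_leb"
    using assms by (auto simp: sq_integrable_def)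
  have "integrable unit_leb (\<lambda>x. (f x)\<^sup>2 + (g x)\<^sup>2)"
    using assms by (auto simp: sq_integrable_def)
  then show ?thesis
  proof (rule Bochner_Integration.integrable_bound)
    have "\<bar>f x * g x\<bar> \<le> (f x)\<^sup>2 + (g x)\<^sup>2" for x
    proof -
      have "2 * \<bar>f x * g x\<bar> \<le> (f x)\<^sup>2 + (g x)\<^sup>2"
        using sum_squares_bound[of "\<bar>f x\<bar>" "\<bar>g x\<bar>"] by (simp add: abs_mult mult.assoc)
      then show ?thesis using abs_ge_zero[of "f x * g x"] by linarith
    qed
    then show "AE x in unit_leb. norm (f x * g x) \<le> norm ((f x)\<^sup>2 + (g x)\<^sup>2)" by simp
  qed measurable
qed

lemma bounded_measurable_sq_integrable: "bounded_measurable unit_leb f \<Longrightarrow> sq_integrable f"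
  unfolding sq_integrable_def
  by (auto dest: bounded_measurableD intro!: U.bounded_measurable_integrable bounded_measurable_power2)

lemma sq_integrable_integrable: "sq_integrable f \<Longrightarrow> integrable unit_leb f"
  using sq_integrable_mult[OF _ bounded_measurable_sq_integrable[OF bounded_measurable_const[of _ 1]]]
  by simp

text \<open>Gram-Schmidt and Bessel's inequality in \<open>L2\<close> will bound the multiplicities;
  norm and topology are those induced by the inner product.\<close>

instantiation L2 :: real_inner
begin

lift_definition inner_L2 :: "L2 \<Rightarrow> L2 \<Rightarrow> real" is "\<lambda>f g. \<integral>x. f x * g x \<partial>unit_leb"
proof (rule integral_cong_AE)
  fix f f' g g' assume eq: "L2_eq f f'" "L2_eq g g'"
  then show "(\<lambda>x. f x * g x) \<in> borel_measurable unit_leb" "(\<lambda>x. f' x * g' x) \<in> borel_measurable unit_leb"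
    by (auto simp: L2_eq_def sq_integrable_def)
  show "AE x in unit_leb. f x * g x = f' x * g' x"
    using eq unfolding L2_eq_def by (auto elim: eventually_elim2)
qed

definition norm_L2 :: "L2 \<Rightarrow> real" where "norm_L2 h = sqrt (inner h h)"

definition dist_L2 :: "L2 \<Rightarrow> L2 \<Rightarrow> real" where "dist_L2 h k = norm (h - k)"

definition sgn_L2 :: "L2 \<Rightarrow> L2" where "sgn_L2 h = h /\<^sub>R norm h"

definition uniformity_L2 :: "(L2 \<times> L2) filter" where
  "uniformity_L2 = (INF e\<in>{0 <..}. principal {(h, k). dist h k < e})"

definition open_L2 :: "L2 set \<Rightarrow> bool" where
  "open_L2 S \<longleftrightarrow> (\<forall>h\<in>S. \<forall>\<^sub>F (h', k) in uniformity. h' = h \<longrightarrow> k \<in> S)"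

instance
proof
  fix f g h :: L2 and r :: real and S :: "L2 set"
  show "inner f g = inner g f"
    by transfer (simp add: mult.commute)
  show "inner (f + g) h = inner f h + inner g h"
    by transfer (simp add: L2_eq_def distrib_right sq_integrable_mult)
  show "inner (r *\<^sub>R f) g = r * inner f g"
    by transfer (simp add: mult.assoc)
  show "0 \<le> inner f f"
    by transfer simp
  show "inner f f = 0 \<longleftrightarrow> f = 0"
  proof transfer
    fix f assume "L2_eq f f"
    then have "sq_integrable f" by (simp add: L2_eq_def)
    then show "((\<integral>x. f x * f x \<partial>unit_leb) = 0) = L2_eq f (\<lambda>x. 0)"
      using sq_integrable_mult[of f f] by (simp add: L2_eq_def sq_integrable_zero integral_nonneg_eq_0_iff_AE)
  qed
qed (simp_all add: norm_L2_def dist_L2_def sgn_L2_def uniformity_L2_def open_L2_def)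

end

lemma abs_L2_rep [simp]: "abs_L2 (rep_L2 h) = h"
  by (rule Quotient3_abs_rep[OF Quotient3_L2])

lemma sq_integrable_rep [simp]: "sq_integrable (rep_L2 h)"
  using Quotient3_rep_reflp[OF Quotient3_L2, of h] by (simp add: L2_eq_def)

lemma abs_L2_eq_iff:
  "sq_integrable f \<Longrightarrow> sq_integrable g \<Longrightarrow> abs_L2 f = abs_L2 g \<longleftrightarrow> (AE x in unit_leb. f x = g x)"
  using Quotient3_rel[OF Quotient3_L2, of f g] by (simp add: L2_eq_def)

lemma abs_L2_eq_0_iff: "sq_integrable f \<Longrightarrow> abs_L2 f = 0 \<longleftrightarrow> (AE x in unit_leb. f x = 0)"
  by (simp add: zero_L2_def abs_L2_eq_iff sq_integrable_zero)

lemma inner_abs_L2: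
  "sq_integrable f \<Longrightarrow> sq_integrable g \<Longrightarrow> inner (abs_L2 f) (abs_L2 g) = (\<integral>x. f x * g x \<partial>unit_leb)"
  by (rule inner_L2.abs_eq) (simp_all add: L2_eq_def)

lemma scaleR_abs_L2: "sq_integrable f \<Longrightarrow> c *\<^sub>R abs_L2 f = abs_L2 (\<lambda>x. c * f x)"
  by (rule scaleR_L2.abs_eq) (simp add: L2_eq_def)

lemma plus_abs_L2:
  "sq_integrable f \<Longrightarrow> sq_integrable g \<Longrightarrow> abs_L2 f + abs_L2 g = abs_L2 (\<lambda>x. f x + g x)"
  by (rule plus_L2.abs_eq) (simp_all add: L2_eq_def)

lemma L2_cases:
  obtains f where "sq_integrable f" "h = abs_L2 f"
  by (metis abs_L2_rep sq_integrable_rep)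

text \<open>On a probability space square integrable functions are integrable, so \<open>B\<close>
  times the integral of \<open>|f|\<close> bounds the image. This is why an eigenfunction for a
  nonzero eigenvalue has a bounded representative.\<close>

lemma kernel_apply_sq_integrable:
  assumes K: "U.kernel K" and f: "sq_integrable f"
  shows "bounded_measurable unit_leb (\<lambda>x. \<integral>y. K x y * f y \<partial>unit_leb)"
proof -
  obtain B where B: "\<And>p. p \<in> space (unit_leb \<Otimes>\<^sub>M unit_leb) \<Longrightarrow> \<bar>case p of (x, y) \<Rightarrow> K x y\<bar> \<le> B"
    using bounded_measurable_bound[OF K] by metis
  have [measurable]: "f \<in> borel_measurable unit_leb"
    "(\<lambda>(x, y). K x y) \<in> borel_measurable (unit_leb \<Otimes>\<^sub>M unit_leb)"
    using f bounded_measurableD[OF K] by (auto simp: sq_integrable_def)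
  show ?thesis
  proof (rule bounded_measurableI[where B = "B * (\<integral>y. \<bar>f y\<bar> \<partial>unit_leb)"])
    fix x assume x: "x \<in> space unit_leb"
    have "\<bar>\<integral>y. K x y * f y \<partial>unit_leb\<bar> \<le> (\<integral>y. \<bar>K x y * f y\<bar> \<partial>unit_leb)"
      by (rule integral_abs_bound)
    also have "\<dots> \<le> (\<integral>y. B * \<bar>f y\<bar> \<partial>unit_leb)"
    proof (rule integral_mono)
      show "integrable unit_leb (\<lambda>y. \<bar>K x y * f y\<bar>)"
        by (intro integrable_abs sq_integrable_mult f bounded_measurable_sq_integrable U.kernel_row[OF K x])
      show "integrable unit_leb (\<lambda>y. B * \<bar>f y\<bar>)"
        by (intro integrable_mult_right integrable_abs sq_integrable_integrable f)
      fix y assume "y \<in> space unit_leb"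
      then show "\<bar>K x y * f y\<bar> \<le> B * \<bar>f y\<bar>"
        using B[of "(x, y)"] x by (auto simp: abs_mult space_pair_measure intro!: mult_right_mono)
    qed
    finally show "\<bar>\<integral>y. K x y * f y \<partial>unit_leb\<bar> \<le> B * (\<integral>y. \<bar>f y\<bar> \<partial>unit_leb)" by simp
  qed measurable
qed

lemma graphon_op_abs:
  assumes W: "graphon W" and f: "sq_integrable f"
  shows "graphon_op W (abs_L2 f) = abs_L2 (\<lambda>x. \<integral>y. W x y * f y \<partial>unit_leb)"
proof -
  have K: "U.kernel W" by (rule graphon_kernel[OF W])
  have "AE x in unit_leb. rep_L2 (abs_L2 f) x = f x"
    using abs_L2_eq_iff[of "rep_L2 (abs_L2 f)" f] f by simp
  then have "(\<integral>y. W x y * rep_L2 (abs_L2 f) y \<partial>unit_leb) = (\<integral>y. W x y * f y \<partial>unit_leb)"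
    if "x \<in> {0..1}" for x
  proof (intro integral_cong_AE)
    have "sq_integrable (W x)"
      using that by (intro bounded_measurable_sq_integrable U.kernel_row[OF K]) simp
    then show "(\<lambda>y. W x y * rep_L2 (abs_L2 f) y) \<in> borel_measurable unit_leb"
      "(\<lambda>y. W x y * f y) \<in> borel_measurable unit_leb"
      using f by (auto intro!: borel_measurable_integrable sq_integrable_mult)
  qed auto
  then have "AE x in unit_leb. (\<integral>y. W x y * rep_L2 (abs_L2 f) y \<partial>unit_leb) = (\<integral>y. W x y * f y \<partial>unit_leb)"
    by (intro AE_I2) simp
  then show ?thesis
    unfolding graphon_op_def
    by (subst abs_L2_eq_iff)
      (simp_all add: bounded_measurable_sq_integrable kernel_apply_sq_integrable[OF K] f)
qed

lemma abs_L2_in_eigenspace_iff: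
  assumes W: "graphon W" and f: "sq_integrable f"
  shows "abs_L2 f \<in> eigenspace W \<mu> \<longleftrightarrow> (AE x in unit_leb. (\<integral>y. W x y * f y \<partial>unit_leb) = \<mu> * f x)"
  unfolding eigenspace_def mem_Collect_eq graphon_op_abs[OF assms] scaleR_abs_L2[OF f]
  by (intro abs_L2_eq_iff bounded_measurable_sq_integrable kernel_apply_sq_integrable
      graphon_kernel[OF W] f sq_integrable_scale)

lemma subspace_eigenspace:
  assumes W: "graphon W"
  shows "subspace (eigenspace W \<mu>)"
proof (rule subspaceI)
  note iff = abs_L2_in_eigenspace_iff[OF W]
  note int = sq_integrable_mult[OF bounded_measurable_sq_integrable[OF U.kernel_row[OF graphon_kernel[OF W]]]]
  show "0 \<in> eigenspace W \<mu>"
    by (simp add: zero_L2_def iff[OF sq_integrable_zero])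
  fix h k assume "h \<in> eigenspace W \<mu>" "k \<in> eigenspace W \<mu>"
  moreover obtain f where f: "sq_integrable f" "h = abs_L2 f" by (rule L2_cases)
  moreover obtain g where g: "sq_integrable g" "k = abs_L2 g" by (rule L2_cases)
  ultimately have "AE x in unit_leb. (\<integral>y. W x y * f y \<partial>unit_leb) = \<mu> * f x"
    "AE x in unit_leb. (\<integral>y. W x y * g y \<partial>unit_leb) = \<mu> * g x"
    by (auto simp: iff)
  moreover have "AE x in unit_leb. x \<in> {0..1}" by (rule AE_I2) simp
  ultimately have "AE x in unit_leb. (\<integral>y. W x y * (f y + g y) \<partial>unit_leb) = \<mu> * (f x + g x)"
    by eventually_elim (simp add: distrib_left int f g)
  then show "h + k \<in> eigenspace W \<mu>"
    by (simp add: f g plus_abs_L2 iff sq_integrable_add)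
next
  fix c h assume "h \<in> eigenspace W \<mu>"
  moreover obtain f where f: "sq_integrable f" "h = abs_L2 f" by (rule L2_cases)
  ultimately have "AE x in unit_leb. (\<integral>y. W x y * f y \<partial>unit_leb) = \<mu> * f x"
    by (auto simp: abs_L2_in_eigenspace_iff[OF W])
  then have "AE x in unit_leb. (\<integral>y. W x y * (c * f y) \<partial>unit_leb) = \<mu> * (c * f x)"
    by eventually_elim (simp add: mult.left_commute[of _ c])
  then show "c *\<^sub>R h \<in> eigenspace W \<mu>"
    by (simp add: f scaleR_abs_L2 abs_L2_in_eigenspace_iff[OF W] sq_integrable_scale)
qed

section \<open>Nonzero eigenvalues have finite multiplicity\<close>

lemma Bessel_finite:
  fixes C :: "'v::real_inner set"
  assumes "finite C" "pairwise orthogonal C"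
  shows "(\<Sum>f\<in>C. (w \<bullet> f)\<^sup>2 / (f \<bullet> f)) \<le> w \<bullet> w"
proof -
  \<comment> \<open>The orthogonal projection of \<open>w\<close> onto the span of \<open>C\<close>.
    A zero vector in \<open>C\<close> contributes 0, as \<open>x / 0 = 0\<close>.\<close>
  define s where "s = (\<Sum>f\<in>C. ((w \<bullet> f) / (f \<bullet> f)) *\<^sub>R f)"
  have ws: "w \<bullet> s = (\<Sum>f\<in>C. (w \<bullet> f)\<^sup>2 / (f \<bullet> f))"
    by (simp add: s_def inner_sum_right power2_eq_square)
  have sf: "s \<bullet> f = w \<bullet> f" if "f \<in> C" for f
  proof -
    have "s \<bullet> f = (\<Sum>g\<in>C. if g = f then w \<bullet> f else 0)"
      unfolding s_def inner_sum_left
    proof (rule sum.cong[OF refl])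
      fix g assume "g \<in> C"
      then have "g \<noteq> f \<Longrightarrow> g \<bullet> f = 0"
        using assms(2) that by (auto simp: pairwise_def orthogonal_def)
      then show "((w \<bullet> g) / (g \<bullet> g)) *\<^sub>R g \<bullet> f = (if g = f then w \<bullet> f else 0)"
        by (cases "f = 0") auto
    qed
    then show ?thesis using assms(1) that by simp
  qed
  have "s \<bullet> s = (\<Sum>f\<in>C. (w \<bullet> f)\<^sup>2 / (f \<bullet> f))"
    unfolding s_def inner_sum_right[of s, folded s_def]
    by (subst inner_sum_right) (simp add: sf[unfolded s_def] power2_eq_square)
  then have "0 \<le> w \<bullet> w - (\<Sum>f\<in>C. (w \<bullet> f)\<^sup>2 / (f \<bullet> f))"
    using inner_ge_zero[of "w - s"] ws by (simp add: inner_diff inner_commute[of s w])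
  then show ?thesis by simp
qed

text \<open>The inner product of the row \<open>W x\<close> with \<open>h\<close> is the value at
  \<open>x\<close> of the image of \<open>h\<close>, so Bessel's inequality for the row gives the
  bound 1 at each \<open>x\<close>. After integration over \<open>x\<close>, every member of
  \<open>C\<close> contributes exactly \<open>\<mu>^2\<close>.\<close>

lemma eigenspace_orthogonal_card:
  assumes W: "graphon W" and C: "finite C" "C \<subseteq> eigenspace W \<mu>" "pairwise orthogonal C" "0 \<notin> C"
  shows "real (card C) * \<mu>\<^sup>2 \<le> 1"
proof -
  have K: "U.kernel W" by (rule graphon_kernel[OF W])
  define T where "T = (\<lambda>h x. \<integral>y. W x y * rep_L2 h y \<partial>unit_leb)"
  have T: "bounded_measurable unit_leb (T h)" for h
    unfolding T_def by (intro kernel_apply_sq_integrable K sq_integrable_rep)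
  have norm_T: "(\<integral>x. (T h x)\<^sup>2 \<partial>unit_leb) = \<mu>\<^sup>2 * (h \<bullet> h)" if "h \<in> eigenspace W \<mu>" for h
  proof -
    have "graphon_op W h = abs_L2 (T h)" by (simp add: graphon_op_def T_def)
    then have "abs_L2 (T h) = \<mu> *\<^sub>R h" using that by (simp add: eigenspace_def)
    moreover have "abs_L2 (T h) \<bullet> abs_L2 (T h) = (\<integral>x. (T h x)\<^sup>2 \<partial>unit_leb)"
      using bounded_measurable_sq_integrable[OF T] by (simp add: inner_abs_L2 power2_eq_square)
    ultimately show ?thesis by (simp add: power2_eq_square)
  qed
  have le1: "(\<Sum>h\<in>C. (T h x)\<^sup>2 / (h \<bullet> h)) \<le> 1" if x: "x \<in> {0..1}" for x
  proof -
    have sq: "sq_integrable (\<lambda>y. W x y)"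
      using x by (intro bounded_measurable_sq_integrable U.kernel_row[OF K]) simp
    define w where "w = abs_L2 (\<lambda>y. W x y)"
    have "w \<bullet> h = T h x" for h
      using inner_abs_L2[OF sq sq_integrable_rep[of h]] by (simp add: w_def T_def)
    then have "(\<Sum>h\<in>C. (T h x)\<^sup>2 / (h \<bullet> h)) \<le> w \<bullet> w"
      using Bessel_finite[OF C(1,3), of w] by simp
    also have "\<dots> = (\<integral>y. W x y * W x y \<partial>unit_leb)"
      unfolding w_def by (rule inner_abs_L2[OF sq sq])
    also have "\<dots> \<le> 1"
    proof -
      have "\<bar>W x y * W x y\<bar> \<le> 1" if "y \<in> space unit_leb" for y
        using graphon_bound[OF W x, of y] that by (simp add: abs_mult mult_le_one)
      moreover have row: "bounded_measurable unit_leb (W x)"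
        using x by (intro U.kernel_row[OF K]) simp
      ultimately have "\<bar>\<integral>y. W x y * W x y \<partial>unit_leb\<bar> \<le> 1"
        by (intro U.abs_integral_le bounded_measurable_mult)
      then show ?thesis by (rule abs_le_D1)
    qed
    finally show ?thesis .
  qed
  have "real (card C) * \<mu>\<^sup>2 = (\<Sum>h\<in>C. (\<integral>x. (T h x)\<^sup>2 \<partial>unit_leb) / (h \<bullet> h))"
  proof -
    have "(\<integral>x. (T h x)\<^sup>2 \<partial>unit_leb) / (h \<bullet> h) = \<mu>\<^sup>2" if "h \<in> C" for h
    proof -
      have "h \<in> eigenspace W \<mu>" "h \<bullet> h \<noteq> 0" using C that by auto
      then show ?thesis using norm_T[of h] by simp
    qed
    then show ?thesis by simp
  qed
  also have "\<dots> = (\<integral>x. (\<Sum>h\<in>C. (T h x)\<^sup>2 / (h \<bullet> h)) \<partial>unit_leb)"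
    by (subst Bochner_Integration.integral_sum)
      (auto intro!: U.bounded_measurable_integrable bounded_measurable_intros T)
  also have "\<dots> \<le> (\<integral>x. 1 \<partial>unit_leb)"
    using le1 by (intro integral_mono Bochner_Integration.integrable_sum)
      (auto intro!: U.bounded_measurable_integrable bounded_measurable_intros T)
  finally show ?thesis by (simp add: U.prob_space)
qed

text \<open>\<open>dim\<close> is 0 for an infinite-dimensional space, so a finite basis has to be
  found before \<open>dim\<close> can serve as a multiplicity. More than \<open>1 / \<mu>^2\<close>
  independent eigenvectors would, after orthogonalization, violate the previous bound.\<close>

lemma eigenspace_finite_basis:
  assumes W: "graphon W" and "\<mu> \<noteq> 0"
  obtains B where "finite B" "B \<subseteq> eigenspace W \<mu>" "eigenspace W \<mu> \<subseteq> span B"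
    "card B = dim (eigenspace W \<mu>)"
proof -
  obtain B where B: "B \<subseteq> eigenspace W \<mu>" "independent B" "eigenspace W \<mu> \<subseteq> span B"
    "card B = dim (eigenspace W \<mu>)"
    using basis_exists[of "eigenspace W \<mu>"] by metis
  have "finite B"
  proof (rule ccontr)
    assume "infinite B"
    obtain n :: nat where n: "real n > 1 / \<mu>\<^sup>2" using reals_Archimedean2 by blast
    obtain B' where B': "B' \<subseteq> B" "finite B'" "card B' = n"
      using infinite_arbitrarily_large[OF \<open>infinite B\<close>] by metis
    obtain C where C: "finite C" "span C = span B'" "pairwise orthogonal C"
      using basis_orthogonal[OF B'(2)] by blast
    have "independent B'" using B(2) B'(1) by (rule independent_mono)
    \<comment> \<open>The orthogonalized family may contain the zero vector, which has to be removed
      before the bound applies; the span is unaffected.\<close>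
    have "C - {0} \<subseteq> eigenspace W \<mu>"
    proof -
      have "C \<subseteq> span B'" using C(2) span_superset by metis
      also have "\<dots> \<subseteq> eigenspace W \<mu>"
        using B'(1) B(1) by (intro span_minimal subspace_eigenspace[OF W]) auto
      finally show ?thesis by blast
    qed
    then have "real (card (C - {0})) * \<mu>\<^sup>2 \<le> 1"
      using C by (intro eigenspace_orthogonal_card[OF W]) (auto intro: pairwise_subset)
    moreover have "n \<le> card (C - {0})"
      using independent_span_bound[OF _ \<open>independent B'\<close>, of "C - {0}"] C B'(3)
      by (simp add: span_superset span_delete_0)
    then have "real n * \<mu>\<^sup>2 \<le> real (card (C - {0})) * \<mu>\<^sup>2"
      by (intro mult_right_mono) auto
    moreover have "1 < real n * \<mu>\<^sup>2" using n \<open>\<mu> \<noteq> 0\<close> by (simp add: field_simps)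
    ultimately show False by linarith
  qed
  then show ?thesis using B that by blast
qed

section \<open>Eigenvalues and zeros of the regularized determinant\<close>

lemma dim_eigenspace_pos:
  assumes "graphon W" "\<mu> \<noteq> 0" "\<mu> \<in> eigenvalues W"
  shows "dim (eigenspace W \<mu>) > 0"
proof -
  obtain B where B: "finite B" "eigenspace W \<mu> \<subseteq> span B" "card B = dim (eigenspace W \<mu>)"
    using eigenspace_finite_basis[OF assms(1,2)] by metis
  obtain h where "h \<in> eigenspace W \<mu>" "h \<noteq> 0" using assms(3) by (auto simp: eigenvalues_def)
  then have "B \<noteq> {}" using B(2) by auto
  then show ?thesis using B by (metis card_gt_0_iff)
qed

text \<open>Every finite set of eigenvalues containing \<open>\<mu>\<close> has a zero factor in its
  product, so the net of subproducts is eventually constant 0. Positivity of \<open>dim\<close>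
  matters, as a factor to the power 0 would be 1.\<close>

lemma det2_eigenvalue_eq_0:
  assumes "graphon W" "\<mu> \<noteq> 0" "\<mu> \<in> eigenvalues W"
  shows "det2 W (of_real (1 / \<mu>)) = 0"
proof -
  let ?f = "\<lambda>\<nu>. ((1 - of_real \<nu> * of_real (1 / \<mu>)) * exp (of_real \<nu> * of_real (1 / \<mu>))) ^ dim (eigenspace W \<nu>) :: complex"
  have "?f \<mu> = 0" using dim_eigenspace_pos[OF assms] assms(2) by simp
  then have "(\<Prod>\<nu>\<in>A. ?f \<nu>) = 0" if "finite A" "{\<mu>} \<subseteq> A" for A
    using that by (auto simp: prod_zero_iff)
  then have "eventually (\<lambda>A. (\<Prod>\<nu>\<in>A. ?f \<nu>) = 0) (finite_subsets_at_top (eigenvalues W))"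
    using assms(3) by (intro eventually_finite_subsets_at_top_weakI[THEN eventually_mono]
        eventually_finite_subsets_at_top[THEN iffD2]) (auto intro!: exI[of _ "{\<mu>}"])
  then have "((\<lambda>A. \<Prod>\<nu>\<in>A. ?f \<nu>) \<longlongrightarrow> 0) (finite_subsets_at_top (eigenvalues W))"
    by (rule tendsto_eventually)
  then show ?thesis
    unfolding det2_def by (rule tendsto_Lim[rotated]) simp
qed

lemma det2_finite:
  assumes "finite (eigenvalues W)"
  shows "det2 W z = (\<Prod>\<mu>\<in>eigenvalues W. ((1 - of_real \<mu> * z) * exp (of_real \<mu> * z)) ^ dim (eigenspace W \<mu>))"
  unfolding det2_def finite_subsets_at_top_finite[OF assms]
  by (rule tendsto_Lim) (auto simp: tendsto_principal_singleton principal_eq_bot_iff)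

section \<open>Graphons with the characteristic power series of a constant\<close>

context prob_space
begin

lemma kernel_AE_iff:
  assumes "kernel K"
  shows "(AE (x, y) in M \<Otimes>\<^sub>M M. K x y = c) \<longleftrightarrow> (AE x in M. AE y in M. K x y = c)"
proof -
  interpret pair_prob_space M M ..
  have [measurable]: "(\<lambda>(x, y). K x y) \<in> borel_measurable (M \<Otimes>\<^sub>M M)"
    by (rule bounded_measurableD[OF assms])
  have "{p \<in> space (M \<Otimes>\<^sub>M M). K (fst p) (snd p) = c} \<in> sets (M \<Otimes>\<^sub>M M)"
    by measurable
  then show ?thesis
    using AE_pair_iff[of "\<lambda>x y. K x y = c"] by (simp add: case_prod_beta')
qed

lemma kernel_symmetric_apply:
  assumes K: "kernel K" and sym: "\<And>x y. x \<in> space M \<Longrightarrow> y \<in> space M \<Longrightarrow> K x y = K y x"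
    and f: "bounded_measurable M f" and g: "bounded_measurable M g"
  shows "(\<integral>x. f x * (\<integral>y. K x y * g y \<partial>M) \<partial>M) = (\<integral>y. g y * (\<integral>x. K y x * f x \<partial>M) \<partial>M)"
proof -
  have k: "kernel (\<lambda>x y. f x * (K x y * g y))"
    by (intro kernel_mult kernel_fst[OF f] kernel_snd[OF g] K)
  have "(\<integral>x. f x * (\<integral>y. K x y * g y \<partial>M) \<partial>M) = (\<integral>x. \<integral>y. f x * (K x y * g y) \<partial>M \<partial>M)" by simp
  also have "\<dots> = (\<integral>y. \<integral>x. f x * (K x y * g y) \<partial>M \<partial>M)" by (rule kernel_integral_swap[OF k])
  also have "\<dots> = (\<integral>y. \<integral>x. g y * (K y x * f x) \<partial>M \<partial>M)"
  proof (intro Bochner_Integration.integral_cong refl)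
    fix y x assume "y \<in> space M" "x \<in> space M"
    then show "f x * (K x y * g y) = g y * (K y x * f x)" using sym[of x y] by simp
  qed
  finally show ?thesis by simp
qed

end

section \<open>Graphons that are almost everywhere constant\<close>

lemma graphon_AE_const_norms:
  assumes W: "graphon W" and ae: "AE (x, y) in unit_leb \<Otimes>\<^sub>M unit_leb. W x y = p" and "0 \<le> p"
  shows "graphon_norm1 W = p" "(graphon_norm2 W)\<^sup>2 = p\<^sup>2"
proof -
  interpret P: prob_space "unit_leb \<Otimes>\<^sub>M unit_leb" by (rule U.prob_space_pair_self)
  have [measurable]: "(\<lambda>(x, y). W x y) \<in> borel_measurable (unit_leb \<Otimes>\<^sub>M unit_leb)"
    by (rule bounded_measurableD[OF graphon_kernel[OF W]])
  have "graphon_norm1 W = (\<integral>q. p \<partial>(unit_leb \<Otimes>\<^sub>M unit_leb))"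
    unfolding graphon_norm1_def using ae \<open>0 \<le> p\<close>
    by (intro integral_cong_AE) (auto elim!: eventually_mono)
  then show "graphon_norm1 W = p" by (simp add: P.prob_space)
  have "(\<integral>(x, y). \<bar>W x y\<bar>\<^sup>2 \<partial>(unit_leb \<Otimes>\<^sub>M unit_leb)) = (\<integral>q. p\<^sup>2 \<partial>(unit_leb \<Otimes>\<^sub>M unit_leb))"
    using ae by (intro integral_cong_AE) (auto elim!: eventually_mono)
  then show "(graphon_norm2 W)\<^sup>2 = p\<^sup>2"
    by (simp add: graphon_norm2_def P.prob_space)
qed

lemma graphon_AE_const_eigenspace_iff:
  assumes W: "graphon W" and ae: "AE (x, y) in unit_leb \<Otimes>\<^sub>M unit_leb. W x y = p"
    and f: "sq_integrable f"
  shows "abs_L2 f \<in> eigenspace W \<mu> \<longleftrightarrow> (AE x in unit_leb. p * (\<integral>y. f y \<partial>unit_leb) = \<mu> * f x)"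
proof -
  have "AE x in unit_leb. AE y in unit_leb. W x y = p"
    using ae U.kernel_AE_iff[OF graphon_kernel[OF W]] by simp
  moreover have "AE x in unit_leb. x \<in> {0..1}" by (rule AE_I2) simp
  ultimately have T: "AE x in unit_leb. (\<integral>y. W x y * f y \<partial>unit_leb) = p * (\<integral>y. f y \<partial>unit_leb)"
  proof eventually_elim
    case (elim x)
    have "sq_integrable (W x)"
      using elim by (intro bounded_measurable_sq_integrable U.kernel_row[OF graphon_kernel[OF W]]) simp
    then have "(\<integral>y. W x y * f y \<partial>unit_leb) = (\<integral>y. p * f y \<partial>unit_leb)"
      using elim f by (intro integral_cong_AE borel_measurable_integrable integrable_mult_right
          sq_integrable_mult sq_integrable_integrable) (auto elim: eventually_mono)
    then show ?case by simp
  qed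
  show ?thesis
    unfolding abs_L2_in_eigenspace_iff[OF W f]
    using T by (intro iffI; elim AE_mp) (auto elim!: eventually_mono)
qed

text \<open>The operator sends \<open>f\<close> to the constant \<open>p\<close> times its mean, so
  a nonzero eigenvalue can only be \<open>p\<close>, with the constants as its eigenspace.\<close>

lemma char_series_AE_const:
  assumes W: "graphon W" and ae: "AE (x, y) in unit_leb \<Otimes>\<^sub>M unit_leb. W x y = p" and "0 \<le> p"
  shows "char_series W z = (1 - of_real p * z) * exp (of_real p * z - of_real (p * (1 - p) / 2) * z\<^sup>2)"
proof -
  note iff = graphon_AE_const_eigenspace_iff[OF W ae]
  have ev: "\<mu> = 0 \<or> \<mu> = p" if \<mu>: "\<mu> \<in> eigenvalues W" for \<mu>
  proof (rule ccontr)
    assume neg: "\<not> (\<mu> = 0 \<or> \<mu> = p)"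
    obtain h where h: "h \<in> eigenspace W \<mu>" "h \<noteq> 0" using \<mu> by (auto simp: eigenvalues_def)
    obtain f where f: "sq_integrable f" "h = abs_L2 f" by (rule L2_cases)
    define s where "s = (\<integral>y. f y \<partial>unit_leb)"
    have ae': "AE x in unit_leb. p * s = \<mu> * f x"
      using h f iff by (simp add: s_def)
    \<comment> \<open>Averaging the eigenvalue equation gives \<open>p s = \<mu> s\<close>; as
      \<open>\<mu>\<close> is neither \<open>p\<close> nor 0, first \<open>s\<close> and then
      \<open>f\<close> vanishes.\<close>
    have "(\<integral>x. p * s \<partial>unit_leb) = (\<integral>x. \<mu> * f x \<partial>unit_leb)"
      using ae' sq_integrable_integrable[OF f(1)] by (intro integral_cong_AE) auto
    then have "s = 0" using neg by (simp add: s_def)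
    then have "AE x in unit_leb. f x = 0" using ae' neg by simp
    then show False using h f by (simp add: abs_L2_eq_0_iff)
  qed
  then have sub: "eigenvalues W \<subseteq> {0, p}" by blast
  then have fin: "finite (eigenvalues W)" by (rule finite_subset) simp
  have "det2 W z = (1 - of_real p * z) * exp (of_real p * z)"
  proof (cases "p = 0")
    \<comment> \<open>Here \<open>p\<close> coincides with the eigenvalue 0, whose eigenspace is the
      whole space; its factor is 1 for any exponent.\<close>
    case True
    have "det2 W z = 1"
      unfolding det2_finite[OF fin]
    proof (rule prod.neutral, rule ballI)
      fix \<mu> assume "\<mu> \<in> eigenvalues W"
      then have "\<mu> = 0" using ev[of \<mu>] True by auto
      then show "((1 - of_real \<mu> * z) * exp (of_real \<mu> * z)) ^ dim (eigenspace W \<mu>) = 1" by simp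
    qed
    then show ?thesis using True by simp
  next
    case False
    define e where "e = abs_L2 (\<lambda>_. 1)"
    have one: "sq_integrable (\<lambda>_. 1)"
      by (intro bounded_measurable_sq_integrable bounded_measurable_const)
    have e: "e \<noteq> 0" "e \<in> eigenspace W p"
      using one by (simp_all add: e_def abs_L2_eq_0_iff iff U.prob_space)
    have "eigenspace W p = span {e}"
    proof
      show "span {e} \<subseteq> eigenspace W p"
        using e(2) by (intro span_minimal subspace_eigenspace[OF W]) simp
      show "eigenspace W p \<subseteq> span {e}"
      proof
        fix h assume h: "h \<in> eigenspace W p"
        obtain f where f: "sq_integrable f" "h = abs_L2 f" by (rule L2_cases)
        have "AE x in unit_leb. f x = (\<integral>y. f y \<partial>unit_leb) * 1"
          using h f iff False by (auto elim!: eventually_mono)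
        then have "h = (\<integral>y. f y \<partial>unit_leb) *\<^sub>R e"
          unfolding e_def f scaleR_abs_L2[OF one]
          using f(1) by (subst abs_L2_eq_iff)
            (simp_all add: bounded_measurable_sq_integrable bounded_measurable_const)
        then show "h \<in> span {e}" by (auto simp: span_singleton)
      qed
    qed
    then have "dim (eigenspace W p) = 1"
      using e(1) dim_span_eq_card_independent[of "{e}"] by simp
    moreover have "p \<in> eigenvalues W" using e by (auto simp: eigenvalues_def)
    ultimately have "(\<Prod>\<mu>\<in>{p}. ((1 - of_real \<mu> * z) * exp (of_real \<mu> * z)) ^ dim (eigenspace W \<mu>)) = det2 W z"
      unfolding det2_finite[OF fin] using sub fin by (intro prod.mono_neutral_left) auto
    then show ?thesis using \<open>dim (eigenspace W p) = 1\<close> by simp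
  qed
  moreover have "exp (of_real p * z) * exp (z\<^sup>2 * of_real ((p\<^sup>2 - p) / 2)) =
      exp (of_real p * z - of_real (p * (1 - p) / 2) * z\<^sup>2)"
    unfolding exp_add[symmetric]
    by (rule arg_cong[where f = exp]) (simp add: power2_eq_square algebra_simps diff_divide_distrib)
  ultimately show ?thesis
    unfolding char_series_def graphon_AE_const_norms[OF assms] by (simp add: mult.assoc)
qed

section \<open>Recovering the constant from the characteristic power series\<close>

text \<open>Deflation. If \<open>K' = W - p f(x) f(y)\<close> were nonzero, it would have an
  eigenfunction \<open>h\<close> with eigenvalue \<open>\<nu> \<noteq> 0\<close>. Pairing with
  \<open>f\<close> shows that \<open>h\<close> is orthogonal to \<open>f\<close>, so
  \<open>h\<close> is also an eigenfunction of \<open>W\<close>; hence \<open>\<nu> = p\<close> and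
  \<open>h\<close> is a multiple of \<open>f\<close>, which together with orthogonality makes it
  zero.\<close>

lemma graphon_rank_one:
  assumes W: "graphon W" and "p \<noteq> 0" and ev: "eigenvalues W \<subseteq> {0, p}" and dim: "dim (eigenspace W p) = 1"
  obtains f where "bounded_measurable unit_leb f" "(\<integral>x. (f x)\<^sup>2 \<partial>unit_leb) = 1"
    "AE (x, y) in unit_leb \<Otimes>\<^sub>M unit_leb. W x y = p * f x * f y"
proof -
  have K: "U.kernel W" by (rule graphon_kernel[OF W])
  obtain b where b: "eigenspace W p \<subseteq> span {b}" "b \<in> eigenspace W p" "b \<noteq> 0"
  proof -
    obtain B where B: "finite B" "B \<subseteq> eigenspace W p" "eigenspace W p \<subseteq> span B" "card B = 1"
      using eigenspace_finite_basis[OF W \<open>p \<noteq> 0\<close>] dim by metis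
    then obtain b where "B = {b}" by (auto simp: card_1_singleton_iff)
    moreover have "b \<noteq> 0"
    proof
      assume "b = 0"
      then have "dim (eigenspace W p) \<le> card ({} :: L2 set)"
        using B \<open>B = {b}\<close> by (intro dim_le_card) auto
      then show False using dim by simp
    qed
    ultimately show ?thesis using that B by auto
  qed
  obtain g0 where g0: "sq_integrable g0" "b = abs_L2 g0" by (rule L2_cases)
  \<comment> \<open>One application of the operator, divided by its eigenvalue, replaces the
    representative by a bounded one of the same class.\<close>
  define g where "g = (\<lambda>x. (\<integral>y. W x y * g0 y \<partial>unit_leb) / p)"
  have g: "bounded_measurable unit_leb g"
    unfolding g_def by (intro bounded_measurable_divide kernel_apply_sq_integrable K g0)
  have bg: "b = abs_L2 g"
    unfolding g0 using b(2) \<open>p \<noteq> 0\<close> g0 g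
    by (subst abs_L2_eq_iff)
      (auto simp: bounded_measurable_sq_integrable abs_L2_in_eigenspace_iff[OF W] g_def elim!: eventually_mono)
  have sg: "sq_integrable g" by (rule bounded_measurable_sq_integrable[OF g])
  define n where "n = (\<integral>x. (g x)\<^sup>2 \<partial>unit_leb)"
  have "n > 0"
  proof -
    have "n \<noteq> 0"
      using b(3) bg sg U.integral_power2_eq_0_iff[OF g] by (simp add: n_def abs_L2_eq_0_iff)
    moreover have "n \<ge> 0" unfolding n_def by (rule Bochner_Integration.integral_nonneg) simp
    ultimately show ?thesis by simp
  qed
  define f where "f = (\<lambda>x. g x / sqrt n)"
  have f: "bounded_measurable unit_leb f" unfolding f_def by (intro bounded_measurable_divide g)
  have f1: "(\<integral>x. (f x)\<^sup>2 \<partial>unit_leb) = 1"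
    using \<open>n > 0\<close> by (simp add: f_def power_divide n_def[symmetric])
  have Tf: "AE x in unit_leb. (\<integral>y. W x y * f y \<partial>unit_leb) = p * f x"
    using b(2) unfolding bg abs_L2_in_eigenspace_iff[OF W sg]
    by eventually_elim (simp add: f_def)
  have multiple: "\<exists>t. AE x in unit_leb. h x = t * f x"
    if "bounded_measurable unit_leb h" "AE x in unit_leb. (\<integral>y. W x y * h y \<partial>unit_leb) = p * h x" for h
  proof -
    have sh: "sq_integrable h" by (rule bounded_measurable_sq_integrable) fact
    then have "abs_L2 h \<in> span {b}" using that(2) b(1) abs_L2_in_eigenspace_iff[OF W sh] by blast
    then obtain t where "abs_L2 h = t *\<^sub>R abs_L2 g" by (auto simp: span_singleton bg)
    then have "AE x in unit_leb. h x = t * g x"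
      using sh sg by (simp add: scaleR_abs_L2 abs_L2_eq_iff sq_integrable_scale)
    then have "AE x in unit_leb. h x = (t * sqrt n) * f x"
      using \<open>n > 0\<close> by (simp add: f_def)
    then show ?thesis by blast
  qed
  define K' where "K' = (\<lambda>x y. W x y - p * (f x * f y))"
  have K': "U.kernel K'"
    unfolding K'_def
    by (intro U.kernel_diff U.kernel_mult U.kernel_const U.kernel_fst[OF f] U.kernel_snd[OF f] K)
  have "AE (x, y) in unit_leb \<Otimes>\<^sub>M unit_leb. K' x y = 0"
  proof (rule ccontr)
    assume nz: "\<not> ?thesis"
    have sym: "K' x y = K' y x" if "x \<in> space unit_leb" "y \<in> space unit_leb" for x y
      using graphon_sym[OF W, of x y] that by (simp add: K'_def)
    obtain \<nu> h where h: "\<nu> \<noteq> 0" "bounded_measurable unit_leb h" "\<not> (AE x in unit_leb. h x = 0)"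
      "AE x in unit_leb. (\<integral>y. K' x y * h y \<partial>unit_leb) = \<nu> * h x"
      by (rule U.symmetric_kernel_eigenfunction[OF K' sym nz])
    define s where "s = (\<integral>y. f y * h y \<partial>unit_leb)"
    define T where "T = (\<lambda>x. \<integral>y. W x y * h y \<partial>unit_leb)"
    have T: "bounded_measurable unit_leb T" unfolding T_def by (intro U.kernel_apply K h)
    have expand: "(\<integral>y. K' x y * h y \<partial>unit_leb) = T x - p * f x * s" if "x \<in> {0..1}" for x
    proof -
      have "integrable unit_leb (\<lambda>y. W x y * h y)" "integrable unit_leb (\<lambda>y. f y * h y)"
        using that by (auto intro!: U.bounded_measurable_integrable bounded_measurable_mult f h U.kernel_row[OF K])
      moreover have "K' x y * h y = W x y * h y - p * f x * (f y * h y)" for y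
        by (simp add: K'_def algebra_simps)
      ultimately show ?thesis by (simp add: T_def s_def)
    qed
    have "AE x in unit_leb. x \<in> {0..1}" by (rule AE_I2) simp
    with h(4) have eq: "AE x in unit_leb. T x - p * f x * s = \<nu> * h x"
      by eventually_elim (simp add: expand)
    have ints: "integrable unit_leb (\<lambda>x. f x * T x)" "integrable unit_leb (\<lambda>x. (f x)\<^sup>2)"
      "integrable unit_leb (\<lambda>x. f x * h x)"
      by (intro U.bounded_measurable_integrable bounded_measurable_intros f h T)+
    have "(\<integral>x. f x * T x \<partial>unit_leb) = (\<integral>y. h y * (\<integral>x. W y x * f x \<partial>unit_leb) \<partial>unit_leb)"
      unfolding T_def using graphon_sym[OF W] by (intro U.kernel_symmetric_apply K f h) auto
    also have "\<dots> = (\<integral>y. p * (f y * h y) \<partial>unit_leb)"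
      using Tf bounded_measurableD[OF h(2)] bounded_measurableD[OF f] bounded_measurableD[OF U.kernel_apply[OF K f]]
      by (intro integral_cong_AE) (auto elim!: eventually_mono)
    finally have fT: "(\<integral>x. f x * T x \<partial>unit_leb) = p * s" by (simp add: s_def)
    \<comment> \<open>\<open>eq\<close> multiplied by \<open>f\<close> and integrated; the left side
      is \<open>p s - p s\<close>, as \<open>f\<close> has norm one.\<close>
    have "(\<integral>x. f x * T x - p * s * (f x)\<^sup>2 \<partial>unit_leb) = (\<integral>x. \<nu> * (f x * h x) \<partial>unit_leb)"
      using eq bounded_measurableD[OF h(2)] bounded_measurableD[OF f] bounded_measurableD[OF T]
      by (intro integral_cong_AE) (auto elim!: eventually_mono simp: algebra_simps power2_eq_square)
    then have "\<nu> * s = 0" using ints by (simp add: fT f1 s_def[symmetric])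
    then have "s = 0" using h(1) by simp
    then have Th: "AE x in unit_leb. (\<integral>y. W x y * h y \<partial>unit_leb) = \<nu> * h x"
      using eq by (simp add: T_def)
    have sh: "sq_integrable h" by (rule bounded_measurable_sq_integrable) fact
    have "\<nu> \<in> eigenvalues W"
      using Th h(3) abs_L2_in_eigenspace_iff[OF W sh] abs_L2_eq_0_iff[OF sh]
      unfolding eigenvalues_def by blast
    then have "\<nu> = p" using ev h(1) by auto
    then obtain t where t: "AE x in unit_leb. h x = t * f x"
      using multiple h(2) Th by blast
    have "s = (\<integral>x. t * (f x)\<^sup>2 \<partial>unit_leb)"
      unfolding s_def using t bounded_measurableD[OF h(2)] bounded_measurableD[OF f]
      by (intro integral_cong_AE) (auto elim!: eventually_mono simp: power2_eq_square)
    then have "t = 0" using \<open>s = 0\<close> f1 by simp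
    then show False using t h(3) by simp
  qed
  then have "AE (x, y) in unit_leb \<Otimes>\<^sub>M unit_leb. W x y = p * f x * f y"
    by (auto elim!: eventually_mono simp: K'_def)
  then show ?thesis using that f f1 by blast
qed

lemma graphon_norms_pair:
  assumes W: "graphon W"
  shows "graphon_norm1 W = (\<integral>x. \<integral>y. W x y \<partial>unit_leb \<partial>unit_leb)"
    "(graphon_norm2 W)\<^sup>2 = U.kip W W"
proof -
  have K: "U.kernel W" by (rule graphon_kernel[OF W])
  have "graphon_norm1 W = (\<integral>(x, y). W x y \<partial>(unit_leb \<Otimes>\<^sub>M unit_leb))"
    unfolding graphon_norm1_def using graphon_bound[OF W]
    by (intro Bochner_Integration.integral_cong refl) (auto simp: space_pair_measure)
  then show "graphon_norm1 W = (\<integral>x. \<integral>y. W x y \<partial>unit_leb \<partial>unit_leb)"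
    by (simp add: U.kernel_integral[OF K])
  have "(\<integral>(x, y). \<bar>W x y\<bar>\<^sup>2 \<partial>(unit_leb \<Otimes>\<^sub>M unit_leb)) = U.kip W W"
    unfolding U.kip_self_pair[OF K] by (intro Bochner_Integration.integral_cong refl) auto
  then show "(graphon_norm2 W)\<^sup>2 = U.kip W W"
    by (simp add: graphon_norm2_def U.kip_nonneg)
qed

text \<open>The order of the zero at \<open>1 / p\<close> determines \<open>m\<close>. With
  \<open>m = 1\<close> the linear factors agree, and one further point determines
  \<open>k\<close>.\<close>

lemma char_series_coefficients:
  fixes p k :: real and m :: nat
  assumes "p > 0" "m > 0"
    and eq: "\<And>z::complex. ((1 - of_real p * z) * exp (of_real p * z)) ^ m * exp (z\<^sup>2 * of_real (k / 2))
        = (1 - of_real p * z) * exp (of_real p * z - of_real (p * (1 - p) / 2) * z\<^sup>2)"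
  shows "m = 1" "k = p\<^sup>2 - p"
proof -
  show m: "m = 1"
  proof (rule ccontr)
    assume "m \<noteq> 1"
    then obtain j where j: "m = Suc (Suc j)" using \<open>m > 0\<close> by (metis One_nat_def gr0_implies_Suc not0_implies_Suc)
    define a where "a = (of_real (1 / p) :: complex)"
    \<comment> \<open>\<open>l\<close> and \<open>r\<close> are the two sides of \<open>eq\<close>
      divided by one factor \<open>1 - p z\<close>. For \<open>m \<ge> 2\<close> the quotient
      \<open>l\<close> still vanishes at \<open>a = 1 / p\<close>, whereas \<open>r\<close> is an
      exponential; their equality reaches \<open>a\<close> by continuity.\<close>
    define l where "l = (\<lambda>z::complex. (1 - of_real p * z) ^ Suc j * exp (of_real p * z) ^ m * exp (z\<^sup>2 * of_real (k / 2)))"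
    define r where "r = (\<lambda>z::complex. exp (of_real p * z - of_real (p * (1 - p) / 2) * z\<^sup>2))"
    have "l z = r z" if "z \<noteq> a" for z
    proof -
      have "1 - of_real p * z \<noteq> 0"
        using that \<open>p > 0\<close> by (auto simp: a_def field_simps)
      moreover have "(1 - of_real p * z) * l z = (1 - of_real p * z) * r z"
        using eq[of z] by (simp add: l_def r_def j power_mult_distrib mult_ac)
      ultimately show ?thesis by simp
    qed
    then have ev: "\<forall>\<^sub>F z in at a. l z = r z"
      by (auto simp: eventually_at intro: exI[of _ 1])
    have "isCont l a" "isCont r a" unfolding l_def r_def by (intro continuous_intros)+
    then have "(l \<longlongrightarrow> l a) (at a)" "(r \<longlongrightarrow> r a) (at a)" by (auto simp: isCont_def)
    then have "l a = r a"
      using tendsto_cong[OF ev] tendsto_unique[of "at a" r] by auto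
    then show False using \<open>p > 0\<close> by (simp add: l_def r_def a_def)
  qed
  \<comment> \<open>Evaluation at -1, where \<open>1 - p z = 1 + p\<close> is nonzero. At a real
    point both exponents are real, so \<open>exp\<close> can be inverted without an ambiguity by
    multiples of \<open>2 pi i\<close>.\<close>
  have "(1 + of_real p) * (exp (- of_real p) * exp (of_real (k / 2))) =
        (1 + of_real p) * (exp (- of_real p) * exp (of_real (- (p * (1 - p) / 2))) :: complex)"
    using eq[of "-1"] by (simp add: m exp_add[symmetric] add.commute)
  moreover have "(1 + of_real p :: complex) \<noteq> 0"
    using \<open>p > 0\<close> by (metis add_pos_pos less_irrefl of_real_1 of_real_add of_real_eq_0_iff zero_less_one)
  ultimately have "exp (of_real (k / 2) :: complex) = exp (of_real (- (p * (1 - p) / 2)))" by simp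
  then have "exp (k / 2) = exp (- (p * (1 - p) / 2))"
    by (simp only: exp_of_real of_real_eq_iff)
  then have "k / 2 = - (p * (1 - p) / 2)" by simp
  then have "k = - (p * (1 - p))" by linarith
  then show "k = p\<^sup>2 - p" by (simp add: algebra_simps power2_eq_square)
qed

lemma graphon_AE_const_of_char_series:
  assumes W: "graphon W" and "0 \<le> p"
    and eq: "\<And>z. char_series W z = (1 - of_real p * z) * exp (of_real p * z - of_real (p * (1 - p) / 2) * z\<^sup>2)"
  shows "AE (x, y) in unit_leb \<Otimes>\<^sub>M unit_leb. W x y = p"
proof -
  have K: "U.kernel W" by (rule graphon_kernel[OF W])
  have ev: "\<mu> = p" if "\<mu> \<in> eigenvalues W" "\<mu> \<noteq> 0" for \<mu>
  proof -
    have "char_series W (of_real (1 / \<mu>)) = 0"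
      using det2_eigenvalue_eq_0[OF W that(2,1)] by (simp add: char_series_def)
    then have "1 - of_real p * of_real (1 / \<mu>) = (0 :: complex)" using eq[of "of_real (1 / \<mu>)"] by simp
    then have "of_real (1 - p * (1 / \<mu>)) = (0 :: complex)" by simp
    then have "1 - p * (1 / \<mu>) = 0" by (simp only: of_real_eq_0_iff)
    then show ?thesis using that(2) by (simp add: field_simps)
  qed
  show ?thesis
  proof (cases "AE (x, y) in unit_leb \<Otimes>\<^sub>M unit_leb. W x y = 0")
    \<comment> \<open>The zero kernel has no eigenfunction with nonzero eigenvalue to start from.
      Its series is constantly 1, while the given one vanishes at \<open>1 / p\<close> unless
      \<open>p = 0\<close>.\<close>
    case True
    have "p = 0"
    proof (rule ccontr)
      assume "p \<noteq> 0"
      then show False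
        using eq[of "of_real (1 / p)"] char_series_AE_const[OF W True, of "of_real (1 / p)"] by simp
    qed
    then show ?thesis using True by simp
  next
    case False
    obtain \<mu> g where g: "\<mu> \<noteq> 0" "bounded_measurable unit_leb g" "\<not> (AE x in unit_leb. g x = 0)"
      "AE x in unit_leb. (\<integral>y. W x y * g y \<partial>unit_leb) = \<mu> * g x"
      by (rule U.symmetric_kernel_eigenfunction[OF K _ False]) (use graphon_sym[OF W] in auto)
    have sg: "sq_integrable g" by (rule bounded_measurable_sq_integrable) fact
    have "\<mu> \<in> eigenvalues W"
      using g abs_L2_in_eigenspace_iff[OF W sg] abs_L2_eq_0_iff[OF sg] unfolding eigenvalues_def by blast
    then have p: "p \<in> eigenvalues W" "p > 0" using ev[of \<mu>] g(1) \<open>0 \<le> p\<close> by auto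
    have sub: "eigenvalues W \<subseteq> {0, p}" using ev by auto
    then have fin: "finite (eigenvalues W)" by (rule finite_subset) simp
    define m where "m = dim (eigenspace W p)"
    define k where "k = (graphon_norm2 W)\<^sup>2 - graphon_norm1 W"
    have "m > 0" unfolding m_def using dim_eigenspace_pos[OF W _ p(1)] p(2) by simp
    have "det2 W z = ((1 - of_real p * z) * exp (of_real p * z)) ^ m" for z :: complex
    proof -
      have "(\<Prod>\<mu>\<in>{p}. ((1 - of_real \<mu> * z) * exp (of_real \<mu> * z)) ^ dim (eigenspace W \<mu>)) = det2 W z"
        unfolding det2_finite[OF fin] using p(1) sub fin by (intro prod.mono_neutral_left) auto
      then show ?thesis by (simp add: m_def)
    qed
    then have "((1 - of_real p * z) * exp (of_real p * z)) ^ m * exp (z\<^sup>2 * of_real (k / 2))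
        = (1 - of_real p * z) * exp (of_real p * z - of_real (p * (1 - p) / 2) * z\<^sup>2)" for z :: complex
      using eq[of z] by (simp add: char_series_def k_def)
    from char_series_coefficients[OF p(2) \<open>m > 0\<close> this] have m: "m = 1" and k: "k = p\<^sup>2 - p" by auto
    obtain f where f: "bounded_measurable unit_leb f" "(\<integral>x. (f x)\<^sup>2 \<partial>unit_leb) = 1"
      "AE (x, y) in unit_leb \<Otimes>\<^sub>M unit_leb. W x y = p * f x * f y"
      by (rule graphon_rank_one[OF W _ sub]) (use p(2) m m_def in auto)
    define K' where "K' = (\<lambda>x y. W x y - p * (f x * f y))"
    have K': "U.kernel K'"
      unfolding K'_def by (intro U.kernel_diff U.kernel_mult U.kernel_const U.kernel_fst[OF f(1)] U.kernel_snd[OF f(1)] K)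
    have "AE (x, y) in unit_leb \<Otimes>\<^sub>M unit_leb. K' x y = 0"
      using f(3) by (auto elim!: eventually_mono simp: K'_def)
    then have ae: "AE x in unit_leb. AE y in unit_leb. W x y = p * f x * f y"
      unfolding U.kernel_AE_iff[OF K'] by (simp add: K'_def mult.assoc)
    define s where "s = (\<integral>x. f x \<partial>unit_leb)"
    have dom: "AE x in unit_leb. x \<in> {0..1}" by (rule AE_I2) simp
    have "AE x in unit_leb. (\<integral>y. W x y \<partial>unit_leb) = p * f x * s"
      using ae dom
    proof eventually_elim
      case (elim x)
      have "(\<integral>y. W x y \<partial>unit_leb) = (\<integral>y. p * f x * f y \<partial>unit_leb)"
        using elim bounded_measurableD[OF U.kernel_row[OF K, of x]] bounded_measurableD[OF f(1)]
        by (intro integral_cong_AE) auto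
      then show ?case by (simp add: s_def)
    qed
    then have "graphon_norm1 W = (\<integral>x. p * f x * s \<partial>unit_leb)"
      unfolding graphon_norms_pair(1)[OF W]
      using bounded_measurableD[OF U.bounded_measurable_integral[OF K]] bounded_measurableD[OF f(1)]
      by (intro integral_cong_AE) auto
    then have N1: "graphon_norm1 W = p * s\<^sup>2" by (simp add: s_def power2_eq_square)
    have "AE x in unit_leb. (\<integral>y. W x y * W x y \<partial>unit_leb) = p\<^sup>2 * (f x)\<^sup>2"
      using ae dom
    proof eventually_elim
      case (elim x)
      have "(\<integral>y. W x y * W x y \<partial>unit_leb) = (\<integral>y. p\<^sup>2 * (f x)\<^sup>2 * (f y)\<^sup>2 \<partial>unit_leb)"
        using elim bounded_measurableD[OF U.kernel_row[OF K, of x]] bounded_measurableD[OF f(1)]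
        by (intro integral_cong_AE) (auto elim!: eventually_mono simp: power2_eq_square)
      then show ?case by (simp add: f(2))
    qed
    then have "(graphon_norm2 W)\<^sup>2 = (\<integral>x. p\<^sup>2 * (f x)\<^sup>2 \<partial>unit_leb)"
      unfolding graphon_norms_pair(2)[OF W] U.kip_def
      using bounded_measurableD[OF U.bounded_measurable_integral[OF U.kernel_mult[OF K K]]] bounded_measurableD[OF f(1)]
      by (intro integral_cong_AE) auto
    then have N2: "(graphon_norm2 W)\<^sup>2 = p\<^sup>2" by (simp add: f(2))
    \<comment> \<open>The value of \<open>k\<close> reads \<open>p^2 - p s^2 = p^2 - p\<close>. Thus
      the mean of \<open>f\<close> squares to its second moment, which makes \<open>f\<close>
      constant; the sign of \<open>s\<close> stays open but cancels in
      \<open>f x * f y\<close>.\<close>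
    have "s\<^sup>2 = 1" using k p(2) by (simp add: k_def N1 N2)
    then have "AE x in unit_leb. f x = s"
      by (intro U.AE_eq_const_of_moments f(1)) (auto simp: s_def f(2))
    then have "AE x in unit_leb. AE y in unit_leb. f x = s \<and> f y = s" by auto
    with ae have "AE x in unit_leb. AE y in unit_leb. W x y = p"
    proof eventually_elim
      case (elim x)
      then show ?case by eventually_elim (use \<open>s\<^sup>2 = 1\<close> in \<open>simp add: power2_eq_square\<close>)
    qed
    then show ?thesis by (simp add: U.kernel_AE_iff[OF K])
  qed
qed

section \<open>Homomorphism densities\<close>

context prob_space
begin

text \<open>Two distinct coordinates of the product are independent with law \<open>M\<close>. This
  transports integrals and almost sure statements about a kernel to any edge of a test
  graph.\<close>

lemma distr_PiM_pair:
  assumes "u \<in> V" "v \<in> V" "u \<noteq> v"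
  shows "distr (\<Pi>\<^sub>M i\<in>V. M) (M \<Otimes>\<^sub>M M) (\<lambda>x. (x u, x v)) = M \<Otimes>\<^sub>M M"
proof (rule pair_measure_eqI[symmetric])
  interpret V: product_prob_space "\<lambda>_. M" V ..
  show "sigma_finite_measure M" "sigma_finite_measure M" by unfold_locales
  have meas: "(\<lambda>x. (x u, x v)) \<in> measurable (\<Pi>\<^sub>M i\<in>V. M) (M \<Otimes>\<^sub>M M)"
    using assms by (intro measurable_Pair measurable_component_singleton)
  fix A B assume A: "A \<in> sets M" and B: "B \<in> sets M"
  have "emeasure (distr (\<Pi>\<^sub>M i\<in>V. M) (M \<Otimes>\<^sub>M M) (\<lambda>x. (x u, x v))) (A \<times> B)
      = emeasure (\<Pi>\<^sub>M i\<in>V. M) ((\<lambda>x. (x u, x v)) -` (A \<times> B) \<inter> space (\<Pi>\<^sub>M i\<in>V. M))"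
    using A B by (intro emeasure_distr meas) auto
  also have "(\<lambda>x. (x u, x v)) -` (A \<times> B) \<inter> space (\<Pi>\<^sub>M i\<in>V. M)
      = {x \<in> space (\<Pi>\<^sub>M i\<in>V. M). \<forall>i\<in>{u, v}. x i \<in> (if i = u then A else B)}"
    using assms(3) by auto
  also have "emeasure (\<Pi>\<^sub>M i\<in>V. M) \<dots> = (\<Prod>i\<in>{u, v}. emeasure M (if i = u then A else B))"
    using assms A B by (intro V.emeasure_PiM_Collect) auto
  also have "\<dots> = emeasure M A * emeasure M B" using assms(3) by simp
  finally show "emeasure M A * emeasure M B
      = emeasure (distr (\<Pi>\<^sub>M i\<in>V. M) (M \<Otimes>\<^sub>M M) (\<lambda>x. (x u, x v))) (A \<times> B)" by simp
qed simp

lemma measurable_PiM_pair: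
  "u \<in> V \<Longrightarrow> v \<in> V \<Longrightarrow> (\<lambda>x. (x u, x v)) \<in> measurable (\<Pi>\<^sub>M i\<in>V. M) (M \<Otimes>\<^sub>M M)"
  by (intro measurable_Pair measurable_component_singleton)

lemma kernel_PiM:
  "kernel K \<Longrightarrow> u \<in> V \<Longrightarrow> v \<in> V \<Longrightarrow> bounded_measurable (\<Pi>\<^sub>M i\<in>V. M) (\<lambda>x. K (x u) (x v))"
  by (intro kernel_compose measurable_component_singleton)

lemma integral_PiM_pair:
  assumes "kernel K" "u \<in> V" "v \<in> V" "u \<noteq> v"
  shows "(\<integral>x. K (x u) (x v) \<partial>(\<Pi>\<^sub>M i\<in>V. M)) = (\<integral>x. \<integral>y. K x y \<partial>M \<partial>M)"
proof -
  have "(\<integral>(x, y). K x y \<partial>(M \<Otimes>\<^sub>M M))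
      = (\<integral>(x, y). K x y \<partial>(distr (\<Pi>\<^sub>M i\<in>V. M) (M \<Otimes>\<^sub>M M) (\<lambda>x. (x u, x v))))"
    by (simp only: distr_PiM_pair[OF assms(2-4)])
  also have "\<dots> = (\<integral>x. K (x u) (x v) \<partial>(\<Pi>\<^sub>M i\<in>V. M))"
    using integral_distr[OF measurable_PiM_pair[OF assms(2,3)] bounded_measurableD[OF assms(1)]] by simp
  finally have "(\<integral>(x, y). K x y \<partial>(M \<Otimes>\<^sub>M M)) = (\<integral>x. K (x u) (x v) \<partial>(\<Pi>\<^sub>M i\<in>V. M))" .
  then show ?thesis by (simp add: kernel_integral[OF assms(1)])
qed

text \<open>With degree \<open>d\<close> and codegree \<open>c\<close>, symmetry makes the integrals
  of \<open>c\<close> and \<open>d^2\<close> equal, which gives the chain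
  \<open>p^2 \<le> int d^2 = int c \<le> sqrt (int c^2) = p^2\<close>. Equality forces
  \<open>d = p\<close> and \<open>c = p^2\<close> almost everywhere, whence \<open>L = K - p\<close>
  has square \<open>c - p d(x) - p d(y) + p^2 = 0\<close>.\<close>

lemma kernel_AE_const_of_moments:
  assumes K: "kernel K" and sym: "\<And>x y. x \<in> space M \<Longrightarrow> y \<in> space M \<Longrightarrow> K x y = K y x"
    and edge: "(\<integral>x. \<integral>y. K x y \<partial>M \<partial>M) = p"
    and cycle: "kip (kcomp K K) (kcomp K K) = p ^ 4"
  shows "AE (x, y) in M \<Otimes>\<^sub>M M. K x y = p"
proof -
  interpret P: prob_space "M \<Otimes>\<^sub>M M" by (rule prob_space_pair_self)
  define d where "d = (\<lambda>x. \<integral>y. K x y \<partial>M)"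
  have d: "bounded_measurable M d" unfolding d_def by (rule bounded_measurable_integral[OF K])
  define c where "c = kcomp K K"
  have c: "kernel c" unfolding c_def by (rule kernel_kcomp[OF K K])
  have "(\<integral>(x, y). c x y \<partial>(M \<Otimes>\<^sub>M M)) = (\<integral>x. \<integral>y. \<integral>z. K x z * K z y \<partial>M \<partial>M \<partial>M)"
    unfolding kernel_integral[OF c] by (simp add: c_def kcomp_def[abs_def])
  also have "\<dots> = (\<integral>x. \<integral>z. \<integral>y. K x z * K z y \<partial>M \<partial>M \<partial>M)"
  proof (rule Bochner_Integration.integral_cong[OF refl], rule kernel_integral_swap)
    fix x assume "x \<in> space M"
    then show "kernel (\<lambda>y z. K x z * K z y)"
      by (intro kernel_mult kernel_swap[OF K] kernel_snd[OF kernel_row[OF K]])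
  qed
  also have "\<dots> = (\<integral>x. \<integral>z. K x z * d z \<partial>M \<partial>M)" by (simp add: d_def)
  also have "\<dots> = (\<integral>z. \<integral>x. K x z * d z \<partial>M \<partial>M)"
    by (rule kernel_integral_swap) (intro kernel_mult K kernel_snd[OF d])
  also have "\<dots> = (\<integral>z. (d z)\<^sup>2 \<partial>M)"
  proof (rule Bochner_Integration.integral_cong[OF refl])
    fix z assume z: "z \<in> space M"
    have "(\<integral>x. K x z \<partial>M) = d z"
      unfolding d_def by (rule Bochner_Integration.integral_cong) (use sym z in auto)
    then show "(\<integral>x. K x z * d z \<partial>M) = (d z)\<^sup>2" by (simp add: power2_eq_square)
  qed
  finally have c_int: "(\<integral>(x, y). c x y \<partial>(M \<Otimes>\<^sub>M M)) = (\<integral>z. (d z)\<^sup>2 \<partial>M)" .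
  have c_sq: "(\<integral>q. (case q of (x, y) \<Rightarrow> c x y)\<^sup>2 \<partial>(M \<Otimes>\<^sub>M M)) = (p\<^sup>2)\<^sup>2"
    unfolding kip_self_pair[OF c, symmetric] using cycle by (simp add: c_def)
  have d_int: "(\<integral>x. d x \<partial>M) = p" using edge by (simp add: d_def)
  have "p\<^sup>2 \<le> (\<integral>z. (d z)\<^sup>2 \<partial>M)" using integral_power2_le[OF d] by (simp add: d_int)
  moreover have "(\<integral>z. (d z)\<^sup>2 \<partial>M)\<^sup>2 \<le> (p\<^sup>2)\<^sup>2"
    using P.integral_power2_le[OF c] by (simp only: c_int c_sq)
  then have "(\<integral>z. (d z)\<^sup>2 \<partial>M) \<le> p\<^sup>2"
    by (rule power2_le_imp_le) simp
  ultimately have d_sq: "(\<integral>z. (d z)\<^sup>2 \<partial>M) = p\<^sup>2" by simp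
  have d_ae: "AE x in M. d x = p"
    by (rule AE_eq_const_of_moments[OF d d_int d_sq])
  have "AE q in M \<Otimes>\<^sub>M M. (case q of (x, y) \<Rightarrow> c x y) = p\<^sup>2"
    by (rule P.AE_eq_const_of_moments[OF c]) (simp_all only: c_int d_sq c_sq)
  then have "AE (x, y) in M \<Otimes>\<^sub>M M. c x y = p\<^sup>2" by (simp add: case_prod_beta')
  then have c_ae: "AE x in M. AE y in M. c x y = p\<^sup>2"
    by (simp only: kernel_AE_iff[OF c])
  define L where "L = (\<lambda>x y. K x y - p)"
  have L: "kernel L" unfolding L_def by (intro kernel_diff K kernel_const)
  have LL: "kcomp L L x y = c x y - p * d x - p * d y + p\<^sup>2" if "x \<in> space M" "y \<in> space M" for x y
  proof -
    have ints: "integrable M (\<lambda>z. K x z * K z y)" "integrable M (\<lambda>z. K x z)" "integrable M (\<lambda>z. K z y)"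
      by (intro bounded_measurable_integrable bounded_measurable_mult kernel_row[OF K that(1)] kernel_col[OF K that(2)])+
    have dy: "(\<integral>z. K z y \<partial>M) = d y"
      unfolding d_def by (rule Bochner_Integration.integral_cong) (use sym that in auto)
    have "kcomp L L x y = (\<integral>z. K x z * K z y - p * K x z - p * K z y + p\<^sup>2 \<partial>M)"
      by (simp add: kcomp_def L_def algebra_simps power2_eq_square)
    also have "\<dots> = c x y - p * d x - p * d y + p\<^sup>2"
      using ints by (simp add: dy prob_space) (simp add: c_def kcomp_def d_def)
    finally show ?thesis .
  qed
  have "AE x in M. AE y in M. kcomp L L x y = 0"
    using c_ae d_ae AE_space
  proof eventually_elim
    case (elim x)
    from elim(1) d_ae AE_space show ?case
      by eventually_elim (simp add: LL elim power2_eq_square)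
  qed
  then have "AE (x, y) in M \<Otimes>\<^sub>M M. kcomp L L x y = 0"
    by (simp only: kernel_AE_iff[OF kernel_kcomp[OF L L]])
  then have "AE (x, y) in M \<Otimes>\<^sub>M M. L x y = 0"
    using sym by (intro kernel_AE_0_of_square[OF L]) (auto simp: L_def)
  then show ?thesis by (simp add: L_def)
qed

end

section \<open>Test graph densities in a graphon\<close>

lemma simple_graph_finite_edges: "simple_graph F \<Longrightarrow> finite (edges F)"
  by (rule finite_subset[of _ "Pow (verts F)"]) (auto simp: simple_graph_def)

lemma simple_graph_edge:
  fixes F :: "nat sgraph"
  assumes "simple_graph F" "e \<in> edges F"
  shows "Min e \<in> verts F" "Max e \<in> verts F" "Min e \<noteq> Max e"
proof -
  have e: "e \<subseteq> verts F" "card e = 2" using assms by (auto simp: simple_graph_def)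
  then have "finite e" "e \<noteq> {}" by (auto intro: card_ge_0_finite)
  then show "Min e \<in> verts F" "Max e \<in> verts F" using e(1) Min_in Max_in by blast+
  obtain a b where "e = {a, b}" "a \<noteq> b" using e(2) by (auto simp: card_2_iff)
  then show "Min e \<noteq> Max e" by (auto simp: min_def max_def)
qed

text \<open>Each edge fails to have value \<open>p\<close> only on a null set, and there are
  finitely many edges.\<close>

lemma graphon_density_AE_const:
  assumes W: "graphon W" and ae: "AE (x, y) in unit_leb \<Otimes>\<^sub>M unit_leb. W x y = p" and F: "simple_graph F"
  shows "graphon_density F W = p ^ card (edges F)"
proof -
  interpret P: prob_space "\<Pi>\<^sub>M v\<in>verts F. unit_leb"
    by (rule prob_space_PiM) (rule prob_space_unit_leb)
  have K: "U.kernel W" by (rule graphon_kernel[OF W])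
  have "AE x in (\<Pi>\<^sub>M v\<in>verts F. unit_leb). \<forall>e\<in>edges F. W (x (Min e)) (x (Max e)) = p"
  proof (subst AE_finite_all[OF simple_graph_finite_edges[OF F]], rule ballI)
    fix e assume "e \<in> edges F"
    note e = simple_graph_edge[OF F this]
    show "AE x in (\<Pi>\<^sub>M v\<in>verts F. unit_leb). W (x (Min e)) (x (Max e)) = p"
      using AE_distrD[OF U.measurable_PiM_pair[OF e(1,2)], unfolded U.distr_PiM_pair[OF e], OF ae] by simp
  qed
  then have "graphon_density F W = (\<integral>x. (\<Prod>e\<in>edges F. p) \<partial>(\<Pi>\<^sub>M v\<in>verts F. unit_leb))"
    unfolding graphon_density_def
    using simple_graph_edge[OF F]
    by (intro integral_cong_AE borel_measurable_prod bounded_measurableD[OF U.kernel_PiM[OF K]])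
      (auto elim!: eventually_mono)
  then show ?thesis by (simp add: P.prob_space)
qed

lemma graphon_density_edge:
  assumes W: "graphon W"
  shows "graphon_density ({0, 1}, {{0, 1}}) W = (\<integral>x. \<integral>y. W x y \<partial>unit_leb \<partial>unit_leb)"
  using U.integral_PiM_pair[OF graphon_kernel[OF W], of "0::nat" "{0, 1}" 1]
  by (simp add: graphon_density_def)

text \<open>Vertices 1 and 3 are both joined to 0 and 2 and to nothing else, so integrating out each
  of them produces one factor \<open>c (x 0) (x 2)\<close>.\<close>

lemma graphon_density_4cycle:
  assumes W: "graphon W"
  shows "graphon_density ({0, 1, 2, 3}, {{0, 1}, {1, 2}, {2, 3}, {0, 3}}) W
    = U.kip (U.kcomp W W) (U.kcomp W W)"
proof -
  interpret S: product_sigma_finite "\<lambda>_::nat. unit_leb"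
    by unfold_locales
  have K: "U.kernel W" by (rule graphon_kernel[OF W])
  define c where "c = U.kcomp W W"
  have c: "U.kernel c" unfolding c_def by (rule U.kernel_kcomp[OF K K])
  have PP: "prob_space (\<Pi>\<^sub>M v\<in>V. unit_leb)" for V :: "nat set"
    by (rule prob_space_PiM) (rule prob_space_unit_leb)
  note int = prob_space.bounded_measurable_integrable[OF PP]
  have "graphon_density ({0, 1, 2, 3}, {{0, 1}, {1, 2}, {2, 3}, {0, 3}}) W
      = (\<integral>x. W (x 0) (x 1) * W (x 1) (x 2) * (W (x 2) (x 3) * W (x 0) (x 3)) \<partial>(\<Pi>\<^sub>M v\<in>{0::nat, 1, 2, 3}. unit_leb))"
    by (simp add: graphon_density_def doubleton_eq_iff mult.assoc numeral_2_eq_2 numeral_3_eq_3)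
  also have "{0::nat, 1, 2, 3} = insert 3 {0, 1, 2}" by auto
  also have "(\<integral>x. W (x 0) (x 1) * W (x 1) (x 2) * (W (x 2) (x 3) * W (x 0) (x 3)) \<partial>(\<Pi>\<^sub>M v\<in>insert 3 {0::nat, 1, 2}. unit_leb))
      = (\<integral>x. \<integral>y. W (x 0) (x 1) * W (x 1) (x 2) * (W (x 2) y * W (x 0) y) \<partial>unit_leb \<partial>(\<Pi>\<^sub>M v\<in>{0::nat, 1, 2}. unit_leb))"
    by (subst S.product_integral_insert)
      (auto intro!: int bounded_measurable_mult U.kernel_PiM[OF K])
  also have "\<dots> = (\<integral>x. W (x 0) (x 1) * W (x 1) (x 2) * c (x 0) (x 2) \<partial>(\<Pi>\<^sub>M v\<in>{0::nat, 1, 2}. unit_leb))"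
  proof (rule Bochner_Integration.integral_cong[OF refl])
    fix x assume "x \<in> space (\<Pi>\<^sub>M v\<in>{0::nat, 1, 2}. unit_leb)"
    then have x: "x 2 \<in> {0..1}" by (auto simp: space_PiM PiE_iff)
    have "(\<integral>y. W (x 2) y * W (x 0) y \<partial>unit_leb) = c (x 0) (x 2)"
      unfolding c_def U.kcomp_def
      by (rule Bochner_Integration.integral_cong) (use graphon_sym[OF W x] in auto)
    then show "(\<integral>y. W (x 0) (x 1) * W (x 1) (x 2) * (W (x 2) y * W (x 0) y) \<partial>unit_leb)
        = W (x 0) (x 1) * W (x 1) (x 2) * c (x 0) (x 2)" by simp
  qed
  also have "{0::nat, 1, 2} = insert 1 {0, 2}" by auto
  also have "(\<integral>x. W (x 0) (x 1) * W (x 1) (x 2) * c (x 0) (x 2) \<partial>(\<Pi>\<^sub>M v\<in>insert 1 {0::nat, 2}. unit_leb))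
      = (\<integral>x. \<integral>y. W (x 0) y * W y (x 2) * c (x 0) (x 2) \<partial>unit_leb \<partial>(\<Pi>\<^sub>M v\<in>{0::nat, 2}. unit_leb))"
    by (subst S.product_integral_insert)
      (auto intro!: int bounded_measurable_mult U.kernel_PiM[OF K] U.kernel_PiM[OF c])
  also have "\<dots> = (\<integral>x. c (x 0) (x 2) * c (x 0) (x 2) \<partial>(\<Pi>\<^sub>M v\<in>{0::nat, 2}. unit_leb))"
    by (simp add: c_def U.kcomp_def)
  also have "\<dots> = U.kip c c"
    unfolding U.kip_def
    by (rule U.integral_PiM_pair[OF U.kernel_mult[OF c c]]) auto
  finally show ?thesis by (simp add: c_def insert_commute)
qed

section \<open>Homomorphisms versus injective homomorphisms\<close>

text \<open>A non-injective map identifies some pair \<open>u \<noteq> v\<close>; for a fixed pair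
  it is determined by its restriction to the vertices other than \<open>v\<close>.\<close>

lemma card_homs_diff_inj_homs:
  assumes F: "finite (verts F)" and G: "finite (verts G)"
  shows "card (homs F G - inj_homs F G) \<le> card (verts F) ^ 2 * card (verts G) ^ (card (verts F) - 1)"
proof -
  define V X where "V = verts F" and "X = verts G"
  have fin: "finite V" "finite X" using F G by (auto simp: V_def X_def)
  define E where "E = (\<lambda>(u, v). {\<phi> \<in> V \<rightarrow>\<^sub>E X. u \<noteq> v \<and> \<phi> u = \<phi> v})"
  have finE: "finite (E q)" for q
    by (rule finite_subset[OF _ finite_PiE[of V "\<lambda>_. X"]]) (auto simp: E_def fin split: prod.splits)
  have "homs F G - inj_homs F G \<subseteq> (\<Union>q\<in>V \<times> V. E q)"
    by (auto simp: homs_def inj_homs_def inj_on_def E_def V_def X_def)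
  then have "card (homs F G - inj_homs F G) \<le> card (\<Union>q\<in>V \<times> V. E q)"
    using fin finE by (intro card_mono) auto
  also have "\<dots> \<le> (\<Sum>q\<in>V \<times> V. card (E q))"
    using fin by (intro card_UN_le) auto
  also have "\<dots> \<le> (\<Sum>q\<in>V \<times> V. card X ^ (card V - 1))"
  proof (rule sum_mono)
    fix q assume "q \<in> V \<times> V"
    then obtain u v where q: "q = (u, v)" "u \<in> V" "v \<in> V" by auto
    have "inj_on (\<lambda>\<phi>. restrict \<phi> (V - {v})) (E q)"
    proof (rule inj_onI)
      fix \<phi> \<psi> assume \<phi>: "\<phi> \<in> E q" and \<psi>: "\<psi> \<in> E q"
        and eq: "restrict \<phi> (V - {v}) = restrict \<psi> (V - {v})"
      have "\<phi> i = \<psi> i" if "i \<in> V - {v}" for i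
        using fun_cong[OF eq, of i] that by (simp add: restrict_def)
      moreover have "u \<in> V - {v}" "\<phi> v = \<phi> u" "\<psi> v = \<psi> u"
        using \<phi> \<psi> q by (auto simp: E_def)
      ultimately have "\<phi> i = \<psi> i" if "i \<in> V" for i using that by (metis DiffI singletonD)
      then show "\<phi> = \<psi>" using \<phi> \<psi> by (auto simp: E_def q intro: PiE_ext)
    qed
    moreover have "(\<lambda>\<phi>. restrict \<phi> (V - {v})) ` E q \<subseteq> (V - {v}) \<rightarrow>\<^sub>E X"
    proof (rule image_subsetI)
      fix \<phi> assume "\<phi> \<in> E q"
      then have "\<phi> i \<in> X" if "i \<in> V" for i using that by (auto simp: E_def q)
      then show "restrict \<phi> (V - {v}) \<in> (V - {v}) \<rightarrow>\<^sub>E X" by (simp add: restrict_PiE_iff)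
    qed
    ultimately have "card (E q) \<le> card ((V - {v}) \<rightarrow>\<^sub>E X)"
      using fin by (intro card_inj_on_le[where f = "\<lambda>\<phi>. restrict \<phi> (V - {v})"] finite_PiE) simp_all
    also have "\<dots> = card X ^ (card V - 1)"
      using fin q by (simp add: card_PiE)
    finally show "card (E q) \<le> card X ^ (card V - 1)" .
  qed
  also have "\<dots> = card V ^ 2 * card X ^ (card V - 1)"
    by (simp add: card_cartesian_product power2_eq_square)
  finally show ?thesis by (simp add: V_def X_def)
qed

lemma hom_density_inj_diff_tendsto:
  fixes F :: "'b sgraph" and G :: "nat \<Rightarrow> 'a sgraph"
  assumes F: "finite (verts F)"
    and G: "\<And>n. n \<ge> 1 \<Longrightarrow> simple_graph (G n) \<and> card (verts (G n)) = n"
  shows "(\<lambda>n. hom_density F (G n) - real (card (inj_homs F (G n))) / real n ^ card (verts F)) \<longlonglongrightarrow> 0"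
proof (rule Lim_null_comparison)
  let ?s = "card (verts F)"
  show "(\<lambda>n. real (?s ^ 2) * inverse (real n)) \<longlonglongrightarrow> 0"
    by (intro tendsto_mult_right_zero lim_inverse_n)
  show "\<forall>\<^sub>F n in sequentially. norm (hom_density F (G n) - real (card (inj_homs F (G n))) / real n ^ ?s)
      \<le> real (?s ^ 2) * inverse (real n)"
    using eventually_ge_at_top[of 1]
  proof eventually_elim
    case (elim n)
    have Gn: "finite (verts (G n))" "card (verts (G n)) = n" using G[OF elim] by (auto simp: simple_graph_def)
    have sub: "inj_homs F (G n) \<subseteq> homs F (G n)" by (auto simp: inj_homs_def)
    have fin: "finite (homs F (G n))"
      by (rule finite_subset[OF _ finite_PiE[OF F, of "\<lambda>_. verts (G n)"]]) (auto simp: homs_def Gn)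
    have "hom_density F (G n) - real (card (inj_homs F (G n))) / real n ^ ?s
        = real (card (homs F (G n) - inj_homs F (G n))) / real n ^ ?s"
      using sub card_mono[OF fin sub] finite_subset[OF sub fin]
      by (simp add: hom_density_def Gn card_Diff_subset of_nat_diff diff_divide_distrib)
    also have "\<dots> \<le> real (?s ^ 2 * n ^ (?s - 1)) / real n ^ ?s"
      using card_homs_diff_inj_homs[OF F Gn(1)] by (intro divide_right_mono) (simp_all only: Gn of_nat_le_iff zero_le_power of_nat_0_le_iff)
    also have "\<dots> \<le> real (?s ^ 2) * inverse (real n)"
    proof (cases "?s = 0")
      case False
      then have "real n ^ ?s = real n * real n ^ (?s - 1)" by (simp add: power_eq_if)
      then show ?thesis using elim by (simp add: field_simps)
    qed simp
    finally have "hom_density F (G n) - real (card (inj_homs F (G n))) / real n ^ ?s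
        \<le> real (?s ^ 2) * inverse (real n)" .
    moreover have "0 \<le> hom_density F (G n) - real (card (inj_homs F (G n))) / real n ^ ?s"
      using card_mono[OF fin sub] by (simp add: hom_density_def Gn divide_right_mono)
    ultimately show ?case by simp
  qed
qed

lemma quasirandom_iff_hom_density:
  fixes G :: "nat \<Rightarrow> 'a sgraph"
  assumes G: "\<And>n. n \<ge> 1 \<Longrightarrow> simple_graph (G n) \<and> card (verts (G n)) = n"
  shows "quasirandom p G \<longleftrightarrow>
    (\<forall>F :: nat sgraph. simple_graph F \<longrightarrow> (\<lambda>n. hom_density F (G n)) \<longlonglongrightarrow> p ^ card (edges F))"
proof -
  have iff: "(\<lambda>n. hom_density F (G n)) \<longlonglongrightarrow> l \<longleftrightarrow>
      (\<lambda>n. real (card (inj_homs F (G n))) / real n ^ card (verts F)) \<longlonglongrightarrow> l"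
    if "simple_graph F" for F :: "nat sgraph" and l
  proof -
    have lim: "(\<lambda>n. hom_density F (G n) - real (card (inj_homs F (G n))) / real n ^ card (verts F)) \<longlonglongrightarrow> 0"
      using that by (intro hom_density_inj_diff_tendsto G) (auto simp: simple_graph_def)
    show ?thesis
      using tendsto_add[OF lim, of "\<lambda>n. real (card (inj_homs F (G n))) / real n ^ card (verts F)" l]
        tendsto_diff[OF _ lim, of "\<lambda>n. hom_density F (G n)" l] by auto
  qed
  \<comment> \<open>\<open>quasirandom\<close> speaks of nonempty graphs, left convergence also of
    the empty one; its density is constantly 1, matching \<open>p ^ 0 = 1\<close>.\<close>
  have empty: "(\<lambda>n. hom_density F (G n)) \<longlonglongrightarrow> p ^ card (edges F)"
    if "simple_graph F" "card (verts F) = 0" for F :: "nat sgraph"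
  proof -
    have "verts F = {}" using that by (auto simp: simple_graph_def)
    moreover have "edges F = {}"
    proof (rule ccontr)
      assume "edges F \<noteq> {}"
      then obtain e where "e \<in> edges F" by blast
      then have "e \<subseteq> {}" "card e = 2" using that(1) \<open>verts F = {}\<close> by (auto simp: simple_graph_def)
      then show False by simp
    qed
    ultimately show ?thesis by (simp add: hom_density_def homs_def)
  qed
  show ?thesis
  proof (intro iffI allI impI)
    fix F :: "nat sgraph" assume q: "quasirandom p G" and F: "simple_graph F"
    show "(\<lambda>n. hom_density F (G n)) \<longlonglongrightarrow> p ^ card (edges F)"
    proof (cases "card (verts F) = 0")
      case False
      then have "1 \<le> card (verts F)" by simp
      then have "(\<lambda>n. real (card (inj_homs F (G n))) / real n ^ card (verts F)) \<longlonglongrightarrow> p ^ card (edges F)"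
        using q F unfolding quasirandom_def by blast
      then show ?thesis by (simp only: iff[OF F])
    qed (rule empty[OF F])
  next
    assume h: "\<forall>F :: nat sgraph. simple_graph F \<longrightarrow> (\<lambda>n. hom_density F (G n)) \<longlonglongrightarrow> p ^ card (edges F)"
    show "quasirandom p G"
      unfolding quasirandom_def
    proof (intro allI impI)
      fix s and H :: "nat sgraph" assume H: "simple_graph H \<and> card (verts H) = s"
      then have "(\<lambda>n. hom_density H (G n)) \<longlonglongrightarrow> p ^ card (edges H)" using h by blast
      then show "(\<lambda>n. real (card (inj_homs H (G n))) / real n ^ s) \<longlonglongrightarrow> p ^ card (edges H)"
        using iff[of H] H by simp
    qed
  qed
qed

section \<open>The partition expansion\<close>

definition parts_ge2 :: "nat \<Rightarrow> nat multiset set" where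
  "parts_ge2 k = {\<Lambda>. sum_mset \<Lambda> = k \<and> (\<forall>b\<in>#\<Lambda>. 2 \<le> b)}"

text \<open>The indices \<open>i\<close> and \<open>j\<close> are read off from the partition as
  \<open>count \<Lambda> 2\<close> and \<open>size \<Lambda>\<close>, so that the double sum over
  them can become a single sum over \<open>parts_ge2 k\<close>.\<close>

definition part_weight :: "real \<Rightarrow> nat multiset \<Rightarrow> real" where
  "part_weight p \<Lambda> = (-1) ^ size \<Lambda> * p ^ (sum_mset \<Lambda> - count \<Lambda> 2) / real (eta \<Lambda>)"

definition part_coeff :: "real \<Rightarrow> nat \<Rightarrow> real" where
  "part_coeff p k = (\<Sum>\<Lambda>\<in>parts_ge2 k. part_weight p \<Lambda>)"

lemma parts_ge2_bounds:
  assumes "\<Lambda> \<in> parts_ge2 k"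
  shows "size \<Lambda> \<le> k" "count \<Lambda> b \<le> k" "b \<in># \<Lambda> \<Longrightarrow> b \<le> k"
proof -
  have "(\<forall>b\<in>#M. 2 \<le> b) \<Longrightarrow> size M \<le> sum_mset M" for M :: "nat multiset"
    by (induction M) auto
  then show "size \<Lambda> \<le> k" using assms by (auto simp: parts_ge2_def)
  then show "count \<Lambda> b \<le> k" using count_le_size[of \<Lambda> b] by linarith
  show "b \<le> k" if "b \<in># \<Lambda>"
  proof -
    obtain M where "\<Lambda> = add_mset b M" using \<open>b \<in># \<Lambda>\<close> by (metis insert_DiffM)
    then show ?thesis using assms by (auto simp: parts_ge2_def)
  qed
qed

lemma finite_parts_ge2: "finite (parts_ge2 k)"
proof (rule finite_subset)
  show "parts_ge2 k \<subseteq> mset ` {xs. set xs \<subseteq> {..k} \<and> length xs \<le> k}"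
  proof
    fix \<Lambda> assume \<Lambda>: "\<Lambda> \<in> parts_ge2 k"
    obtain xs where "mset xs = \<Lambda>" using ex_mset by blast
    with parts_ge2_bounds[OF \<Lambda>] show "\<Lambda> \<in> mset ` {xs. set xs \<subseteq> {..k} \<and> length xs \<le> k}"
      by (intro image_eqI[of _ _ xs]) auto
  qed
  show "finite (mset ` {xs. set xs \<subseteq> {..k} \<and> length xs \<le> k})"
    by (intro finite_imageI finite_lists_length_le) simp
qed

text \<open>Only index pairs in \<open>{..k} \<times> {..k}\<close> occur, which reduces the
  infinite sum to a finite one; the fibres of \<open>(count \<Lambda> 2, size \<Lambda>)\<close>
  then partition \<open>parts_ge2 k\<close>.\<close>

lemma infsum_partitions:
  "(\<Sum>\<^sub>\<infinity>(i, j)\<in>UNIV. \<Sum>\<Lambda>\<in>partitions k i j. (-1) ^ j * p ^ (k - i) / real (eta \<Lambda>)) = part_coeff p k"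
proof -
  have eq: "(\<Sum>\<Lambda>\<in>partitions k i j. (-1) ^ j * p ^ (k - i) / real (eta \<Lambda>))
      = (\<Sum>\<Lambda>\<in>{\<Lambda> \<in> parts_ge2 k. (count \<Lambda> 2, size \<Lambda>) = (i, j)}. part_weight p \<Lambda>)" for i j
    by (rule sum.cong) (auto simp: partitions_def parts_ge2_def part_weight_def)
  have "(\<Sum>\<^sub>\<infinity>(i, j)\<in>UNIV. \<Sum>\<Lambda>\<in>partitions k i j. (-1) ^ j * p ^ (k - i) / real (eta \<Lambda>))
      = (\<Sum>\<^sub>\<infinity>q\<in>{..k} \<times> {..k}. \<Sum>\<Lambda>\<in>{\<Lambda> \<in> parts_ge2 k. (count \<Lambda> 2, size \<Lambda>) = q}. part_weight p \<Lambda>)"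
  proof (rule infsum_cong_neutral)
    fix q :: "nat \<times> nat" assume q: "q \<in> UNIV - {..k} \<times> {..k}"
    have "{\<Lambda> \<in> parts_ge2 k. (count \<Lambda> 2, size \<Lambda>) = q} = {}"
      using q parts_ge2_bounds by auto
    then show "(case q of (i, j) \<Rightarrow> \<Sum>\<Lambda>\<in>partitions k i j. (-1) ^ j * p ^ (k - i) / real (eta \<Lambda>)) = 0"
      by (cases q) (simp only: eq prod.case sum.empty)
  qed (auto simp: eq)
  also have "\<dots> = (\<Sum>q\<in>{..k} \<times> {..k}. \<Sum>\<Lambda>\<in>{\<Lambda> \<in> parts_ge2 k. (count \<Lambda> 2, size \<Lambda>) = q}. part_weight p \<Lambda>)"
    by simp
  also have "\<dots> = part_coeff p k"
    unfolding part_coeff_def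
    by (rule sum.group) (use finite_parts_ge2 parts_ge2_bounds in auto)
  finally show ?thesis .
qed

section \<open>Recurrence by removing one part\<close>

lemma sum_mset_eq_sum_count:
  fixes M :: "nat multiset"
  assumes "finite A" "set_mset M \<subseteq> A"
  shows "sum_mset M = (\<Sum>b\<in>A. b * count M b)"
  using assms(2)
proof (induction M)
  case (add x M)
  have "(\<Sum>b\<in>A. b * count (add_mset x M) b) = (\<Sum>b\<in>A. b * count M b + (if b = x then x else 0))"
    by (rule sum.cong) auto
  also have "\<dots> = (\<Sum>b\<in>A. b * count M b) + x"
    using assms(1) add.prems by (simp add: sum.distrib)
  finally show ?case using add by simp
qed simp

lemma eta_superset:
  assumes "finite A" "set_mset \<Lambda> \<subseteq> A"
  shows "eta \<Lambda> = (\<Prod>b\<in>A. b ^ count \<Lambda> b * fact (count \<Lambda> b))"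
  unfolding eta_def using assms by (intro prod.mono_neutral_left) (auto simp: not_in_iff)

lemma eta_add_mset: "eta (add_mset b \<Lambda>) = eta \<Lambda> * (b * Suc (count \<Lambda> b))"
proof -
  let ?A = "insert b (set_mset \<Lambda>)"
  have "eta (add_mset b \<Lambda>) = (\<Prod>c\<in>?A. c ^ count (add_mset b \<Lambda>) c * fact (count (add_mset b \<Lambda>) c))"
    by (rule eta_superset) auto
  also have "\<dots> = (\<Prod>c\<in>?A. (c ^ count \<Lambda> c * fact (count \<Lambda> c)) * (if c = b then b * Suc (count \<Lambda> b) else 1))"
    by (rule prod.cong) (auto simp: algebra_simps)
  also have "\<dots> = (\<Prod>c\<in>?A. c ^ count \<Lambda> c * fact (count \<Lambda> c)) * (b * Suc (count \<Lambda> b))"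
    by (subst prod.distrib) simp
  also have "(\<Prod>c\<in>?A. c ^ count \<Lambda> c * fact (count \<Lambda> c)) = eta \<Lambda>"
    by (rule eta_superset[symmetric]) auto
  finally show ?thesis .
qed

text \<open>The logarithm of the characteristic power series is \<open>- (\<Sum>b\<ge>2. w b * z\<^sup>b / b)\<close>, with \<open>w\<close> the
  following weights.\<close>

definition part_size_weight :: "real \<Rightarrow> nat \<Rightarrow> real" where
  "part_size_weight p b = (if b = 2 then p else p ^ b)"

text \<open>The factor \<open>b * count\<close> on the left is exactly the factor by which
  \<open>eta\<close> grows when \<open>b\<close> is added, so it cancels. For \<open>b = 2\<close>
  the exponent grows by 1 instead of 2, because \<open>count \<Lambda> 2\<close> is subtracted;
  hence the exceptional weight \<open>p\<close>.\<close>

lemma part_weight_add_mset: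
  assumes "2 \<le> b"
  shows "real b * real (count (add_mset b \<Lambda>) b) * part_weight p (add_mset b \<Lambda>)
    = - part_size_weight p b * part_weight p \<Lambda>"
proof -
  \<comment> \<open>Keeps the natural-number subtraction in the exponent from being
    truncated.\<close>
  have "count \<Lambda> 2 \<le> sum_mset \<Lambda>"
    using sum_mset_eq_sum_count[of "insert 2 (set_mset \<Lambda>)" \<Lambda>, OF _ subset_insertI]
      member_le_sum[of 2 "insert 2 (set_mset \<Lambda>)" "\<lambda>b. b * count \<Lambda> b"] by simp
  then have "p ^ (sum_mset (add_mset b \<Lambda>) - count (add_mset b \<Lambda>) 2)
      = part_size_weight p b * p ^ (sum_mset \<Lambda> - count \<Lambda> 2)"
    by (auto simp: part_size_weight_def power_add[symmetric] Suc_diff_le)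
  then have "part_weight p (add_mset b \<Lambda>) = - (part_size_weight p b * part_weight p \<Lambda>) / (real b * real (Suc (count \<Lambda> b)))"
    by (simp add: part_weight_def eta_add_mset mult_ac del: of_nat_Suc mult_Suc mult_Suc_right)
  then show ?thesis using assms by simp
qed

text \<open>Writing \<open>k\<close> as the sum of \<open>b * count \<Lambda> b\<close> marks one
  part of each partition; removing the marked part leaves a partition of \<open>k - b\<close>. This
  is the coefficient form of the logarithmic derivative of the generating series.\<close>

lemma part_coeff_recurrence:
  "real k * part_coeff p k = - (\<Sum>b=2..k. part_size_weight p b * part_coeff p (k - b))"
proof -
  have "real k * part_coeff p k
      = (\<Sum>\<Lambda>\<in>parts_ge2 k. \<Sum>b=2..k. real b * real (count \<Lambda> b) * part_weight p \<Lambda>)"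
    unfolding part_coeff_def sum_distrib_left
  proof (rule sum.cong[OF refl])
    fix \<Lambda> assume \<Lambda>: "\<Lambda> \<in> parts_ge2 k"
    have "set_mset \<Lambda> \<subseteq> {2..k}" using \<Lambda> parts_ge2_bounds(3)[OF \<Lambda>] by (auto simp: parts_ge2_def)
    then have "k = (\<Sum>b=2..k. b * count \<Lambda> b)"
      using sum_mset_eq_sum_count[of "{2..k}" \<Lambda>] \<Lambda> by (simp add: parts_ge2_def)
    then have "real k = (\<Sum>b=2..k. real b * real (count \<Lambda> b))"
      by (metis (no_types, lifting) of_nat_mult of_nat_sum sum.cong)
    then show "real k * part_weight p \<Lambda> = (\<Sum>b=2..k. real b * real (count \<Lambda> b) * part_weight p \<Lambda>)"
      by (simp add: sum_distrib_right)
  qed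
  also have "\<dots> = (\<Sum>b=2..k. \<Sum>\<Lambda>\<in>parts_ge2 k. real b * real (count \<Lambda> b) * part_weight p \<Lambda>)"
    by (rule sum.swap)
  also have "\<dots> = (\<Sum>b=2..k. - part_size_weight p b * part_coeff p (k - b))"
  proof (rule sum.cong[OF refl])
    fix b assume b: "b \<in> {2..k}"
    have "(\<Sum>\<Lambda>\<in>parts_ge2 k. real b * real (count \<Lambda> b) * part_weight p \<Lambda>)
        = (\<Sum>\<Lambda>\<in>{\<Lambda> \<in> parts_ge2 k. b \<in># \<Lambda>}. real b * real (count \<Lambda> b) * part_weight p \<Lambda>)"
      by (rule sum.mono_neutral_right) (auto simp: finite_parts_ge2 not_in_iff)
    also have "\<dots> = (\<Sum>\<Lambda>\<in>parts_ge2 (k - b). - part_size_weight p b * part_weight p \<Lambda>)"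
    proof (rule sum.reindex_bij_witness[where i = "add_mset b" and j = "\<lambda>\<Lambda>. \<Lambda> - {#b#}"])
      fix \<Lambda> assume \<Lambda>: "\<Lambda> \<in> {\<Lambda> \<in> parts_ge2 k. b \<in># \<Lambda>}"
      then obtain N where N: "\<Lambda> = add_mset b N" by (metis (mono_tags, lifting) insert_DiffM mem_Collect_eq)
      then show "add_mset b (\<Lambda> - {#b#}) = \<Lambda>" by simp
      show "\<Lambda> - {#b#} \<in> parts_ge2 (k - b)" using \<Lambda> N by (auto simp: parts_ge2_def)
      show "- part_size_weight p b * part_weight p (\<Lambda> - {#b#}) = real b * real (count \<Lambda> b) * part_weight p \<Lambda>"
        using part_weight_add_mset[of b N p] b N by simp
    next
      fix \<Lambda> assume "\<Lambda> \<in> parts_ge2 (k - b)"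
      then show "add_mset b \<Lambda> \<in> {\<Lambda> \<in> parts_ge2 k. b \<in># \<Lambda>}" using b by (auto simp: parts_ge2_def)
    qed simp
    finally show "(\<Sum>\<Lambda>\<in>parts_ge2 k. real b * real (count \<Lambda> b) * part_weight p \<Lambda>)
        = - part_size_weight p b * part_coeff p (k - b)"
      by (simp add: part_coeff_def sum_distrib_left)
  qed
  finally show ?thesis by (simp add: sum_negf)
qed

lemma part_coeff_0: "part_coeff p 0 = 1"
proof -
  have "parts_ge2 0 = {{#}}"
    using parts_ge2_bounds(1)[of _ 0] by (auto simp: parts_ge2_def)
  then show ?thesis by (simp add: part_coeff_def part_weight_def eta_def)
qed

section \<open>The generating series as solution of a linear differential equation\<close>

text \<open>Coefficient \<open>m\<close> of the equation expresses coefficient \<open>Suc m\<close>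
  of the solution through earlier ones, and \<open>Suc m\<close> is invertible in characteristic
  0.\<close>

lemma fps_linear_ode_unique:
  fixes A B Q :: "'a :: field_char_0 fps"
  assumes "fps_deriv A = Q * A" "fps_deriv B = Q * B" "fps_nth A 0 = fps_nth B 0"
  shows "A = B"
proof (rule fps_ext)
  fix n show "fps_nth A n = fps_nth B n"
  proof (induction n rule: less_induct)
    case (less n)
    show ?case
    proof (cases n)
      case (Suc m)
      have "of_nat (Suc m) * fps_nth A (Suc m) = (\<Sum>i=0..m. fps_nth Q i * fps_nth A (m - i))"
        using assms(1)[THEN arg_cong, of "\<lambda>F. fps_nth F m"] by (simp add: fps_mult_nth)
      also have "\<dots> = (\<Sum>i=0..m. fps_nth Q i * fps_nth B (m - i))"
        using less.IH Suc by (intro sum.cong) auto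
      also have "\<dots> = of_nat (Suc m) * fps_nth B (Suc m)"
        using assms(2)[THEN arg_cong, of "\<lambda>F. fps_nth F m"] by (simp add: fps_mult_nth)
      finally show ?thesis using Suc by (simp del: of_nat_Suc)
    qed (use assms(3) in simp)
  qed
qed

text \<open>In the logarithm of the closed form the terms \<open>p z\<close> cancel, and
  \<open>- p^2 / 2 - p (1 - p) / 2 = - p / 2\<close> is the coefficient of \<open>z^2\<close>; the
  higher ones are \<open>- p^b / b\<close>. Its derivative \<open>Q\<close> is also the logarithmic
  derivative of the partition series.\<close>

lemma part_coeff_sums:
  fixes p :: real and z :: complex
  shows "(\<lambda>k. z ^ k * of_real (part_coeff p k)) sums
    ((1 - of_real p * z) * exp (of_real p * z - of_real (p * (1 - p) / 2) * z\<^sup>2))"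
proof -
  define P where "P = (of_real p :: complex)"
  define d where "d = P - P * P"
  define c where "c = d / 2"
  define f where "f = (\<lambda>z. exp (P * z - c * z\<^sup>2))"
  define E where "E = fps_expansion f 0"
  have "f holomorphic_on UNIV" unfolding f_def by (intro holomorphic_intros)
  then have E: "f has_fps_expansion E"
    unfolding E_def by (intro has_fps_expansion_fps_expansion[of UNIV]) auto
  have "(f has_field_derivative (P - d * z) * f z) (at z)" for z
    unfolding f_def c_def by (auto intro!: derivative_eq_intros)
  then have "deriv f = (\<lambda>z. (P - d * z) * f z)"
    by (auto intro!: DERIV_imp_deriv)
  moreover have "(\<lambda>z. (P - d * z) * f z) has_fps_expansion (fps_const P - fps_const d * fps_X) * E"
    by (intro fps_expansion_intros E)
  ultimately have E': "fps_deriv E = (fps_const P - fps_const d * fps_X) * E"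
    using has_fps_expansion_deriv[OF E] fps_expansion_unique_complex by metis
  define A where "A = (1 - fps_const P * fps_X) * E"
  have A: "(\<lambda>z. (1 - P * z) * f z) has_fps_expansion A"
    unfolding A_def by (intro fps_expansion_intros E)
  \<comment> \<open>Coefficient \<open>n\<close> belongs to part size \<open>n + 1\<close>; the
    entry 0 at \<open>n = 0\<close> reflects that parts of size 1 are excluded.\<close>
  define Q where "Q = Abs_fps (\<lambda>n. if n = 0 then 0 else - (of_real (part_size_weight p (Suc n)) :: complex))"
  \<comment> \<open>The logarithmic derivative \<open>- P / (1 - P z) + P - d z\<close> with the
    denominator cleared. Multiplication by \<open>1 - P z\<close> cancels the geometric tail of
    \<open>Q\<close>, so only the coefficients at 1 and 2 survive.\<close>
  have Q: "Q * (1 - fps_const P * fps_X) = - fps_const P + (1 - fps_const P * fps_X) * (fps_const P - fps_const d * fps_X)"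
  proof (rule fps_ext)
    fix n
    have lhs: "fps_nth (Q * (1 - fps_const P * fps_X)) n = fps_nth Q n - (if n = 0 then 0 else P * fps_nth Q (n - 1))"
    proof -
      have "Q * (1 - fps_const P * fps_X) = Q - fps_const P * (fps_X * Q)" by (simp add: algebra_simps)
      then show ?thesis by simp
    qed
    have r: "- fps_const P + (1 - fps_const P * fps_X) * (fps_const P - fps_const d * fps_X)
        = fps_const (- d - P * P) * fps_X + fps_const (d * P) * fps_X ^ 2"
      by (simp add: algebra_simps power2_eq_square fps_const_add[symmetric] fps_const_mult[symmetric]
          fps_const_sub[symmetric] fps_const_neg[symmetric] del: fps_const_add fps_const_mult fps_const_sub fps_const_neg)
    consider "n = 0" | "n = 1" | "n = 2" | "n \<ge> 3" by linarith
    then show "fps_nth (Q * (1 - fps_const P * fps_X)) n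
        = fps_nth (- fps_const P + (1 - fps_const P * fps_X) * (fps_const P - fps_const d * fps_X)) n"
      unfolding lhs r
      by cases (auto simp: Q_def part_size_weight_def P_def[symmetric] d_def fps_X_power_nth power_eq_if
          algebra_simps power2_eq_square numeral_3_eq_3)
  qed
  have A': "fps_deriv A = Q * A"
  proof -
    have "fps_deriv A = - fps_const P * E + (1 - fps_const P * fps_X) * fps_deriv E"
      by (simp add: A_def algebra_simps fps_const_neg[symmetric] del: fps_const_neg)
    also have "\<dots> = (- fps_const P + (1 - fps_const P * fps_X) * (fps_const P - fps_const d * fps_X)) * E"
      unfolding E' by (simp add: algebra_simps)
    also have "\<dots> = Q * A" unfolding Q[symmetric] A_def by (simp add: mult.assoc)
    finally show ?thesis .
  qed
  define C where "C = Abs_fps (\<lambda>k. of_real (part_coeff p k) :: complex)"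
  have C': "fps_deriv C = Q * C"
  proof (rule fps_ext)
    fix n
    have "of_real (real (Suc n) * part_coeff p (Suc n)) = fps_nth (Q * C) n"
    proof -
      have "fps_nth (Q * C) n = (\<Sum>i=0..n. fps_nth Q i * fps_nth C (n - i))"
        by (simp add: fps_mult_nth)
      also have "\<dots> = (\<Sum>i=1..n. fps_nth Q i * fps_nth C (n - i))"
        by (rule sum.mono_neutral_right) (auto simp: Q_def)
      also have "\<dots> = (\<Sum>b=2..Suc n. of_real (- part_size_weight p b * part_coeff p (Suc n - b)))"
        by (rule sum.reindex_bij_witness[where i = "\<lambda>b. b - 1" and j = Suc]) (auto simp: Q_def C_def)
      also have "\<dots> = of_real (real (Suc n) * part_coeff p (Suc n))"
        unfolding part_coeff_recurrence by (simp add: sum_negf)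
      finally show ?thesis by simp
    qed
    then show "fps_nth (fps_deriv C) n = fps_nth (Q * C) n" by (simp add: C_def)
  qed
  have "fps_nth A 0 = f 0"
    using has_fps_expansion_imp_0_eq_fps_nth_0[OF A] by simp
  then have "fps_nth A 0 = fps_nth C 0" by (simp add: C_def part_coeff_0 f_def)
  then have "A = C" by (rule fps_linear_ode_unique[OF A' C'])
  \<comment> \<open>The closed form is entire, so its expansion converges on the whole
    plane.\<close>
  have "(\<lambda>n. fps_nth A n * z ^ n) sums ((1 - P * z) * f z)"
    by (rule has_fps_expansion_imp_sums_complex[OF A, where r = \<infinity>])
      (auto simp: f_def intro!: holomorphic_intros)
  then show ?thesis
    unfolding \<open>A = C\<close> by (simp add: C_def f_def P_def c_def d_def mult.commute right_diff_distrib)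
qed

section \<open>The equivalence and the expansion\<close>

text \<open>The edge and the 4-cycle already determine the limit: uniqueness of limits transfers
  their densities \<open>p\<close> and \<open>p^4\<close> to \<open>W\<close>.\<close>

lemma quasirandom_limit_AE_const:
  assumes W: "graphon W" and lim: "left_converges G W"
    and G: "\<And>n. n \<ge> 1 \<Longrightarrow> simple_graph (G n) \<and> card (verts (G n)) = n"
    and q: "quasirandom p G"
  shows "AE (x, y) in unit_leb \<Otimes>\<^sub>M unit_leb. W x y = p"
proof -
  have dens: "graphon_density F W = p ^ card (edges F)" if "simple_graph F" for F
    using lim q that quasirandom_iff_hom_density[OF G] LIMSEQ_unique
    unfolding left_converges_def by blast
  show ?thesis
  proof (rule U.kernel_AE_const_of_moments)
    show "U.kernel W" by (rule graphon_kernel[OF W])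
    show "W x y = W y x" if "x \<in> space unit_leb" "y \<in> space unit_leb" for x y
      using graphon_sym[OF W] that by simp
    have "simple_graph ({0::nat, 1}, {{0, 1}})" by (simp add: simple_graph_def)
    from dens[OF this] show "(\<integral>x. \<integral>y. W x y \<partial>unit_leb \<partial>unit_leb) = p"
      by (simp only: graphon_density_edge[OF W]) simp
    have "simple_graph ({0::nat, 1, 2, 3}, {{0, 1}, {1, 2}, {2, 3}, {0, 3}})"
      by (simp add: simple_graph_def)
    from dens[OF this] show "U.kip (U.kcomp W W) (U.kcomp W W) = p ^ 4"
      by (simp only: graphon_density_4cycle[OF W]) (simp add: doubleton_eq_iff power4_eq_xxxx)
  qed
qed

theorem proposition1:
  fixes p :: real and G :: "nat \<Rightarrow> 'a sgraph"
  assumes "0 \<le> p" and "p \<le> 1"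
    and "\<And>n. n \<ge> 1 \<Longrightarrow> simple_graph (G n) \<and> card (verts (G n)) = n"
  shows "(quasirandom p G \<longleftrightarrow>
            (\<exists>W. graphon W \<and> left_converges G W \<and>
              (\<forall>z::complex. char_series W z =
                 (1 - of_real p * z) * exp (of_real p * z - of_real (p * (1 - p) / 2) * z\<^sup>2))))
       \<and> (quasirandom p G \<longrightarrow>
            (\<forall>W. graphon W \<and> left_converges G W \<longrightarrow>
              (\<forall>z::complex.
                 (\<lambda>k. z ^ k * of_real (\<Sum>\<^sub>\<infinity>(i, j)\<in>UNIV. \<Sum>\<Lambda>\<in>partitions k i j.
                        (-1) ^ j * p ^ (k - i) / real (eta \<Lambda>)))
                 sums char_series W z)))"
proof -
  let ?F = "\<lambda>z::complex. (1 - of_real p * z) * exp (of_real p * z - of_real (p * (1 - p) / 2) * z\<^sup>2)"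
  have iff: "quasirandom p G \<longleftrightarrow>
      (\<forall>F :: nat sgraph. simple_graph F \<longrightarrow> (\<lambda>n. hom_density F (G n)) \<longlonglongrightarrow> p ^ card (edges F))"
    by (rule quasirandom_iff_hom_density) (rule assms(3))
  \<comment> \<open>For a kernel almost everywhere equal to \<open>p\<close>, the limits demanded by
    left convergence are the numbers \<open>p ^ card (edges F)\<close>, which are the quasirandom
    ones.\<close>
  have AE_quasirandom: "left_converges G W \<longleftrightarrow> quasirandom p G"
    if "graphon W" "AE (x, y) in unit_leb \<Otimes>\<^sub>M unit_leb. W x y = p" for W
    unfolding left_converges_def iff using graphon_density_AE_const[OF that] by simp
  have const: "graphon (\<lambda>_ _. p)"
    using assms(1,2) by (simp add: graphon_def)
  have "quasirandom p G \<longleftrightarrow> (\<exists>W. graphon W \<and> left_converges G W \<and> (\<forall>z. char_series W z = ?F z))"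
  proof
    assume "quasirandom p G"
    then show "\<exists>W. graphon W \<and> left_converges G W \<and> (\<forall>z. char_series W z = ?F z)"
      using const AE_quasirandom[OF const] char_series_AE_const[OF const _ assms(1)]
      by (intro exI[of _ "\<lambda>_ _. p"]) simp
  next
    assume "\<exists>W. graphon W \<and> left_converges G W \<and> (\<forall>z. char_series W z = ?F z)"
    then obtain W where W: "graphon W" "left_converges G W" "\<And>z. char_series W z = ?F z" by blast
    have "AE (x, y) in unit_leb \<Otimes>\<^sub>M unit_leb. W x y = p"
      by (rule graphon_AE_const_of_char_series[OF W(1) assms(1) W(3)])
    then show "quasirandom p G" using AE_quasirandom W by blast
  qed
  moreover have "(\<lambda>k. z ^ k * of_real (part_coeff p k)) sums char_series W z"
    if "quasirandom p G" "graphon W" "left_converges G W" for W and z :: complex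
  proof -
    have "AE (x, y) in unit_leb \<Otimes>\<^sub>M unit_leb. W x y = p"
      using that assms(3) by (intro quasirandom_limit_AE_const) auto
    then show ?thesis
      using char_series_AE_const[OF that(2) _ assms(1)] part_coeff_sums[of z p] by simp
  qed
  ultimately show ?thesis
    unfolding infsum_partitions by blast
qed

end
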